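(* Consider the noise-free training setting described in the context (no label flipping, $\tau_+=\tau_-=0$) and suppose Condition (C$_0$) holds. Then, with probability at least $1-O(\delta)$ over the training data and the initialization, there exists $T_1=\Theta(\eta^{-1}nm\sigma_\xi^{-2}d^{-1})$ such that for all $T_1\le t\le T^*$, $y_if(\mathbf W^{(t)},\mathbf x_i)\ge0$ for all $i\in[n]$. In addition, there exists a time $t^*\in[T_1,T^*]$ such that the training loss converges, i.e. $L_S(\mathbf W^{(t^* )})\le\epsilon$, and 1. $y_if(\mathbf W^{(t^* )},\mathbf x_i)\ge0$ for all $i\in[n]$; 2. the test error is bounded as $L_D^{0-1}(\mathbf W^{(t^* )})\le\exp\Big(\frac dn-\frac{n\|\boldsymbol\mu\|_2^4}{C_D\sigma_\xi^4d}\Big)$ for some constant $C_D>0$.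
   Context: Data. Let $d,n,m$ be positive integers, $\boldsymbol\mu\in\mathbb R^d$ a fixed nonzero vector, $\sigma_\xi,\sigma_0,\eta,\epsilon>0$, $\delta\in(0,1)$. Training samples $i\in[n]$ are drawn independently: $y_i\in\{\pm1\}$ with $\mathbb P(y_i=1)=\mathbb P(y_i=-1)=1/2$ (the training set is assumed balanced), $\boldsymbol\xi_i\sim\mathcal N(0,\sigma_\xi^2\mathbf I_d)$, and $\mathbf x_i\in\mathbb R^{2d}$ consists of two patches, one equal to $y_i\boldsymbol\mu$ and the other to $\boldsymbol\xi_i$. Observed labels equal the true labels: $\tilde y_i=y_i$. Network. $\sigma(z)=\max\{0,z\}$, $\sigma'(z)=\mathbf 1(z\ge0)$. For $\mathbf W=\{\mathbf w_{j,r}\in\mathbb R^d\}_{j=\pm1,r\in[m]}$ and an input with signal patch $y\boldsymbol\mu$ and noise patch $\boldsymbol\xi$, $f(\mathbf W,\mathbf x)=F_{+1}-F_{-1}$ with $F_j=\frac1m\sum_{r=1}^m\big(\sigma(\langle\mathbf w_{j,r},y\boldsymbol\mu\rangle)+\sigma(\langle\mathbf w_{j,r},\boldsymbol\xi\rangle)\big)$. Initialization: $\mathbf w_{j,r}^{(0)}\sim\mathcal N(0,\sigma_0^2\mathbf I_d)$ independently. Training. Gradient descent $\mathbf w_{j,r}^{(t+1)}=\mathbf w_{j,r}^{(t)}-\eta\nabla_{\mathbf w_{j,r}}L_S(\mathbf W^{(t)})$ on $L_S(\mathbf W)=\frac1n\sum_{i=1}^n\log(1+\exp(-y_if(\mathbf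 W,\mathbf x_i)))$. Test error. $L_D^{0-1}(\mathbf W)=\mathbb P_{(\mathbf x,y)\sim\mathcal D_{\rm test}}(y\,f(\mathbf W,\mathbf x)<0)$, where under $\mathcal D_{\rm test}$ (given the training set) $y$ is uniform on $\{\pm1\}$ and $\mathbf x=[y\boldsymbol\mu,\boldsymbol\xi+\boldsymbol\zeta]$ (signal patch $y\boldsymbol\mu$, noise patch $\boldsymbol\xi+\boldsymbol\zeta$) with $\boldsymbol\xi\sim\mathrm{Unif}(\{\boldsymbol\xi_i\}_{i=1}^n)$ and $\boldsymbol\zeta\sim\mathcal N(0,\sigma_\xi^2\mathbf I_d)$ independent. Notation. $\mathrm{SNR}=\|\boldsymbol\mu\|_2/(\sigma_\xi\sqrt d)$; for given $\epsilon>0$, $T^*=\widetilde\Theta(\eta^{-1}\epsilon^{-1}nm\sigma_\xi^{-2}d^{-1})$ is the maximum number of iterations. $O,\Omega,\Theta$ hide positive constants, and tildes additionally hide logarithmic factors. Condition (C$_0$). There is a sufficiently large constant $C$ such that: (1) $n\cdot\mathrm{SNR}^2=\Theta(1)$; (2) $d\ge C\max\{n^2\log(nm/\delta)\log(T^* )^2,\ n\|\boldsymbol\mu\|_2\sigma_\xi^{-1}\sqrt{\log(n/\delta)}\}$; (3) $m\ge C\log(n/\delta)$, $n\ge C\log(m/\delta)$; (4) $\|\boldsymbol\mu\|_2^2\ge C\sigma_\xi^2\log(n/\delta)$; (5) $\sigma_0\le C^{-1}\min\{\sqrt n\,\sigma_\xi^{-1}d^{-1},\ \|\boldsymbol\mu\|_2^{-1}\log(m/\delta)^{-1/2}\}$;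 (6) $0<\eta\le C^{-1}\min\{\sigma_\xi^{-2}d^{-3/2}n^2m\sqrt{\log(n/\delta)},\ \sigma_\xi^{-2}d^{-1}n\}$. *)

theory Defs
  imports "HOL-Probability.Probability"
begin

text \<open>The constants of the theorem are uniform in the dimension \<open>d\<close> and in the width \<open>m\<close>, so both
  have to be quantified inside the formula. A vector of \<open>\<real>\<^sup>d\<close> is therefore a function
  \<open>nat \<Rightarrow> real\<close> of which only the coordinates \<open>k < d\<close> matter; samples are indexed by \<open>i < n\<close> and
  neurons by \<open>(j, r)\<close> with \<open>j \<in> {-1, 1}\<close> and \<open>r < m\<close>.\<close>

type_synonym vec = "nat \<Rightarrow> real"
type_synonym weights = "real \<times> nat \<Rightarrow> vec"

definition dot :: "nat \<Rightarrow> vec \<Rightarrow> vec \<Rightarrow> real" where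
  "dot d u v = (\<Sum>k<d. u k * v k)"

definition vnorm :: "nat \<Rightarrow> vec \<Rightarrow> real" where
  "vnorm d u = sqrt (dot d u u)"

definition vscale :: "real \<Rightarrow> vec \<Rightarrow> vec" where
  "vscale a u = (\<lambda>k. a * u k)"


section \<open>Network, loss and gradient descent\<close>

definition relu :: "real \<Rightarrow> real" where
  "relu z = max 0 z"

text \<open>The convention for the derivative at the kink is \<open>\<sigma>'(0) = 1\<close>.\<close>

definition relu' :: "real \<Rightarrow> real" where
  "relu' z = (if z \<ge> 0 then 1 else 0)"

definition neurons :: "nat \<Rightarrow> (real \<times> nat) set" where
  "neurons m = {-1, 1} \<times> {..<m}"

text \<open>Inputs are pairs (signal patch, noise patch).\<close>

definition F :: "nat \<Rightarrow> nat \<Rightarrow> weights \<Rightarrow> real \<Rightarrow> vec \<times> vec \<Rightarrow> real" where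
  "F d m W j x = 1 / real m * (\<Sum>r<m. relu (dot d (W (j, r)) (fst x)) + relu (dot d (W (j, r)) (snd x)))"

definition network :: "nat \<Rightarrow> nat \<Rightarrow> weights \<Rightarrow> vec \<times> vec \<Rightarrow> real" where
  "network d m W x = F d m W 1 x - F d m W (-1) x"

definition train_input :: "vec \<Rightarrow> (nat \<Rightarrow> real) \<Rightarrow> (nat \<Rightarrow> vec) \<Rightarrow> nat \<Rightarrow> vec \<times> vec" where
  "train_input \<mu> y \<xi> i = (vscale (y i) \<mu>, \<xi> i)"

definition logistic :: "real \<Rightarrow> real" where
  "logistic z = ln (1 + exp (- z))"

definition train_loss ::
  "nat \<Rightarrow> nat \<Rightarrow> nat \<Rightarrow> vec \<Rightarrow> (nat \<Rightarrow> real) \<Rightarrow> (nat \<Rightarrow> vec) \<Rightarrow> weights \<Rightarrow> real" where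
  "train_loss d n m \<mu> y \<xi> W =
     1 / real n * (\<Sum>i<n. logistic (y i * network d m W (train_input \<mu> y \<xi> i)))"

text \<open>Coordinate \<open>k\<close> of the gradient of the training loss with respect to \<open>w\<^sub>j\<^sub>,\<^sub>r\<close>, computed by the
  chain rule with \<open>relu'\<close> as the derivative of \<open>relu\<close>. Away from the kinks this is the actual
  partial derivative, see \<open>train_loss_has_partial_derivative\<close> below.\<close>

definition train_grad ::
  "nat \<Rightarrow> nat \<Rightarrow> nat \<Rightarrow> vec \<Rightarrow> (nat \<Rightarrow> real) \<Rightarrow> (nat \<Rightarrow> vec) \<Rightarrow> weights \<Rightarrow> weights" where
  "train_grad d n m \<mu> y \<xi> W = (\<lambda>(j, r) k.
     1 / real n * (\<Sum>i<n.
       deriv logistic (y i * network d m W (train_input \<mu> y \<xi> i)) * y i *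
       (j / real m * (relu' (dot d (W (j, r)) (vscale (y i) \<mu>)) * vscale (y i) \<mu> k
                    + relu' (dot d (W (j, r)) (\<xi> i)) * \<xi> i k))))"

primrec gd ::
  "nat \<Rightarrow> nat \<Rightarrow> nat \<Rightarrow> vec \<Rightarrow> real \<Rightarrow> (nat \<Rightarrow> real) \<Rightarrow> (nat \<Rightarrow> vec) \<Rightarrow> weights \<Rightarrow> nat \<Rightarrow> weights" where
  "gd d n m \<mu> \<eta> y \<xi> W0 0 = W0"
| "gd d n m \<mu> \<eta> y \<xi> W0 (Suc t) =
     (\<lambda>jr k. gd d n m \<mu> \<eta> y \<xi> W0 t jr k - \<eta> * train_grad d n m \<mu> y \<xi> (gd d n m \<mu> \<eta> y \<xi> W0 t) jr k)"


section \<open>Training data, initialization and test distribution\<close>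

definition gauss :: "nat \<Rightarrow> real \<Rightarrow> vec measure" where
  "gauss d s = PiM {..<d} (\<lambda>_. density lborel (\<lambda>x. ennreal (normal_density 0 s x)))"

definition label_pmf :: "real pmf" where
  "label_pmf = pmf_of_set {-1, 1}"

definition sample_space ::
  "nat \<Rightarrow> nat \<Rightarrow> nat \<Rightarrow> real \<Rightarrow> real \<Rightarrow> ((nat \<Rightarrow> real) \<times> (nat \<Rightarrow> vec) \<times> weights) measure" where
  "sample_space d n m \<sigma>\<^sub>\<xi> \<sigma>\<^sub>0 =
     PiM {..<n} (\<lambda>_. measure_pmf label_pmf) \<Otimes>\<^sub>M
     (PiM {..<n} (\<lambda>_. gauss d \<sigma>\<^sub>\<xi>) \<Otimes>\<^sub>M PiM (neurons m) (\<lambda>_. gauss d \<sigma>\<^sub>0))"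

definition balanced :: "nat \<Rightarrow> (nat \<Rightarrow> real) \<Rightarrow> bool" where
  "balanced n y \<longleftrightarrow> card {i. i < n \<and> y i = 1} = card {i. i < n \<and> y i = -1}"

text \<open>Law of \<open>(y, \<xi>, \<zeta>)\<close> for a test point; \<open>\<xi>\<close> is a uniformly chosen member of the family of
  training noise vectors.\<close>

definition test_measure ::
  "nat \<Rightarrow> nat \<Rightarrow> real \<Rightarrow> (nat \<Rightarrow> vec) \<Rightarrow> (real \<times> vec \<times> vec) measure" where
  "test_measure d n \<sigma>\<^sub>\<xi> \<xi> =
     measure_pmf label_pmf \<Otimes>\<^sub>M (measure_pmf (map_pmf \<xi> (pmf_of_set {..<n})) \<Otimes>\<^sub>M gauss d \<sigma>\<^sub>\<xi>)"

definition test_error ::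
  "nat \<Rightarrow> nat \<Rightarrow> nat \<Rightarrow> vec \<Rightarrow> real \<Rightarrow> (nat \<Rightarrow> vec) \<Rightarrow> weights \<Rightarrow> real" where
  "test_error d n m \<mu> \<sigma>\<^sub>\<xi> \<xi> W =
     \<P>((y, v, z) in test_measure d n \<sigma>\<^sub>\<xi> \<xi>. y * network d m W (vscale y \<mu>, \<lambda>k. v k + z k) < 0)"


section \<open>Parameter regime\<close>

definition SNR :: "nat \<Rightarrow> vec \<Rightarrow> real \<Rightarrow> real" where
  "SNR d \<mu> \<sigma>\<^sub>\<xi> = vnorm d \<mu> / (\<sigma>\<^sub>\<xi> * sqrt (real d))"

definition time_scale :: "nat \<Rightarrow> nat \<Rightarrow> nat \<Rightarrow> real \<Rightarrow> real \<Rightarrow> real" where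
  "time_scale d n m \<sigma>\<^sub>\<xi> \<eta> = real n * real m / (\<eta> * \<sigma>\<^sub>\<xi>\<^sup>2 * real d)"

text \<open>The quantity whose powers are the logarithmic factors hidden by a tilde; it is at least 1.\<close>

definition log_factor :: "nat \<Rightarrow> nat \<Rightarrow> nat \<Rightarrow> real \<Rightarrow> real \<Rightarrow> real" where
  "log_factor d n m \<epsilon> \<delta> = ln (exp 1 + real n * real m * real d / (\<delta> * \<epsilon>))"

text \<open>Condition (C\<open>\<^sub>0\<close>) with the constant \<open>C\<close>; \<open>a\<close> and \<open>b\<close> are the constants hidden in
  \<open>n SNR\<^sup>2 = \<Theta>(1)\<close>, and \<open>T\<close> is the maximum number of iterations.\<close>

definition condition_C0 ::
  "real \<Rightarrow> real \<Rightarrow> real \<Rightarrow> nat \<Rightarrow> nat \<Rightarrow> nat \<Rightarrow> vec \<Rightarrow> real \<Rightarrow> real \<Rightarrow> real \<Rightarrow> real \<Rightarrow> nat \<Rightarrow> bool" where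
  "condition_C0 a b C d n m \<mu> \<sigma>\<^sub>\<xi> \<sigma>\<^sub>0 \<eta> \<delta> T \<longleftrightarrow>
     a \<le> real n * (SNR d \<mu> \<sigma>\<^sub>\<xi>)\<^sup>2 \<and> real n * (SNR d \<mu> \<sigma>\<^sub>\<xi>)\<^sup>2 \<le> b \<and>
     real d \<ge> C * max ((real n)\<^sup>2 * ln (real n * real m / \<delta>) * (ln (real T))\<^sup>2)
                      (real n * vnorm d \<mu> / \<sigma>\<^sub>\<xi> * sqrt (ln (real n / \<delta>))) \<and>
     real m \<ge> C * ln (real n / \<delta>) \<and> real n \<ge> C * ln (real m / \<delta>) \<and>
     (vnorm d \<mu>)\<^sup>2 \<ge> C * \<sigma>\<^sub>\<xi>\<^sup>2 * ln (real n / \<delta>) \<and>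
     \<sigma>\<^sub>0 \<le> 1 / C * min (sqrt (real n) / (\<sigma>\<^sub>\<xi> * real d))
                      (1 / (vnorm d \<mu> * sqrt (ln (real m / \<delta>)))) \<and>
     0 < \<eta> \<and>
     \<eta> \<le> 1 / C * min ((real n)\<^sup>2 * real m * sqrt (ln (real n / \<delta>)) / (\<sigma>\<^sub>\<xi>\<^sup>2 * real d powr (3 / 2)))
                     (real n / (\<sigma>\<^sub>\<xi>\<^sup>2 * real d))"


section \<open>The gradient formula is the gradient away from the kinks\<close>

lemma relu_has_derivative:
  assumes "z \<noteq> 0"
  shows "(relu has_real_derivative relu' z) (at z)"
proof (cases "z > 0")
  case True
  have "(relu has_real_derivative 1) (at z)"
    by (rule has_field_derivative_transform_within_open[where S = "{0<..}" and f = "\<lambda>x. x"])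
       (use True in \<open>auto simp: relu_def\<close>)
  with True show ?thesis by (simp add: relu'_def)
next
  case False
  have "(relu has_real_derivative 0) (at z)"
    by (rule has_field_derivative_transform_within_open[where S = "{..<0}" and f = "\<lambda>x. 0"])
       (use False assms in \<open>auto simp: relu_def\<close>)
  with False assms show ?thesis by (simp add: relu'_def)
qed

lemma logistic_has_derivative: "(logistic has_real_derivative deriv logistic z) (at z)"
proof -
  have "(logistic has_real_derivative (- exp (- z) / (1 + exp (- z)))) (at z)"
    unfolding logistic_def
    by (auto intro!: derivative_eq_intros simp: add_pos_pos)
  then show ?thesis by (simp add: DERIV_imp_deriv)
qed

lemma dot_update_has_derivative:
  assumes "k < d"
  shows "((\<lambda>s. dot d (w(k := s)) x) has_real_derivative x k) (at s)"
proof -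
  have "dot d (w(k := s)) x = s * x k + (\<Sum>l\<in>{..<d} - {k}. w l * x l)" for s
    using assms unfolding dot_def
    by (subst sum.remove[of _ k]) auto
  then show ?thesis by (auto intro!: derivative_eq_intros)
qed

lemma F_update_has_derivative:
  assumes "r < m" "k < d" "dot d (W (j, r)) (fst x) \<noteq> 0" "dot d (W (j, r)) (snd x) \<noteq> 0"
  shows "((\<lambda>s. F d m (W((j, r) := (W (j, r))(k := s))) j' x) has_real_derivative
      (if j' = j then 1 / real m * (relu' (dot d (W (j, r)) (fst x)) * fst x k
          + relu' (dot d (W (j, r)) (snd x)) * snd x k) else 0)) (at (W (j, r) k))"
proof (cases "j' = j")
  case False
  then show ?thesis by (simp add: F_def)
next
  case True
  let ?g = "\<lambda>s. relu (dot d ((W (j, r))(k := s)) (fst x)) + relu (dot d ((W (j, r))(k := s)) (snd x))"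
  have eq: "F d m (W((j, r) := (W (j, r))(k := s))) j x = 1 / real m * (?g s +
      (\<Sum>q\<in>{..<m} - {r}. relu (dot d (W (j, q)) (fst x)) + relu (dot d (W (j, q)) (snd x))))" for s
    using assms(1) unfolding F_def by (subst sum.remove[of _ r]) auto
  have 1: "((\<lambda>s. relu (dot d ((W (j, r))(k := s)) u)) has_real_derivative
      relu' (dot d (W (j, r)) u) * u k) (at (W (j, r) k))"
    if "dot d (W (j, r)) u \<noteq> 0" for u
    by (rule DERIV_chain2[where f = relu])
       (use that relu_has_derivative dot_update_has_derivative[OF assms(2)] in auto)
  show ?thesis unfolding True eq
    by (rule DERIV_cong, (rule derivative_intros 1 assms(3,4))+) auto
qed

lemma train_loss_has_partial_derivative:
  assumes "(j, r) \<in> neurons m" "k < d"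
    and "\<And>i. i < n \<Longrightarrow> dot d (W (j, r)) (vscale (y i) \<mu>) \<noteq> 0"
    and "\<And>i. i < n \<Longrightarrow> dot d (W (j, r)) (\<xi> i) \<noteq> 0"
  shows "((\<lambda>s. train_loss d n m \<mu> y \<xi> (W((j, r) := (W (j, r))(k := s)))) has_real_derivative
      train_grad d n m \<mu> y \<xi> W (j, r) k) (at (W (j, r) k))"
proof -
  let ?U = "\<lambda>s. W((j, r) := (W (j, r))(k := s))"
  let ?D = "\<lambda>i. j / real m * (relu' (dot d (W (j, r)) (vscale (y i) \<mu>)) * vscale (y i) \<mu> k
                    + relu' (dot d (W (j, r)) (\<xi> i)) * \<xi> i k)"
  have j: "j = 1 \<or> j = -1" and r: "r < m" using assms(1) by (auto simp: neurons_def)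
  have net: "((\<lambda>s. network d m (?U s) (train_input \<mu> y \<xi> i)) has_real_derivative ?D i) (at (W (j, r) k))"
    if "i < n" for i
  proof -
    note FD = F_update_has_derivative[OF r assms(2), of W j "train_input \<mu> y \<xi> i"]
    have "((\<lambda>s. network d m (?U s) (train_input \<mu> y \<xi> i)) has_real_derivative
       ((if 1 = j then ?D i / j else 0) - (if -1 = j then ?D i / j else 0))) (at (W (j, r) k))"
      unfolding network_def
      by (rule DERIV_diff; rule DERIV_cong[OF FD])
         (use assms(3,4)[OF that] j in \<open>auto simp: train_input_def\<close>)
    moreover have "(if 1 = j then ?D i / j else 0) - (if -1 = j then ?D i / j else 0) = ?D i"
      using j by (elim disjE; simp add: divide_simps)
    ultimately show ?thesis by simp
  qed
  have summand: "((\<lambda>s. logistic (y i * network d m (?U s) (train_input \<mu> y \<xi> i))) has_real_derivative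
      deriv logistic (y i * network d m W (train_input \<mu> y \<xi> i)) * (y i * ?D i)) (at (W (j, r) k))"
    if "i < n" for i
    by (rule DERIV_chain2[where f = logistic])
       (use logistic_has_derivative DERIV_cmult[OF net[OF that], of "y i"] in auto)
  show ?thesis
    unfolding train_loss_def train_grad_def prod.case
    by (rule DERIV_cmult, rule DERIV_cong, rule DERIV_sum, rule summand) (auto simp: mult.assoc)
qed

end

theory Submission
  imports Defs
begin

text \<open>All bounds are phrased through the cumulative logistic derivatives \<open>a\<^sub>i = h \<Sum>\<^sub>\<tau> l\<^sub>i\<close>, which dominate the
  noise coefficients of every neuron. On an event of probability \<open>1 - O(\<delta>)\<close> all inner products other
  than \<open>\<parallel>\<xi>\<^sub>i\<parallel>\<^sup>2\<close> and \<open>\<parallel>\<mu>\<parallel>\<^sup>2\<close> are so small that the margin of sample \<open>i\<close> is the mean signal coefficient of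
  its class plus the mean noise coefficient of the sample, up to a small constant, as long as
  \<open>a\<^sub>i = O(log T)\<close>. A quarter of the neurons is active on \<open>\<xi>\<^sub>i\<close> initially and stays active, so the
  margin is at least \<open>a\<^sub>i / 8\<close> minus a small constant; hence \<open>exp (a\<^sub>i / 8)\<close> grows at most linearly in time, which
  closes the induction. The margins are nonnegative once \<open>a\<^sub>i\<close> has reached a constant, at time
  \<open>\<Theta>(1 / h)\<close>. A loss above \<open>\<epsilon>\<close> up to time \<open>T\<close> would make the mean of the \<open>a\<^sub>i\<close> linear in \<open>\<epsilon> h T\<close>,
  contradicting their logarithmic growth.

  The test bound is at least 1 when \<open>s = n SNR\<^sup>2\<close> is below a universal constant. For larger
  \<open>s\<close>, the signal coefficients of both classes solve comparable difference equations and dominate: each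
  \<open>a\<^sub>i\<close> is \<open>O(1 / s)\<close> times the signal coefficient. A neuron can be fooled only by a deviation of \<open>\<langle>w, \<zeta>\<rangle>\<close> of order
  \<open>sqrt (s d / n)\<close> standard deviations, and the union bound over the neurons is paid for by the
  factor \<open>exp (d / n)\<close>.\<close>

section \<open>Gradient descent near initialization\<close>

text \<open>The analysis is perturbative, but fixed error constants do not suffice: an active neuron
  must stay active from the first step on, while its own noise coefficient is still tiny. Deviations
  are therefore measured against an arbitrary upper bound \<open>A\<close> of the accumulated
  derivatives, so that the error and the coefficient that has to dominate it both grow linearly up
  to time 1 / h. The ratio of their rates depends on the smallest logistic derivative during that
  time, \<open>c\<^sub>0\<close>, hence on the upper bound b of n SNR^2. This fixes the tolerance
  \<nu>, and with it the constant of Condition (C0), as functions of b alone.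

  In terms of s the test bound has the exponent (d / n) - (d / n) s^2 / C_D, quadratic in s, while
  the Gaussian tails yield only (d / n) - (d / n) s / 64000, linear in s. As s \<le> max 1 b, a C_D
  proportional to max 1 b turns one into the other. The signals of the two classes must be
  comparable because the neurons that oppose a test point grow with the signal of the other
  class.\<close>

lemma deriv_logistic: "deriv logistic z = - 1 / (1 + exp z)"
proof -
  have "(logistic has_real_derivative (- exp (- z) / (1 + exp (- z)))) (at z)"
    unfolding logistic_def
    by (auto intro!: derivative_eq_intros simp: add_pos_pos)
  moreover have "- exp (- z) / (1 + exp (- z)) = - 1 / (1 + exp z)"
    by (simp add: exp_minus field_simps)
  ultimately show ?thesis by (simp add: DERIV_imp_deriv)
qed

lemma logistic_le: "logistic z \<le> exp (- z)"
  unfolding logistic_def using ln_add_one_self_le_self[of "exp (- z)"] by simp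

lemma dot_vscale_right: "dot d u (vscale c v) = c * dot d u v"
  by (simp add: dot_def vscale_def sum_distrib_left algebra_simps)

lemma dot_commute: "dot d u v = dot d v u"
  by (simp add: dot_def mult.commute)

lemma dot_add_right: "dot d u (\<lambda>k. v k + z k) = dot d u v + dot d u z"
  by (simp add: dot_def algebra_simps sum.distrib)

lemma relu_nonneg: "0 \<le> relu x"
  by (simp add: relu_def)

text \<open>\<open>relu\<close> is 1-Lipschitz and fixes \<open>z\<close>.\<close>

lemma relu_diff_le: "0 \<le> z \<Longrightarrow> \<bar>relu x - z\<bar> \<le> \<bar>x - z\<bar>"
  by (auto simp: relu_def max_def)

lemma relu_add_le: "relu (x + z) \<le> relu x + relu z"
  by (auto simp: relu_def max_def)

lemma relu'_bounds: "0 \<le> relu' x" "relu' x \<le> 1"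
  by (simp_all add: relu'_def)

lemma abs_average_le:
  fixes e :: "nat \<Rightarrow> real"
  assumes "0 < m" "\<And>r. r < m \<Longrightarrow> \<bar>e r\<bar> \<le> c"
  shows "\<bar>1 / real m * (\<Sum>r<m. e r)\<bar> \<le> c"
proof -
  have "\<bar>\<Sum>r<m. e r\<bar> \<le> (\<Sum>r<m. c)"
    by (rule order_trans[OF sum_abs], rule sum_mono) (use assms in auto)
  then show ?thesis using assms(1) by (simp add: abs_mult field_simps)
qed

section \<open>Gradient descent in coefficient form\<close>

locale gd_run =
  fixes d n m :: nat and \<mu> :: vec and \<sigma> \<eta> :: real and y :: "nat \<Rightarrow> real"
    and \<xi> :: "nat \<Rightarrow> vec" and W0 :: weights
  assumes d_pos: "0 < d" and n_pos: "0 < n" and m_pos: "0 < m"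
    and \<sigma>_pos: "0 < \<sigma>" and \<eta>_pos: "0 < \<eta>" and \<mu>_pos: "0 < dot d \<mu> \<mu>"
    and labels: "\<And>i. i < n \<Longrightarrow> y i = 1 \<or> y i = -1"
begin

text \<open>Time is measured in units of \<open>1 / h\<close>, the time scale of the theorem, and \<open>s\<close> is \<open>n SNR\<^sup>2\<close>. The
  weights are \<open>W0\<close> plus a combination of \<open>\<mu>\<close> and the \<open>\<xi> i\<close> with nonnegative coefficients that are,
  up to signs, \<open>g\<close> for the signal and \<open>p\<close> for the noise, see \<open>W_eq\<close>. The cumulative logistic
  derivative \<open>a i t\<close> is the value of \<open>p\<close> at a neuron that has always been active on sample \<open>i\<close>.\<close>

definition "W t = gd d n m \<mu> \<eta> y \<xi> W0 t"
definition "M i t = y i * network d m (W t) (train_input \<mu> y \<xi> i)"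
definition "l i t = 1 / (1 + exp (M i t))"
definition "q = \<sigma>\<^sup>2 * real d"
definition "h = \<eta> * q / (real n * real m)"
definition "s = real n * dot d \<mu> \<mu> / q"
definition "a i t = h * (\<Sum>\<tau><t. l i \<tau>)"
definition "p w i t = h * (\<Sum>\<tau><t. l i \<tau> * relu' (dot d (W \<tau> w) (\<xi> i)))"
definition "g w t = h * s / real n *
  (\<Sum>\<tau><t. \<Sum>i<n. l i \<tau> * relu' (dot d (W \<tau> w) (vscale (y i) \<mu>)))"
definition "\<Gamma> j t = 1 / real m * (\<Sum>r<m. g (j, r) t)"
definition "X i = dot d (\<xi> i) (\<xi> i) / q"
definition "P i t = 1 / real m * (\<Sum>r<m. p (y i, r) i t * X i)"

lemma q_pos: "0 < q" using \<sigma>_pos d_pos by (simp add: q_def)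
lemma h_pos: "0 < h" using q_pos \<eta>_pos n_pos m_pos by (simp add: h_def)
lemma s_pos: "0 < s" using q_pos \<mu>_pos n_pos by (simp add: s_def)

lemma y_sq: "i < n \<Longrightarrow> y i * y i = 1"
  using labels[of i] by auto

lemma abs_y: "i < n \<Longrightarrow> \<bar>y i\<bar> = 1"
  using labels[of i] by auto

lemma l_pos: "0 < l i t" by (simp add: l_def add_pos_pos)
lemma l_nonneg: "0 \<le> l i t" using l_pos[of i t] by simp
lemma l_less_1: "l i t < 1" by (simp add: l_def add_pos_pos)

lemma l_le_exp: "l i t \<le> exp (- M i t)"
  by (simp add: l_def exp_minus field_simps add_pos_pos)

lemma l_ge: assumes "M i t \<le> x" shows "1 / (1 + exp x) \<le> l i t"
  unfolding l_def using assms by (intro divide_left_mono) (auto intro!: mult_pos_pos add_pos_pos)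

lemma a_0: "a i 0 = 0" by (simp add: a_def)
lemma a_Suc: "a i (Suc t) = a i t + h * l i t" by (simp add: a_def algebra_simps)

lemma a_Suc_le: "a i (Suc t) \<le> a i t + h"
  using l_less_1[of i t] h_pos by (simp add: a_Suc mult_left_le)

lemma a_mono_Suc: "a i t \<le> a i (Suc t)"
  using l_pos[of i t] h_pos by (simp add: a_Suc)

lemma a_nonneg: "0 \<le> a i t"
  unfolding a_def using l_pos h_pos
  by (intro mult_nonneg_nonneg sum_nonneg) (auto intro: less_imp_le)

lemma a_le_time: "a i t \<le> h * real t"
proof (induction t)
  case (Suc t)
  then show ?case using a_Suc_le[of i t] by (simp add: algebra_simps)
qed (simp add: a_0)

lemma p_nonneg: "0 \<le> p w i t"
  unfolding p_def using l_pos h_pos relu'_bounds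
  by (intro mult_nonneg_nonneg sum_nonneg) (auto intro: less_imp_le)

lemma p_le_a: "p w i t \<le> a i t"
  unfolding p_def a_def using l_pos h_pos relu'_bounds
  by (intro mult_left_mono sum_mono) (auto intro!: mult_left_le less_imp_le)

lemma p_eq_a:
  assumes "\<And>\<tau>. \<tau> < t \<Longrightarrow> 0 \<le> dot d (W \<tau> w) (\<xi> i)"
  shows "p w i t = a i t"
  unfolding p_def a_def using assms by (simp add: relu'_def)

lemma g_0: "g w 0 = 0" by (simp add: g_def)

lemma g_Suc: "g w (Suc t) = g w t +
    h * s / real n * (\<Sum>i<n. l i t * relu' (dot d (W t w) (vscale (y i) \<mu>)))"
  by (simp add: g_def algebra_simps)

lemma g_nonneg: "0 \<le> g w t"
  using l_pos h_pos s_pos relu'_bounds unfolding g_def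
  by (intro mult_nonneg_nonneg sum_nonneg) (auto intro!: less_imp_le)

lemma g_le: "g w t \<le> s / real n * (\<Sum>i<n. a i t)"
proof -
  have "g w t \<le> h * s / real n * (\<Sum>\<tau><t. \<Sum>i<n. l i \<tau>)"
    unfolding g_def using l_pos h_pos s_pos relu'_bounds
    by (intro mult_left_mono sum_mono) (auto intro!: mult_left_le less_imp_le)
  also have "(\<Sum>\<tau><t. \<Sum>i<n. l i \<tau>) = (\<Sum>i<n. \<Sum>\<tau><t. l i \<tau>)"
    by (rule sum.swap)
  also have "h * s / real n * \<dots> = s / real n * (\<Sum>i<n. a i t)"
    by (simp add: a_def sum_distrib_left[symmetric])
  finally show ?thesis .
qed

lemma g_le_bound:
  assumes "\<And>k. k < n \<Longrightarrow> a k t \<le> A"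
  shows "g w t \<le> s * A"
proof -
  have "(\<Sum>i<n. a i t) \<le> (\<Sum>i<n. A)" using assms by (intro sum_mono) auto
  then have "s / real n * (\<Sum>i<n. a i t) \<le> s / real n * (real n * A)"
    using s_pos by (intro mult_left_mono) auto
  then show ?thesis using g_le[of w t] n_pos by simp
qed

lemma \<Gamma>_nonneg: "0 \<le> \<Gamma> j t"
  unfolding \<Gamma>_def using g_nonneg by (intro mult_nonneg_nonneg sum_nonneg) auto

lemma \<Gamma>_le_bound:
  assumes "\<And>k. k < n \<Longrightarrow> a k t \<le> A"
  shows "\<Gamma> j t \<le> s * A"
proof -
  have "(\<Sum>r<m. g (j, r) t) \<le> (\<Sum>r<m. s * A)" using g_le_bound[OF assms] by (intro sum_mono) auto
  then show ?thesis using m_pos by (simp add: \<Gamma>_def field_simps)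
qed

text \<open>The label occurs twice in the signal part of the gradient, once from the loss and once
  from the patch, and cancels: every sample pushes neuron (j, r) along j * \<mu>, whatever its
  class. In the noise part the label survives. Both coefficients are thus sums of nonnegative terms
  and never decrease.\<close>

lemma W_eq:
  "W t (j, r) k = W0 (j, r) k + j * g (j, r) t * \<mu> k / dot d \<mu> \<mu>
     + j / q * (\<Sum>i<n. y i * p (j, r) i t * \<xi> i k)"
proof (induction t)
  case 0
  then show ?case by (simp add: W_def g_def p_def)
next
  case (Suc t)
  let ?A = "\<lambda>i. l i t * relu' (dot d (W t (j, r)) (vscale (y i) \<mu>))"
  let ?B = "\<lambda>i. l i t * relu' (dot d (W t (j, r)) (\<xi> i))"
  have 1: "deriv logistic (y i * network d m (W t) (train_input \<mu> y \<xi> i)) = - l i t" for i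
    by (simp add: deriv_logistic l_def M_def)
  have "\<eta> * train_grad d n m \<mu> y \<xi> (W t) (j, r) k =
     - (\<eta> * j / (real n * real m)) * (\<Sum>i<n. l i t * y i *
        (relu' (dot d (W t (j, r)) (vscale (y i) \<mu>)) * (y i * \<mu> k)
         + relu' (dot d (W t (j, r)) (\<xi> i)) * \<xi> i k))"
    unfolding train_grad_def 1
    by (simp add: vscale_def sum_negf sum_distrib_left mult_ac)
  also have "(\<Sum>i<n. l i t * y i *
        (relu' (dot d (W t (j, r)) (vscale (y i) \<mu>)) * (y i * \<mu> k)
         + relu' (dot d (W t (j, r)) (\<xi> i)) * \<xi> i k))
     = (\<Sum>i<n. ?A i * \<mu> k + y i * ?B i * \<xi> i k)"
  proof (rule sum.cong, simp)
    fix i assume "i \<in> {..<n}"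
    then have "y i * y i = 1" by (simp add: y_sq)
    then have "l i t * y i * (x * (y i * \<mu> k) + z * \<xi> i k) = l i t * x * \<mu> k + y i * (l i t * z) * \<xi> i k" for x z
      by algebra
    then show "l i t * y i * (relu' (dot d (W t (j, r)) (vscale (y i) \<mu>)) * (y i * \<mu> k)
         + relu' (dot d (W t (j, r)) (\<xi> i)) * \<xi> i k) = ?A i * \<mu> k + y i * ?B i * \<xi> i k" by simp
  qed
  also have "\<dots> = (\<Sum>i<n. ?A i) * \<mu> k + (\<Sum>i<n. y i * ?B i * \<xi> i k)"
    by (simp add: sum.distrib sum_distrib_right)
  finally have G: "\<eta> * train_grad d n m \<mu> y \<xi> (W t) (j, r) k =
     - (\<eta> * j / (real n * real m)) * ((\<Sum>i<n. ?A i) * \<mu> k + (\<Sum>i<n. y i * ?B i * \<xi> i k))" .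
  have "h * s / real n / dot d \<mu> \<mu> = \<eta> / (real n * real m)"
    using n_pos m_pos q_pos \<mu>_pos by (simp add: h_def s_def field_simps)
  then have 2: "j * (h * s / real n * S) * \<mu> k / dot d \<mu> \<mu> = \<eta> * j / (real n * real m) * (S * \<mu> k)" for S
    by (metis (no_types, lifting) mult.assoc mult.commute times_divide_eq_left times_divide_eq_right)
  have "p (j, r) i (Suc t) = p (j, r) i t + h * ?B i" for i
    by (simp add: p_def algebra_simps)
  then have "(\<Sum>i<n. y i * p (j, r) i (Suc t) * \<xi> i k) =
      (\<Sum>i<n. y i * p (j, r) i t * \<xi> i k) + h * (\<Sum>i<n. y i * ?B i * \<xi> i k)"
    by (simp add: sum_distrib_left sum.distrib[symmetric] algebra_simps)
  moreover have "j / q * (h * S) = \<eta> * j / (real n * real m) * S" for S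
    using q_pos by (simp add: h_def field_simps)
  ultimately have 3: "j / q * (\<Sum>i<n. y i * p (j, r) i (Suc t) * \<xi> i k) =
      j / q * (\<Sum>i<n. y i * p (j, r) i t * \<xi> i k) + \<eta> * j / (real n * real m) * (\<Sum>i<n. y i * ?B i * \<xi> i k)"
    by (simp add: distrib_left)
  have "W (Suc t) (j, r) k = W t (j, r) k - \<eta> * train_grad d n m \<mu> y \<xi> (W t) (j, r) k"
    by (simp add: W_def)
  also have "\<dots> = W0 (j, r) k + j * g (j, r) (Suc t) * \<mu> k / dot d \<mu> \<mu>
     + j / q * (\<Sum>i<n. y i * p (j, r) i (Suc t) * \<xi> i k)"
    unfolding Suc.IH G 3 g_Suc
    using 2[of "\<Sum>i<n. ?A i"] by (simp add: distrib_left distrib_right add_divide_distrib)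
  finally show ?case .
qed

lemma dot_W:
  "dot d (W t (j, r)) v = dot d (W0 (j, r)) v + j * g (j, r) t * (dot d \<mu> v / dot d \<mu> \<mu>)
     + j / q * (\<Sum>i<n. y i * p (j, r) i t * dot d (\<xi> i) v)"
proof -
  have "W t (j, r) k * v k = W0 (j, r) k * v k + j * g (j, r) t / dot d \<mu> \<mu> * (\<mu> k * v k)
     + j / q * (\<Sum>i<n. y i * p (j, r) i t * (\<xi> i k * v k))" for k
  proof -
    have "(\<Sum>i<n. y i * p (j, r) i t * (\<xi> i k * v k)) = (\<Sum>i<n. y i * p (j, r) i t * \<xi> i k) * v k"
      by (simp add: sum_distrib_right mult.assoc)
    then show ?thesis by (simp only: W_eq) (simp add: algebra_simps)
  qed
  then have "dot d (W t (j, r)) v = (\<Sum>k<d. W0 (j, r) k * v k) + (\<Sum>k<d. j * g (j, r) t / dot d \<mu> \<mu> * (\<mu> k * v k))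
     + (\<Sum>k<d. j / q * (\<Sum>i<n. y i * p (j, r) i t * (\<xi> i k * v k)))"
    by (simp add: dot_def sum.distrib)
  also have "(\<Sum>k<d. j / q * (\<Sum>i<n. y i * p (j, r) i t * (\<xi> i k * v k))) =
      j / q * (\<Sum>i<n. \<Sum>k<d. y i * p (j, r) i t * (\<xi> i k * v k))"
    by (subst sum_distrib_left[symmetric], subst sum.swap) simp
  finally show ?thesis
    by (simp add: dot_def sum_distrib_left sum_divide_distrib)
qed

end

text \<open>Randomness enters only through these inequalities, so the analysis of training is
  deterministic. \<alpha> caps the cumulative derivatives; one half of \<nu> is reserved for the
  initialization and one half for the accumulated cross terms. As \<nu> is
  \<open>c\<^sub>0 / 256\<close>, the margin error 4 * \<nu> stays below
  \<open>c\<^sub>0 / 8\<close>, which active neurons contribute from time 1 / h on.\<close>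

locale good_run = gd_run +
  fixes T :: nat and b \<alpha> \<nu> \<epsilon>\<^sub>1 \<epsilon>\<^sub>2 :: real
  assumes half: "\<And>j. j = 1 \<or> j = -1 \<Longrightarrow> real (card {i. i < n \<and> y i = j}) = real n / 2"
    and \<xi>_sq: "\<And>i. i < n \<Longrightarrow> q / 2 \<le> dot d (\<xi> i) (\<xi> i) \<and> dot d (\<xi> i) (\<xi> i) \<le> 2 * q"
    and \<xi>_\<xi>: "\<And>i k. i < n \<Longrightarrow> k < n \<Longrightarrow> k \<noteq> i \<Longrightarrow> \<bar>dot d (\<xi> k) (\<xi> i)\<bar> \<le> \<epsilon>\<^sub>1 * q"
    and \<mu>_\<xi>: "\<And>i. i < n \<Longrightarrow> \<bar>dot d \<mu> (\<xi> i)\<bar> \<le> \<epsilon>\<^sub>2 * dot d \<mu> \<mu>"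
    and W0_\<xi>: "\<And>j r i. j = 1 \<or> j = -1 \<Longrightarrow> r < m \<Longrightarrow> i < n \<Longrightarrow> \<bar>dot d (W0 (j, r)) (\<xi> i)\<bar> \<le> \<nu> / 2"
    and W0_\<mu>: "\<And>j r. j = 1 \<or> j = -1 \<Longrightarrow> r < m \<Longrightarrow> \<bar>dot d (W0 (j, r)) \<mu>\<bar> \<le> \<nu> / 2"
    and active: "\<And>i. i < n \<Longrightarrow> real m / 4 \<le> real (card {r. r < m \<and> 0 \<le> dot d (W0 (y i, r)) (\<xi> i)})"
    and b_ge: "1 \<le> b" "s \<le> b"
    and h_small: "s * h \<le> 1 / 64" "h \<le> 1"
    and \<alpha>_ge: "1 \<le> \<alpha>" "8 * ln (1 + h * real T) \<le> \<alpha>"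
    and \<epsilon>_nonneg: "0 \<le> \<epsilon>\<^sub>1" "0 \<le> \<epsilon>\<^sub>2"
    and \<epsilon>_small: "(s * \<epsilon>\<^sub>2 + real n * \<epsilon>\<^sub>1) * \<alpha> \<le> \<nu> / 2"
    and \<nu>_eq: "\<nu> = 1 / (256 * (1 + exp (b + 3)))"
begin

section \<open>Inner products and margins up to small errors\<close>

definition "c\<^sub>0 = 1 / (1 + exp (b + 3))"

lemma c0: "0 < c\<^sub>0" "c\<^sub>0 \<le> 1" "\<nu> = c\<^sub>0 / 256"
  by (simp_all add: c\<^sub>0_def \<nu>_eq add_pos_pos)

lemma \<nu>_bounds: "0 < \<nu>" "\<nu> \<le> 1 / 256" using c0 by auto

lemma X_bounds: assumes "i < n" shows "1 / 2 \<le> X i" "X i \<le> 2"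
  using \<xi>_sq[OF assms] q_pos by (auto simp: X_def field_simps)

text \<open>What remains are the contributions of \<mu> and of the other samples, which are nearly
  orthogonal to \<xi> i. The bound is proportional to \<open>A\<close>, and \<open>W0\<close> is
  kept on the left, so that early in training the error of an initially active neuron can be
  compared with its own small coefficient.\<close>

lemma noise_deviation:
  assumes j: "j = 1 \<or> j = -1" and i: "i < n" and A: "\<And>k. k < n \<Longrightarrow> a k t \<le> A"
  shows "\<bar>dot d (W t (j, r)) (\<xi> i) - dot d (W0 (j, r)) (\<xi> i) - j * y i * (p (j, r) i t * X i)\<bar>
    \<le> (s * \<epsilon>\<^sub>2 + real n * \<epsilon>\<^sub>1) * A"
proof -
  have A0: "0 \<le> A" using A[OF i] a_nonneg[of i t] by simp
  let ?S = "\<Sum>k\<in>{..<n} - {i}. y k * p (j, r) k t * dot d (\<xi> k) (\<xi> i)"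
  have "(\<Sum>k<n. y k * p (j, r) k t * dot d (\<xi> k) (\<xi> i)) = y i * p (j, r) i t * dot d (\<xi> i) (\<xi> i) + ?S"
    using i by (subst sum.remove[of _ i]) auto
  then have eq: "dot d (W t (j, r)) (\<xi> i) - dot d (W0 (j, r)) (\<xi> i) - j * y i * (p (j, r) i t * X i)
      = j * (g (j, r) t * (dot d \<mu> (\<xi> i) / dot d \<mu> \<mu>) + ?S / q)"
    using q_pos by (simp add: dot_W X_def field_simps)
  have "\<bar>?S\<bar> \<le> (\<Sum>k\<in>{..<n} - {i}. A * (\<epsilon>\<^sub>1 * q))"
  proof (rule order_trans[OF sum_abs], rule sum_mono)
    fix k assume k: "k \<in> {..<n} - {i}"
    have "\<bar>p (j, r) k t\<bar> \<le> A" using A[of k] p_nonneg[of "(j, r)" k t] p_le_a[of "(j, r)" k t] k by auto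
    moreover have "\<bar>dot d (\<xi> k) (\<xi> i)\<bar> \<le> \<epsilon>\<^sub>1 * q" using \<xi>_\<xi>[of i k] i k by auto
    ultimately have "\<bar>p (j, r) k t\<bar> * \<bar>dot d (\<xi> k) (\<xi> i)\<bar> \<le> A * (\<epsilon>\<^sub>1 * q)"
      using A0 by (intro mult_mono) auto
    then show "\<bar>y k * p (j, r) k t * dot d (\<xi> k) (\<xi> i)\<bar> \<le> A * (\<epsilon>\<^sub>1 * q)"
      using abs_y[of k] k by (simp add: abs_mult)
  qed
  also have "\<dots> \<le> real n * (A * (\<epsilon>\<^sub>1 * q))"
    using A0 \<epsilon>_nonneg q_pos i by (auto intro!: mult_right_mono)
  finally have S: "\<bar>?S / q\<bar> \<le> real n * \<epsilon>\<^sub>1 * A"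
    using q_pos by (simp add: field_simps abs_divide)
  have "\<bar>dot d \<mu> (\<xi> i) / dot d \<mu> \<mu>\<bar> \<le> \<epsilon>\<^sub>2" using \<mu>_\<xi>[OF i] \<mu>_pos by (simp add: abs_divide field_simps)
  moreover have "\<bar>g (j, r) t\<bar> \<le> s * A" using g_le_bound[OF A, of "(j, r)"] g_nonneg[of "(j, r)" t] by simp
  ultimately have "\<bar>g (j, r) t\<bar> * \<bar>dot d \<mu> (\<xi> i) / dot d \<mu> \<mu>\<bar> \<le> s * A * \<epsilon>\<^sub>2"
    using A0 s_pos by (intro mult_mono) auto
  then have "\<bar>g (j, r) t * (dot d \<mu> (\<xi> i) / dot d \<mu> \<mu>)\<bar> \<le> s * A * \<epsilon>\<^sub>2"
    by (simp only: abs_mult)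
  with S have "\<bar>g (j, r) t * (dot d \<mu> (\<xi> i) / dot d \<mu> \<mu>) + ?S / q\<bar> \<le> s * A * \<epsilon>\<^sub>2 + real n * \<epsilon>\<^sub>1 * A"
    by linarith
  moreover have "\<bar>j\<bar> = 1" using j by auto
  ultimately show ?thesis unfolding eq by (simp only: abs_mult mult_1 distrib_right) (simp only: mult_ac)
qed

text \<open>Each of the n noise terms is at most \<open>A * \<epsilon>\<^sub>2\<close> times
  |\<mu>|^2 / q, and n |\<mu>|^2 / q = s.\<close>

lemma signal_deviation:
  assumes j: "j = 1 \<or> j = -1" and A: "\<And>k. k < n \<Longrightarrow> a k t \<le> A"
  shows "\<bar>j * dot d (W t (j, r)) \<mu> - j * dot d (W0 (j, r)) \<mu> - g (j, r) t\<bar> \<le> s * \<epsilon>\<^sub>2 * A"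
proof -
  have A0: "0 \<le> A" using A[OF n_pos] a_nonneg[of 0 t] by simp
  let ?S = "\<Sum>k<n. y k * p (j, r) k t * dot d (\<xi> k) \<mu>"
  have jj: "j * j = 1" using j by auto
  have "j * dot d (W t (j, r)) \<mu> = j * dot d (W0 (j, r)) \<mu> + (j * j) * g (j, r) t * (dot d \<mu> \<mu> / dot d \<mu> \<mu>) + (j * j) / q * ?S"
    unfolding dot_W by (simp add: algebra_simps)
  then have eq: "j * dot d (W t (j, r)) \<mu> - j * dot d (W0 (j, r)) \<mu> - g (j, r) t = ?S / q"
    using jj \<mu>_pos by simp
  have "\<bar>?S\<bar> \<le> (\<Sum>k<n. A * (\<epsilon>\<^sub>2 * dot d \<mu> \<mu>))"
  proof (rule order_trans[OF sum_abs], rule sum_mono)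
    fix k assume k: "k \<in> {..<n}"
    have "\<bar>p (j, r) k t\<bar> \<le> A" using A[of k] p_nonneg[of "(j, r)" k t] p_le_a[of "(j, r)" k t] k by auto
    moreover have "\<bar>dot d (\<xi> k) \<mu>\<bar> \<le> \<epsilon>\<^sub>2 * dot d \<mu> \<mu>"
      using \<mu>_\<xi>[of k] k by (simp add: dot_commute[of d "\<xi> k"])
    ultimately have "\<bar>p (j, r) k t\<bar> * \<bar>dot d (\<xi> k) \<mu>\<bar> \<le> A * (\<epsilon>\<^sub>2 * dot d \<mu> \<mu>)"
      using A0 by (intro mult_mono) auto
    then show "\<bar>y k * p (j, r) k t * dot d (\<xi> k) \<mu>\<bar> \<le> A * (\<epsilon>\<^sub>2 * dot d \<mu> \<mu>)"
      using abs_y[of k] k by (simp add: abs_mult)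
  qed
  then have "\<bar>?S / q\<bar> \<le> real n * (A * (\<epsilon>\<^sub>2 * dot d \<mu> \<mu>)) / q"
    using q_pos by (simp add: abs_divide divide_right_mono)
  also have "\<dots> = s * \<epsilon>\<^sub>2 * A" by (simp add: s_def)
  finally show ?thesis unfolding eq .
qed

definition "bounded_at t \<longleftrightarrow> (\<forall>k<n. a k t \<le> \<alpha>)"

lemma noise_bound:
  assumes "bounded_at t" "j = 1 \<or> j = -1" "r < m" "i < n"
  shows "\<bar>dot d (W t (j, r)) (\<xi> i) - j * y i * (p (j, r) i t * X i)\<bar> \<le> \<nu>"
  using noise_deviation[of j i t \<alpha> r] assms W0_\<xi>[of j r i] \<epsilon>_small unfolding bounded_at_def by auto

lemma signal_bound:
  assumes "bounded_at t" "j = 1 \<or> j = -1" "r < m"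
  shows "\<bar>j * dot d (W t (j, r)) \<mu> - g (j, r) t\<bar> \<le> \<nu>"
proof -
  have "\<bar>j * dot d (W0 (j, r)) \<mu>\<bar> \<le> \<nu> / 2" using W0_\<mu>[OF assms(2,3)] assms(2) by (auto simp: abs_mult)
  moreover have "s * \<epsilon>\<^sub>2 * \<alpha> \<le> (s * \<epsilon>\<^sub>2 + real n * \<epsilon>\<^sub>1) * \<alpha>"
    using \<epsilon>_nonneg \<alpha>_ge by (intro mult_right_mono) auto
  ultimately show ?thesis
    using signal_deviation[of j t \<alpha> r] assms \<epsilon>_small unfolding bounded_at_def by auto
qed

text \<open>Four terms per index r, each with an error of at most \<nu>. For the sign j = y i the
  two activations reproduce \<open>g\<close> and \<open>p * X\<close>. For the sign -j both
  coefficients enter the inner products negatively, so the rectifier cuts them off and at most \<nu>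
  is left.\<close>

lemma margin_approx:
  assumes B: "bounded_at t" and i: "i < n"
  shows "\<bar>M i t - (\<Gamma> (y i) t + P i t)\<bar> \<le> 4 * \<nu>"
proof -
  define j where "j = y i"
  have j: "j = 1 \<or> j = -1" "- j = 1 \<or> - j = -1" using labels[OF i] by (auto simp: j_def)
  have jj: "j * j = 1" using j by auto
  let ?S = "\<lambda>j r. relu (dot d (W t (j, r)) (vscale (y i) \<mu>))"
  let ?N = "\<lambda>j r. relu (dot d (W t (j, r)) (\<xi> i))"
  let ?e = "\<lambda>r. (?S j r - g (j, r) t) + (?N j r - p (j, r) i t * X i) - ?S (- j) r - ?N (- j) r"
  have "M i t = F d m (W t) j (train_input \<mu> y \<xi> i) - F d m (W t) (- j) (train_input \<mu> y \<xi> i)"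
    using j unfolding M_def network_def j_def by auto
  then have "M i t - (\<Gamma> (y i) t + P i t) = 1 / real m * (\<Sum>r<m. ?e r)"
    unfolding F_def train_input_def \<Gamma>_def P_def fst_conv snd_conv j_def[symmetric]
    by (simp add: sum.distrib sum_subtractf right_diff_distrib distrib_left)
  moreover have "\<bar>?e r\<bar> \<le> 4 * \<nu>" if r: "r < m" for r
  proof -
    have 1: "dot d (W t (j, r)) (vscale (y i) \<mu>) = j * dot d (W t (j, r)) \<mu>"
      by (simp add: dot_vscale_right j_def)
    have 2: "dot d (W t (- j, r)) (vscale (y i) \<mu>) = - ((- j) * dot d (W t (- j, r)) \<mu>)"
      by (simp add: dot_vscale_right j_def)
    have "\<bar>?S j r - g (j, r) t\<bar> \<le> \<nu>"
      unfolding 1 by (rule order_trans[OF relu_diff_le signal_bound[OF B j(1) r]]) (rule g_nonneg)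
    moreover have pX: "0 \<le> p (w, r) i t * X i" for w
      using p_nonneg X_bounds[OF i] by (intro mult_nonneg_nonneg) auto
    have "\<bar>?N j r - p (j, r) i t * X i\<bar> \<le> \<nu>"
      using order_trans[OF relu_diff_le[OF pX] , of "dot d (W t (j, r)) (\<xi> i)" j \<nu>] noise_bound[OF B j(1) r i] jj
      by (simp add: j_def)
    moreover have "?S (- j) r \<le> \<nu>"
      unfolding 2 using signal_bound[OF B j(2) r] g_nonneg[of "(- j, r)" t] \<nu>_bounds
      by (auto simp: relu_def)
    moreover have "?N (- j) r \<le> \<nu>"
    proof -
      have "- j * y i = -1" using jj by (simp add: j_def)
      then have "dot d (W t (- j, r)) (\<xi> i) \<le> \<nu>"
        using noise_bound[OF B j(2) r i] pX[of "- j"] by auto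
      then show ?thesis using \<nu>_bounds by (simp add: relu_def)
    qed
    ultimately show ?thesis using relu_nonneg[of "dot d (W t (- j, r)) (vscale (y i) \<mu>)"]
        relu_nonneg[of "dot d (W t (- j, r)) (\<xi> i)"] by linarith
  qed
  ultimately show ?thesis using abs_average_le[OF m_pos, of ?e "4 * \<nu>"] by simp
qed

section \<open>Persistent activity and logarithmic growth of the cumulative derivatives\<close>

lemma P_le: assumes "i < n" shows "P i t \<le> 2 * a i t"
proof -
  have "p (y i, r) i t * X i \<le> a i t * 2" for r
    using p_le_a[of "(y i, r)" i t] X_bounds[OF assms] a_nonneg[of i t] by (intro mult_mono) auto
  then have "(\<Sum>r<m. p (y i, r) i t * X i) \<le> (\<Sum>r<m. a i t * 2)" by (intro sum_mono) auto
  then show ?thesis using m_pos by (simp add: P_def field_simps)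
qed

text \<open>Time \<open>t\<close> is excluded because \<open>p w i t\<close> collects the activity
  at the times before \<open>t\<close>.\<close>

definition "active_until i t \<longleftrightarrow> (\<forall>r<m. 0 \<le> dot d (W0 (y i, r)) (\<xi> i) \<longrightarrow>
   (\<forall>\<tau><t. 0 \<le> dot d (W \<tau> (y i, r)) (\<xi> i)))"

text \<open>One eighth is the active quarter of the neurons times the lower bound 1 / 2 for
  \<open>X i\<close>.\<close>

lemma P_ge: assumes i: "i < n" and act: "active_until i t" shows "a i t / 8 \<le> P i t"
proof -
  let ?R = "{r. r < m \<and> 0 \<le> dot d (W0 (y i, r)) (\<xi> i)}"
  have "real m / 4 * (a i t / 2) \<le> real (card ?R) * (a i t / 2)"
    using active[OF i] a_nonneg[of i t] by (intro mult_right_mono) auto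
  also have "\<dots> = (\<Sum>r\<in>?R. a i t / 2)" by simp
  also have "\<dots> \<le> (\<Sum>r\<in>?R. p (y i, r) i t * X i)"
  proof (rule sum_mono)
    fix r assume "r \<in> ?R"
    then have "p (y i, r) i t = a i t" using act by (intro p_eq_a) (auto simp: active_until_def)
    then show "a i t / 2 \<le> p (y i, r) i t * X i"
      using mult_left_mono[OF X_bounds(1)[OF i] a_nonneg[of i t]] by simp
  qed
  also have "\<dots> \<le> (\<Sum>r<m. p (y i, r) i t * X i)"
    using p_nonneg X_bounds[OF i] by (intro sum_mono2) (auto intro!: mult_nonneg_nonneg)
  finally show ?thesis using m_pos by (simp add: P_def field_simps)
qed

text \<open>Up to time 1 / h no cumulative derivative exceeds 1, so the margin is at most s + 2 + 4
  * \<nu> \<le> b + 3. This is where b + 3 in \<open>c\<^sub>0\<close> comes from.\<close>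

lemma l_ge_c0:
  assumes i: "i < n" and t: "h * real t \<le> 1" and B: "bounded_at t"
  shows "c\<^sub>0 \<le> l i t"
proof -
  have at: "a k t \<le> 1" for k using a_le_time[of k t] t by simp
  have "M i t \<le> \<Gamma> (y i) t + P i t + 4 * \<nu>" using margin_approx[OF B i] by auto
  also have "\<dots> \<le> s + 2 + 4 * \<nu>"
  proof -
    have "\<Gamma> (y i) t \<le> s" using \<Gamma>_le_bound[of t 1 "y i"] at by simp
    moreover have "P i t \<le> 2" using P_le[OF i, of t] at[of i] by linarith
    ultimately show ?thesis by linarith
  qed
  also have "\<dots> \<le> b + 3" using \<nu>_bounds b_ge by linarith
  finally show ?thesis unfolding c\<^sub>0_def by (rule l_ge)
qed

text \<open>Growth at rate at least \<open>c\<^sub>0\<close> up to time 1 / h, monotonicity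
  afterwards.\<close>

lemma a_lower:
  assumes i: "i < n" and B: "\<And>\<tau>. \<tau> < t \<Longrightarrow> bounded_at \<tau>"
  shows "c\<^sub>0 * min (h * real t) 1 \<le> a i t"
  using B
proof (induction t)
  case 0
  then show ?case by (simp add: a_0)
next
  case (Suc t)
  then have IH: "c\<^sub>0 * min (h * real t) 1 \<le> a i t" by simp
  show ?case
  proof (cases "h * real t \<le> 1")
    case True
    have "c\<^sub>0 \<le> l i t" using l_ge_c0[OF i True] Suc.prems by simp
    then have "h * c\<^sub>0 \<le> h * l i t" using h_pos by simp
    then have "c\<^sub>0 * (h * real (Suc t)) \<le> a i (Suc t)" using IH True by (simp add: a_Suc algebra_simps)
    moreover have "c\<^sub>0 * min (h * real (Suc t)) 1 \<le> c\<^sub>0 * (h * real (Suc t))"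
      using c0 by (intro mult_left_mono) auto
    ultimately show ?thesis by linarith
  next
    case False
    have "c\<^sub>0 * min (h * real (Suc t)) 1 \<le> c\<^sub>0 * 1" using c0 by (intro mult_left_mono) auto
    then show ?thesis using IH False a_mono_Suc[of i t] by simp
  qed
qed

text \<open>Discrete form of (exp (a / 8))' = exp (a / 8) * l / 8. The factor \<open>x\<close>
  leaves room for further decay of the derivative: it is 1 in the proof of the logarithmic growth
  and exp (- G) in the comparison with the signal.\<close>

lemma exp_a_step:
  assumes "l i t \<le> exp 1 * exp (- a i t / 8) * x" "0 \<le> x"
  shows "exp (a i (Suc t) / 8) \<le> exp (a i t / 8) + h * x"
proof -
  have hl: "0 \<le> h * l i t" "h * l i t \<le> 1"
    using h_pos l_pos[of i t] l_less_1[of i t] h_small mult_mono[of h 1 "l i t" 1] by auto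
  have "exp (h * l i t / 8) \<le> 1 + h * l i t / 8 + (h * l i t / 8)\<^sup>2"
    using hl by (intro exp_bound) auto
  also have "(h * l i t / 8)\<^sup>2 \<le> h * l i t / 8"
    using hl mult_left_le[of "h * l i t / 8" "h * l i t / 8"] by (simp add: power2_eq_square)
  finally have e: "exp (h * l i t / 8) \<le> 1 + h * l i t / 4" by simp
  have "exp (a i (Suc t) / 8) = exp (a i t / 8) * exp (h * l i t / 8)"
    by (simp add: a_Suc exp_add[symmetric] add_divide_distrib)
  also have "\<dots> \<le> exp (a i t / 8) * (1 + h * l i t / 4)" using e by (intro mult_left_mono) auto
  also have "\<dots> = exp (a i t / 8) + h / 4 * (exp (a i t / 8) * l i t)" by (simp add: algebra_simps)
  also have "exp (a i t / 8) * l i t \<le> exp (a i t / 8) * (exp 1 * exp (- a i t / 8) * x)"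
    using assms by (intro mult_left_mono) auto
  also have "\<dots> = exp 1 * x" by (simp add: exp_minus)
  also have "h / 4 * (exp 1 * x) \<le> h / 4 * (4 * x)"
    using h_pos assms(2) exp_le by (intro mult_left_mono mult_right_mono) auto
  finally show ?thesis using h_pos by simp
qed

text \<open>The cross terms compete with the neuron's own coefficient a i t. Up to time 1 / h both
  are bounded linearly in time, with rates \<nu> / 2 and \<open>c\<^sub>0\<close>. Later the
  coefficient is at least \<open>c\<^sub>0\<close>, while the cap \<alpha> keeps the cross terms
  below \<nu> / 2.\<close>

lemma active_step:
  assumes i: "i < n" and B: "\<And>\<tau>. \<tau> \<le> t \<Longrightarrow> bounded_at \<tau>" and act: "active_until i t"
  shows "active_until i (Suc t)"
proof -
  have "0 \<le> dot d (W t (y i, r)) (\<xi> i)" if r: "r < m" "0 \<le> dot d (W0 (y i, r)) (\<xi> i)" for r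
  proof -
    let ?e = "s * \<epsilon>\<^sub>2 + real n * \<epsilon>\<^sub>1" and ?A = "min (h * real t) \<alpha>" and ?m = "min (h * real t) 1"
    have e0: "0 \<le> ?e" using s_pos \<epsilon>_nonneg by auto
    have ht: "0 \<le> h * real t" using h_pos by simp
    have A: "a k t \<le> ?A" if "k < n" for k using a_le_time[of k t] B[of t] that by (auto simp: bounded_at_def)
    have pa: "p (y i, r) i t = a i t" using act r by (intro p_eq_a) (auto simp: active_until_def)
    have e1: "?e \<le> \<nu> / 2" using \<epsilon>_small mult_left_mono[OF \<alpha>_ge(1) e0] by simp
    have "?e * ?A \<le> \<nu> / 2 * ?m"
    proof (cases "h * real t \<le> 1")
      case True
      then have "?A = h * real t" "?m = h * real t" using \<alpha>_ge by auto
      then show ?thesis using mult_right_mono[OF e1 ht] by simp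
    next
      case False
      have "?e * ?A \<le> ?e * \<alpha>" using e0 by (intro mult_left_mono) auto
      then show ?thesis using False \<epsilon>_small by simp
    qed
    also have "\<dots> \<le> c\<^sub>0 / 2 * ?m" using ht c0 by (intro mult_right_mono) auto
    also have "\<dots> \<le> a i t * (1 / 2)" using a_lower[OF i, of t] B by simp
    also have "\<dots> \<le> a i t * X i" using X_bounds[OF i] a_nonneg by (intro mult_left_mono) auto
    finally have "?e * ?A \<le> y i * y i * (p (y i, r) i t * X i)" using pa y_sq[OF i] by simp
    then show ?thesis using noise_deviation[OF labels[OF i] i A, of r] r by auto
  qed
  then show ?thesis using act unfolding active_until_def by (auto simp: less_Suc_eq)
qed

lemma margin_ge:
  assumes "i < n" "bounded_at t" "active_until i t"
  shows "\<Gamma> (y i) t + a i t / 8 - 4 * \<nu> \<le> M i t"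
  using margin_approx[OF assms(2,1)] P_ge[OF assms(1,3)] by auto

text \<open>The three claims need each other: activity gives the lower bound on the margin, which
  limits the growth of exp (a / 8) to h per step and so yields the cap \<alpha> at the next time;
  the cap keeps the neurons active there. \<open>Suc t\<close> makes the activity claim include time
  \<open>t\<close> itself.\<close>

lemma invariant:
  assumes "t \<le> T"
  shows "(\<forall>\<tau>\<le>t. bounded_at \<tau>) \<and> (\<forall>i<n. active_until i (Suc t) \<and> exp (a i t / 8) \<le> 1 + h * real t)"
  using assms
proof (induction t)
  case 0
  have "bounded_at 0" using \<alpha>_ge by (simp add: bounded_at_def a_0)
  moreover have "active_until i 0" for i by (simp add: active_until_def)
  ultimately show ?case using active_step[of _ 0] by (simp add: a_0)
next
  case (Suc t)
  then have B: "bounded_at \<tau>" if "\<tau> \<le> t" for \<tau> using that by simp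
  have act: "active_until i (Suc t)" if "i < n" for i using Suc that by simp
  then have act': "active_until i t" if "i < n" for i using that by (auto simp: active_until_def)
  have ex: "exp (a i (Suc t) / 8) \<le> 1 + h * real (Suc t)" if i: "i < n" for i
  proof -
    have "l i t \<le> exp (- (a i t / 8 - 1))"
      using l_le_exp[of i t] margin_ge[OF i B[OF order_refl] act'[OF i]] \<Gamma>_nonneg[of "y i" t] \<nu>_bounds
      by (elim order_trans) simp
    then have "l i t \<le> exp 1 * exp (- a i t / 8) * 1" by (simp add: exp_add[symmetric])
    from exp_a_step[OF this] have "exp (a i (Suc t) / 8) \<le> exp (a i t / 8) + h" by simp
    moreover have "exp (a i t / 8) \<le> 1 + h * real t" using Suc i by simp
    ultimately show ?thesis by (simp add: distrib_left)
  qed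
  have "a i (Suc t) \<le> \<alpha>" if i: "i < n" for i
  proof -
    have pos: "0 < 1 + h * real (Suc t)" using h_pos by (intro add_pos_nonneg) auto
    have "a i (Suc t) / 8 \<le> ln (1 + h * real (Suc t))"
      using ex[OF i] by (simp only: ln_ge_iff[OF pos])
    also have "\<dots> \<le> ln (1 + h * real T)"
      using pos Suc.prems h_pos by (intro ln_mono) (auto intro!: mult_left_mono)
    finally show ?thesis using \<alpha>_ge by simp
  qed
  then have B': "bounded_at (Suc t)" by (simp add: bounded_at_def)
  then have "bounded_at \<tau>" if "\<tau> \<le> Suc t" for \<tau> using B that by (auto simp: le_Suc_eq)
  then show ?case using active_step act ex by blast
qed

lemma bounded: "t \<le> T \<Longrightarrow> bounded_at t"
  using invariant by blast

lemma active_until: assumes "t \<le> T" "i < n" shows "active_until i t"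
  using invariant[OF assms(1)] assms(2) unfolding active_until_def by (meson less_SucI)

lemma margin_nonneg:
  assumes "1 \<le> h * real t" "t \<le> T" "i < n"
  shows "0 \<le> M i t"
proof -
  have "c\<^sub>0 * min (h * real t) 1 \<le> a i t" using bounded assms by (intro a_lower) auto
  then have "c\<^sub>0 \<le> a i t" using assms by simp
  then show ?thesis
    using margin_ge[OF assms(3) bounded[OF assms(2)] active_until[OF assms(2,3)]] \<Gamma>_nonneg[of "y i" t] c0 by simp
qed

section \<open>A time of small training loss\<close>

lemma train_loss_eq: "train_loss d n m \<mu> y \<xi> (W t) = 1 / real n * (\<Sum>i<n. logistic (M i t))"
  by (simp add: train_loss_def M_def)

text \<open>This passes from the loss to the quantity whose sum over time is under control. For a
  nonnegative margin 1 + exp M is at most 2 * exp M.\<close>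

lemma logistic_le_2l: assumes "0 \<le> M i t" shows "logistic (M i t) \<le> 2 * l i t"
proof -
  have "exp (- M i t) \<le> 2 * l i t"
  proof -
    have "exp (- M i t) * (1 + exp (M i t)) = exp (- M i t) + 1" by (simp add: algebra_simps exp_minus)
    also have "\<dots> \<le> 2" using assms by simp
    finally show ?thesis by (simp add: l_def field_simps add_pos_pos)
  qed
  then show ?thesis using logistic_le[of "M i t"] by simp
qed

lemma small_loss_time:
  assumes T1: "1 \<le> h * real T1" "h * real T1 \<le> 2" "T1 \<le> T"
    and \<epsilon>: "0 < \<epsilon>" "8 * ln (1 + h * real T) < (h * real T - 2) * \<epsilon> / 2"
  shows "\<exists>t. T1 \<le> t \<and> t \<le> T \<and> train_loss d n m \<mu> y \<xi> (W t) \<le> \<epsilon>"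
proof (rule ccontr)
  assume neg: "\<not> ?thesis"
  have L: "\<epsilon> < train_loss d n m \<mu> y \<xi> (W t)" if "T1 \<le> t" "t \<le> T" for t
    by (rule ccontr, rule notE[OF neg], intro exI[of _ t]) (simp add: that not_less)
  \<comment> \<open>The factor 1 / 2 is the price for replacing the loss by logistic derivatives,
    which is possible once all margins are nonnegative.\<close>
  have gt: "real n * \<epsilon> / 2 \<le> (\<Sum>i<n. l i t)" if t: "T1 \<le> t" "t \<le> T" for t
  proof -
    have "h * real T1 \<le> h * real t" using t h_pos by (intro mult_left_mono) auto
    then have "0 \<le> M i t" if "i < n" for i using margin_nonneg[of t i] t T1 that by linarith
    then have "(\<Sum>i<n. logistic (M i t)) \<le> (\<Sum>i<n. 2 * l i t)"
      by (intro sum_mono logistic_le_2l) auto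
    moreover have "real n * \<epsilon> < (\<Sum>i<n. logistic (M i t))"
      using L[OF t] n_pos unfolding train_loss_eq by (simp add: field_simps)
    ultimately show ?thesis by (simp add: sum_distrib_left[symmetric])
  qed
  have "h * (real (T - T1) * (real n * \<epsilon> / 2)) = h * (\<Sum>t\<in>{T1..<T}. real n * \<epsilon> / 2)" by simp
  also have "\<dots> \<le> h * (\<Sum>t\<in>{T1..<T}. \<Sum>i<n. l i t)"
    using h_pos gt by (intro mult_left_mono sum_mono) auto
  also have "\<dots> \<le> h * (\<Sum>t<T. \<Sum>i<n. l i t)"
    using h_pos l_nonneg by (intro mult_left_mono sum_mono2) (auto intro: sum_nonneg)
  also have "\<dots> = (\<Sum>i<n. a i T)" unfolding a_def by (subst sum.swap) (simp add: sum_distrib_left)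
  also have "\<dots> \<le> (\<Sum>i<n. 8 * ln (1 + h * real T))"
  proof (rule sum_mono)
    fix i assume "i \<in> {..<n}"
    then have "exp (a i T / 8) \<le> 1 + h * real T" using invariant[of T] by simp
    moreover have "0 < 1 + h * real T" using h_pos by (intro add_pos_nonneg) auto
    ultimately have "a i T / 8 \<le> ln (1 + h * real T)" by (simp only: ln_ge_iff)
    then show "a i T \<le> 8 * ln (1 + h * real T)" by simp
  qed
  finally have "real n * (h * real (T - T1) * \<epsilon> / 2) \<le> real n * (8 * ln (1 + h * real T))"
    by (simp add: mult_ac)
  then have "h * real (T - T1) * \<epsilon> / 2 \<le> 8 * ln (1 + h * real T)" using n_pos by simp
  moreover have "(h * real T - 2) * \<epsilon> \<le> h * real (T - T1) * \<epsilon>"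
  proof (rule mult_right_mono)
    have "h * real (T - T1) = h * real T - h * real T1"
      using T1(3) by (simp add: of_nat_diff right_diff_distrib)
    then show "h * real T - 2 \<le> h * real (T - T1)" using T1(2) by linarith
  qed (use \<epsilon> in simp)
  ultimately show False using \<epsilon> by linarith
qed

end

section \<open>Growth of the signal under large signal-to-noise ratio\<close>

context good_run begin

definition "grp j = {i. i < n \<and> y i = j}"
text \<open>The signal coefficient of an idealized neuron of sign j that has always been active on
  the signal patches of class j and on no others.\<close>

definition "G j t = s / real n * (\<Sum>i\<in>grp j. a i t)"

lemma grp_subset: "grp j \<subseteq> {..<n}"
  by (auto simp: grp_def)

lemma card_grp: "j = 1 \<or> j = -1 \<Longrightarrow> real (card (grp j)) = real n / 2"
  unfolding grp_def by (rule half)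

lemma G_0: "G j 0 = 0" by (simp add: G_def a_0)

lemma G_Suc: "G j (Suc t) = G j t + h * s / real n * (\<Sum>i\<in>grp j. l i t)"
  by (simp add: G_def a_Suc sum.distrib sum_distrib_left algebra_simps)

lemma G_nonneg: "0 \<le> G j t"
  unfolding G_def using s_pos a_nonneg by (intro mult_nonneg_nonneg sum_nonneg) auto

lemma G_mono_Suc: "G j t \<le> G j (Suc t)"
proof -
  have "0 \<le> h * s / real n * (\<Sum>i\<in>grp j. l i t)"
    using h_pos s_pos l_nonneg by (intro mult_nonneg_nonneg sum_nonneg) auto
  then show ?thesis by (simp add: G_Suc)
qed

lemma G_le_time: "G j t \<le> s * (h * real t)"
proof -
  have "(\<Sum>i\<in>grp j. a i t) \<le> (\<Sum>i<n. a i t)"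
    using a_nonneg grp_subset by (intro sum_mono2) auto
  also have "\<dots> \<le> (\<Sum>i<n. h * real t)" by (intro sum_mono a_le_time)
  finally have "G j t \<le> s / real n * (real n * (h * real t))"
    unfolding G_def using s_pos by (intro mult_left_mono) auto
  then show ?thesis using n_pos by simp
qed

lemma g_le_time: "g w t \<le> s * (h * real t)"
  by (rule g_le_bound) (rule a_le_time)

text \<open>All signal patches are multiples of \<mu>, so the sign of the inner product with \<mu>
  alone decides which class activates a neuron.\<close>

lemma relu'_signal:
  assumes "i < n" "j = 1 \<or> j = -1"
  shows "0 \<le> j * dot d w \<mu> \<Longrightarrow> y i = j \<Longrightarrow> relu' (dot d w (vscale (y i) \<mu>)) = 1"
    and "0 < j * dot d w \<mu> \<Longrightarrow> y i \<noteq> j \<Longrightarrow> relu' (dot d w (vscale (y i) \<mu>)) = 0"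
  using labels[OF assms(1)] assms(2) by (auto simp: relu'_def dot_vscale_right)

text \<open>Whatever the sign of its inner product with \<mu>, a neuron is active on the signal
  patches of at least one class, which has n / 2 samples with derivatives at least
  \<open>c\<^sub>0\<close> up to time 1 / h. So even a misaligned neuron moves along j *
  \<mu>.\<close>

lemma g_lower:
  assumes j: "j = 1 \<or> j = -1" and B: "\<And>\<tau>. \<tau> < t \<Longrightarrow> bounded_at \<tau>"
  shows "s * c\<^sub>0 / 2 * min (h * real t) 1 \<le> g (j, r) t"
  using B
proof (induction t)
  case 0
  then show ?case by (simp add: g_0)
next
  case (Suc t)
  then have IH: "s * c\<^sub>0 / 2 * min (h * real t) 1 \<le> g (j, r) t" by simp
  let ?R = "\<lambda>i. relu' (dot d (W t (j, r)) (vscale (y i) \<mu>))"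
  show ?case
  proof (cases "h * real t \<le> 1")
    case True
    obtain k where k: "k = 1 \<or> k = -1" "0 \<le> k * dot d (W t (j, r)) \<mu>"
      by (cases "0 \<le> dot d (W t (j, r)) \<mu>") (auto intro: that[of 1] that[of "-1"])
    have "real n / 2 * c\<^sub>0 = (\<Sum>i\<in>grp k. c\<^sub>0)" using card_grp[OF k(1)] by simp
    also have "\<dots> \<le> (\<Sum>i\<in>grp k. l i t * ?R i)"
    proof (rule sum_mono)
      fix i assume "i \<in> grp k"
      then have i: "i < n" "y i = k" by (auto simp: grp_def)
      show "c\<^sub>0 \<le> l i t * ?R i"
        using l_ge_c0[OF i(1) True] Suc.prems relu'_signal(1)[OF i(1) k(1) k(2) i(2)] by simp
    qed
    also have "\<dots> \<le> (\<Sum>i<n. l i t * ?R i)"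
      using grp_subset l_nonneg relu'_bounds by (intro sum_mono2) auto
    finally have "h * s / real n * (real n / 2 * c\<^sub>0) \<le> h * s / real n * (\<Sum>i<n. l i t * ?R i)"
      using h_pos s_pos by (intro mult_left_mono) auto
    then have "s * c\<^sub>0 / 2 * (h * real (Suc t)) \<le> g (j, r) (Suc t)"
      using IH True n_pos by (simp add: g_Suc algebra_simps)
    moreover have "s * c\<^sub>0 / 2 * min (h * real (Suc t)) 1 \<le> s * c\<^sub>0 / 2 * (h * real (Suc t))"
      using c0 s_pos by (intro mult_left_mono) auto
    ultimately show ?thesis by linarith
  next
    case False
    have "s * c\<^sub>0 / 2 * min (h * real (Suc t)) 1 \<le> s * c\<^sub>0 / 2 * 1"
      using c0 s_pos by (intro mult_left_mono) auto
    moreover have "g (j, r) t \<le> g (j, r) (Suc t)"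
    proof -
      have "0 \<le> h * s / real n * (\<Sum>i<n. l i t * ?R i)"
        using h_pos s_pos l_nonneg relu'_bounds
        by (intro mult_nonneg_nonneg sum_nonneg) auto
      then show ?thesis by (simp add: g_Suc)
    qed
    ultimately show ?thesis using IH False by simp
  qed
qed

text \<open>Beyond \<nu> the coefficient outweighs the perturbation of the inner product, so the
  neuron has the sign j and behaves like the idealized one.\<close>

lemma g_step_aligned:
  assumes j: "j = 1 \<or> j = -1" and r: "r < m" and B: "bounded_at t" and g: "\<nu> < g (j, r) t"
  shows "g (j, r) (Suc t) - g (j, r) t = G j (Suc t) - G j t"
proof -
  have pos: "0 < j * dot d (W t (j, r)) \<mu>" using signal_bound[OF B j r] g by linarith
  have "(\<Sum>i<n. l i t * relu' (dot d (W t (j, r)) (vscale (y i) \<mu>))) = (\<Sum>i<n. if y i = j then l i t else 0)"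
    using relu'_signal[OF _ j, of _ "W t (j, r)"] pos by (intro sum.cong) auto
  also have "\<dots> = (\<Sum>i\<in>grp j. l i t)"
    by (subst sum.inter_filter[symmetric]) (auto simp: grp_def intro!: sum.cong)
  finally show ?thesis by (simp add: g_Suc G_Suc)
qed

text \<open>A neuron whose sign does not match \<open>j\<close> is corrected before time \<open>1 / (128 s h)\<close>;
  afterwards it sees exactly the samples with label \<open>j\<close>.\<close>

lemma g_near_G:
  assumes j: "j = 1 \<or> j = -1" and r: "r < m" and s: "1 \<le> s" and t: "t \<le> T"
  shows "\<bar>g (j, r) t - G j t\<bar> \<le> 3 / 128"
  using t
proof (induction t)
  case (Suc t)
  then have IH: "\<bar>g (j, r) t - G j t\<bar> \<le> 3 / 128" by simp
  show ?case
  proof (cases "\<nu> < g (j, r) t")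
    case True
    then show ?thesis using g_step_aligned[OF j r bounded True] Suc.prems IH by linarith
  next
    case False
    have "s * c\<^sub>0 / 2 * min (h * real t) 1 \<le> g (j, r) t"
      by (rule g_lower[OF j bounded]) (use Suc.prems in simp)
    then have "c\<^sub>0 * (s * min (h * real t) 1) \<le> c\<^sub>0 * (1 / 128)" using False c0(3) by argo
    then have m: "s * min (h * real t) 1 \<le> 1 / 128" by (rule mult_left_le_imp_le) (rule c0)
    have "h * real t \<le> 1"
    proof (rule ccontr)
      assume "\<not> ?thesis"
      then show False using m s by simp
    qed
    with m have "s * (h * real t) \<le> 1 / 128" by simp
    \<comment> \<open>A misaligned step occurs only while s * h * t \<le> 1 / 128, and the step
      itself adds at most s * h \<le> 1 / 64. Both \<open>g\<close> and \<open>G\<close> then lie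
      between 0 and 3 / 128.\<close>
    then have "s * (h * real (Suc t)) \<le> 3 / 128" using h_small by (simp add: algebra_simps)
    then show ?thesis
      using g_le_time[of "(j, r)" "Suc t"] G_le_time[of j "Suc t"] G_nonneg[of j "Suc t"] g_nonneg[of "(j, r)" "Suc t"]
      by linarith
  qed
qed (simp add: g_0 G_0)

lemma \<Gamma>_near_G:
  assumes j: "j = 1 \<or> j = -1" and s: "1 \<le> s" and t: "t \<le> T"
  shows "\<bar>\<Gamma> j t - G j t\<bar> \<le> 3 / 128"
proof -
  have "\<Gamma> j t - G j t = 1 / real m * (\<Sum>r<m. g (j, r) t - G j t)"
    using m_pos by (simp add: \<Gamma>_def sum_subtractf right_diff_distrib)
  then show ?thesis using abs_average_le[OF m_pos g_near_G[OF j _ s t]] by simp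
qed

section \<open>Difference inequalities for the signal of a class\<close>

lemma margin_near_G:
  assumes i: "i < n" and s: "1 \<le> s" and t: "t \<le> T"
  shows "G (y i) t + a i t / 8 - 1 \<le> M i t" "M i t \<le> G (y i) t + 2 * a i t + 1"
  using \<Gamma>_near_G[OF labels[OF i] s t] margin_approx[OF bounded[OF t] i] P_ge[OF i active_until[OF t i]]
    P_le[OF i, of t] \<nu>_bounds by linarith+

lemma l_upper:
  assumes i: "i < n" and s: "1 \<le> s" and t: "t \<le> T"
  shows "l i t \<le> exp 1 * exp (- a i t / 8) * exp (- G (y i) t)"
proof -
  have "l i t \<le> exp (- (G (y i) t + a i t / 8 - 1))"
    using l_le_exp[of i t] margin_near_G(1)[OF i s t] by (elim order_trans) simp
  then show ?thesis by (simp add: exp_add[symmetric] algebra_simps)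
qed

lemma G_step_upper:
  assumes j: "j = 1 \<or> j = -1" and s: "1 \<le> s" and t: "t \<le> T"
  shows "G j (Suc t) - G j t \<le> 2 * (h * s) * exp (- G j t)" "G j (Suc t) - G j t \<le> 1"
proof -
  have "(\<Sum>i\<in>grp j. l i t) \<le> (\<Sum>i\<in>grp j. 3 * exp (- G j t))"
  proof (rule sum_mono)
    fix i assume "i \<in> grp j"
    then have i: "i < n" "y i = j" by (auto simp: grp_def)
    have "l i t \<le> exp 1 * exp (- a i t / 8) * exp (- G j t)" using l_upper[OF i(1) s t] i by simp
    also have "\<dots> \<le> 3 * 1 * exp (- G j t)" using exp_le a_nonneg[of i t]
      by (intro mult_right_mono mult_mono) auto
    finally show "l i t \<le> 3 * exp (- G j t)" by simp
  qed
  also have "\<dots> = real n / 2 * (3 * exp (- G j t))" by (simp add: card_grp[OF j])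
  finally have "h * s / real n * (\<Sum>i\<in>grp j. l i t) \<le> h * s / real n * (real n / 2 * (3 * exp (- G j t)))"
    using h_pos s_pos by (intro mult_left_mono) auto
  also have "\<dots> \<le> 2 * (h * s) * exp (- G j t)" using n_pos h_pos s_pos by (simp add: field_simps)
  finally show "G j (Suc t) - G j t \<le> 2 * (h * s) * exp (- G j t)" by (simp add: G_Suc)
  also have "\<dots> \<le> 2 * (1 / 64) * 1" using h_small G_nonneg[of j t] s_pos h_pos
    by (intro mult_mono) (auto simp: mult.commute)
  finally show "G j (Suc t) - G j t \<le> 1" by simp
qed

text \<open>Jensen's inequality for the mean \<open>2 G / s\<close> of the \<open>a i t\<close> over a label class.\<close>

lemma G_step_lower:
  assumes j: "j = 1 \<or> j = -1" and s: "1 \<le> s" and t: "t \<le> T"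
  shows "h * s / 12 * exp (- G j t) * exp (- (4 * G j t / s)) \<le> G j (Suc t) - G j t"
proof -
  let ?A = "2 * G j t / s"
  have sum_a: "(\<Sum>i\<in>grp j. a i t) = real n / 2 * ?A" using n_pos s_pos by (simp add: G_def)
  \<comment> \<open>The values at a i t of the tangent line of exp (- 2 x) at the mean
    \<open>?A\<close>, up to a common factor; their linear parts cancel in the sum.\<close>
  have "(\<Sum>i\<in>grp j. 1 - 2 * (a i t - ?A)) = real n / 2"
    by (simp add: sum_subtractf sum_distrib_left[symmetric] card_grp[OF j] sum_a)
  then have "real n / 2 * exp (- (2 * ?A)) = (\<Sum>i\<in>grp j. exp (- (2 * ?A)) * (1 - 2 * (a i t - ?A)))"
    by (simp add: sum_distrib_left[symmetric])
  also have "\<dots> \<le> (\<Sum>i\<in>grp j. exp (- (2 * ?A)) * exp (- 2 * (a i t - ?A)))"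
  proof -
    have "1 - 2 * (x - ?A) \<le> exp (- 2 * (x - ?A))" for x
      using exp_ge_add_one_self[of "- 2 * (x - ?A)"] by linarith
    then show ?thesis by (intro sum_mono mult_left_mono) simp_all
  qed
  also have "\<dots> = (\<Sum>i\<in>grp j. exp (- 2 * a i t))"
  proof (rule sum.cong)
    show "exp (- (2 * ?A)) * exp (- 2 * (a i t - ?A)) = exp (- 2 * a i t)" for i
      unfolding exp_add[symmetric] by (simp add: algebra_simps)
  qed simp
  finally have J: "real n / 2 * exp (- (4 * G j t / s)) \<le> (\<Sum>i\<in>grp j. exp (- 2 * a i t))" by simp
  have "(\<Sum>i\<in>grp j. exp (- 2 * a i t)) * (1 / 6 * exp (- G j t)) \<le> (\<Sum>i\<in>grp j. l i t)"
    unfolding sum_distrib_right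
  proof (rule sum_mono)
    fix i assume "i \<in> grp j"
    then have i: "i < n" "y i = j" by (auto simp: grp_def)
    let ?x = "G j t + 2 * a i t + 1"
    have x: "1 \<le> exp ?x" using G_nonneg[of j t] a_nonneg[of i t] by simp
    \<comment> \<open>As exp ?x \<ge> 1, 1 + exp ?x is at most 2 * exp ?x, and the summand 1 of
      \<open>?x\<close> costs a factor e \<le> 3; hence 1 / 6.\<close>
    have "exp (- 2 * a i t) * (1 / 6 * exp (- G j t)) = exp 1 / 3 * (1 / (2 * exp ?x))"
      by (simp add: exp_add exp_minus field_simps mult_exp_exp[symmetric])
    also have "\<dots> \<le> 1 * (1 / (1 + exp ?x))"
      using x exp_le by (intro mult_mono divide_left_mono) (auto intro!: mult_pos_pos add_pos_pos)
    also have "\<dots> \<le> l i t" using l_ge[of i t ?x] margin_near_G(2)[OF i(1) s t] i by simp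
    finally show "exp (- 2 * a i t) * (1 / 6 * exp (- G j t)) \<le> l i t" .
  qed
  moreover have "real n / 2 * exp (- (4 * G j t / s)) * (1 / 6 * exp (- G j t))
      \<le> (\<Sum>i\<in>grp j. exp (- 2 * a i t)) * (1 / 6 * exp (- G j t))"
    using J by (intro mult_right_mono) auto
  ultimately have "real n / 2 * exp (- (4 * G j t / s)) * (1 / 6 * exp (- G j t)) \<le> (\<Sum>i\<in>grp j. l i t)"
    by (rule order_trans[rotated])
  then have "h * s / real n * (real n / 2 * exp (- (4 * G j t / s)) * (1 / 6 * exp (- G j t)))
      \<le> h * s / real n * (\<Sum>i\<in>grp j. l i t)"
    using h_pos s_pos by (intro mult_left_mono) auto
  moreover have "h * s / real n * (real n / 2 * exp (- (4 * G j t / s)) * (1 / 6 * exp (- G j t)))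
      = h * s / 12 * exp (- G j t) * exp (- (4 * G j t / s))"
    using n_pos by (simp add: field_simps)
  ultimately show ?thesis by (simp add: G_Suc)
qed

text \<open>Comparison with G' = 2 h s exp (- G), for which exp G is linear in time. The discrete
  step uses exp D \<le> 1 + 2 D on [0, 1], which doubles the rate.\<close>

lemma exp_G_le:
  assumes j: "j = 1 \<or> j = -1" and s: "1 \<le> s" and t: "t \<le> T"
  shows "exp (G j t) \<le> 1 + 4 * (h * s * real t)"
  using t
proof (induction t)
  case (Suc t)
  define D where "D = G j (Suc t) - G j t"
  have D: "0 \<le> D" "D \<le> 1" "D \<le> 2 * (h * s) * exp (- G j t)"
    using G_mono_Suc[of j t] G_step_upper[OF j s, of t] Suc.prems by (auto simp: D_def)
  have "exp D \<le> 1 + D + D\<^sup>2" using D by (intro exp_bound) auto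
  also have "D\<^sup>2 \<le> D" using D by (simp add: power2_eq_square mult_left_le)
  finally have e: "exp D \<le> 1 + 2 * D" by simp
  have "exp (G j (Suc t)) = exp (G j t) * exp D" by (simp add: D_def exp_add[symmetric])
  also have "\<dots> \<le> exp (G j t) * (1 + 2 * D)" using e by (intro mult_left_mono) auto
  also have "\<dots> \<le> exp (G j t) * (1 + 2 * (2 * (h * s) * exp (- G j t)))"
    by (intro mult_left_mono add_left_mono D(3)) simp_all
  also have "\<dots> = exp (G j t) + 4 * (h * s)" by (simp add: algebra_simps exp_minus)
  also have "\<dots> \<le> 1 + 4 * (h * s * real t) + 4 * (h * s)" using Suc by simp
  finally show ?case by (simp add: algebra_simps)
qed (simp add: G_0)

text \<open>For s \<ge> 4 the factor exp (- 4 G / s) is at least exp (- G), and an increment of at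
  least (h s / 12) exp (- 2 G) makes exp (2 G) grow at least linearly.\<close>

lemma exp_2G_ge:
  assumes j: "j = 1 \<or> j = -1" and s: "4 \<le> s" and t: "t \<le> T"
  shows "1 + h * s * real t / 6 \<le> exp (2 * G j t)"
  using t
proof (induction t)
  case (Suc t)
  define D where "D = G j (Suc t) - G j t"
  have "4 * G j t / s \<le> G j t" using s mult_right_mono[OF s G_nonneg[of j t]] by (simp add: field_simps)
  then have "exp (- G j t) \<le> exp (- (4 * G j t / s))" by simp
  then have "h * s / 12 * exp (- G j t) * exp (- G j t) \<le> h * s / 12 * exp (- G j t) * exp (- (4 * G j t / s))"
    using h_pos s_pos by (intro mult_left_mono) auto
  also have "\<dots> \<le> D" using G_step_lower[OF j _, of t] s Suc.prems by (simp add: D_def)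
  finally have D: "h * s / 12 * exp (- (2 * G j t)) \<le> D" by (simp add: mult_exp_exp mult.assoc)
  have "1 + h * s * real (Suc t) / 6 = (1 + h * s * real t / 6) + h * s / 6"
    by (simp add: distrib_left add_divide_distrib)
  also have "\<dots> \<le> exp (2 * G j t) + h * s / 6" using Suc by simp
  also have "\<dots> = exp (2 * G j t) * (1 + 2 * (h * s / 12 * exp (- (2 * G j t))))"
    by (simp add: algebra_simps exp_minus)
  also have "\<dots> \<le> exp (2 * G j t) * (1 + 2 * D)" by (intro mult_left_mono add_left_mono D) simp_all
  also have "\<dots> \<le> exp (2 * G j t) * exp (2 * D)" by (intro mult_left_mono exp_ge_add_one_self) auto
  also have "\<dots> = exp (2 * G j (Suc t))" by (simp add: D_def exp_add[symmetric])
  finally show ?case .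
qed (simp add: G_0)

text \<open>Both bounds are logarithms of affine functions of x = h s t. As 4 = 24 / 6, Bernoulli's
  inequality bounds 1 + 4 x by the 24th power of 1 + x / 6, and the lower bound concerns exp (2 G),
  hence 48 = 2 * 24.\<close>

lemma G_ratio:
  assumes j: "j = 1 \<or> j = -1" and k: "k = 1 \<or> k = -1" and s: "4 \<le> s" and t: "t \<le> T"
  shows "G k t \<le> 48 * G j t"
proof -
  let ?x = "h * s * real t"
  have x: "0 \<le> ?x" using h_pos s_pos by simp
  have "exp (G k t) \<le> 1 + 4 * ?x" using exp_G_le[OF k _ t] s by simp
  also have "\<dots> = 1 + real 24 * (?x / 6)" by simp
  also have "\<dots> \<le> (1 + ?x / 6) ^ 24" using x by (intro Bernoulli_inequality) auto
  also have "\<dots> \<le> exp (2 * G j t) ^ 24" using exp_2G_ge[OF j s t] x by (intro power_mono) auto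
  also have "\<dots> = exp (48 * G j t)" by (simp add: exp_of_nat_mult[symmetric])
  finally show ?thesis by simp
qed

text \<open>One step raises exp (a / 8) by at most h exp (- G). It raises exp (12 G / s) by at least
  as much: the factor 12 / s cancels the s / 12 of \<open>G_step_lower\<close>, and exp (12 G / s)
  absorbs the loss exp (- 4 G / s).\<close>

lemma a_le_G:
  assumes i: "i < n" and s: "1 \<le> s" and t: "t \<le> T"
  shows "a i t \<le> 96 * G (y i) t / s"
proof -
  have "exp (a i t / 8) \<le> exp (12 * G (y i) t / s)"
    using t
  proof (induction t)
    case (Suc t)
    define g where "g = G (y i) t"
    define D where "D = G (y i) (Suc t) - g"
    have g0: "0 \<le> g" using G_nonneg by (simp add: g_def)
    have D: "h * s / 12 * exp (- g) * exp (- (4 * g / s)) \<le> D"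
      using G_step_lower[OF labels[OF i] s, of t] Suc.prems by (simp add: g_def D_def)
    have "h * exp (- g) = 12 / s * exp (4 * g / s) * (h * s / 12 * exp (- g) * exp (- (4 * g / s)))"
      using s_pos by (simp add: exp_minus field_simps)
    also have "\<dots> \<le> 12 / s * exp (4 * g / s) * D" using D s_pos by (intro mult_left_mono) auto
    also have "\<dots> \<le> 12 / s * exp (12 * g / s) * D"
    proof -
      have "0 \<le> h * s / 12 * exp (- g) * exp (- (4 * g / s))" using h_pos s_pos by simp
      then have "0 \<le> D" using D by linarith
      moreover have "4 * g / s \<le> 12 * g / s" using g0 s_pos by (simp add: divide_right_mono)
      ultimately show ?thesis using s_pos by (intro mult_left_mono mult_right_mono) auto
    qed
    finally have hD: "h * exp (- g) \<le> 12 / s * exp (12 * g / s) * D" .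
    have "exp (a i (Suc t) / 8) \<le> exp (a i t / 8) + h * exp (- g)"
      using exp_a_step[OF l_upper[OF i s]] Suc.prems by (simp add: g_def)
    also have "\<dots> \<le> exp (12 * g / s) + 12 / s * exp (12 * g / s) * D"
      using hD Suc.IH[OF Suc_leD[OF Suc.prems]] by (simp only: g_def)
    also have "\<dots> = exp (12 * g / s) * (1 + 12 * D / s)" by (simp add: algebra_simps)
    also have "\<dots> \<le> exp (12 * g / s) * exp (12 * D / s)" by (intro mult_left_mono exp_ge_add_one_self) auto
    also have "\<dots> = exp (12 * G (y i) (Suc t) / s)"
      by (simp add: exp_add[symmetric] D_def add_divide_distrib[symmetric])
    finally show ?case .
  qed (simp add: a_0 G_0)
  then show ?thesis by simp
qed

text \<open>The decisive requirement is 4608^2 \<le> s, which gives s * A^2 \<le> G^2 for A = 4608 *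
  G / s in \<open>weight_norm\<close>; the other uses of a large s ask for less.\<close>

definition "s\<^sub>1 = (3 * 10 ^ 7 :: real)"

section \<open>Test margin and weight norms after time 1 / h\<close>

context
  fixes t :: nat and j :: real
  assumes s_large: "s\<^sub>1 \<le> s" and t: "t \<le> T" "1 \<le> h * real t" and j: "j = 1 \<or> j = -1"
begin

lemma s4: "4 \<le> s" "1 \<le> s" using s_large by (simp_all add: s\<^sub>1_def)

lemma G_ge_1: "1 \<le> G j t"
proof -
  have "s * 1 \<le> s * (h * real t)" using t s_pos by (intro mult_left_mono) auto
  moreover have "54 \<le> s" using s_large by (simp add: s\<^sub>1_def)
  ultimately have "54 \<le> s * (h * real t)" by linarith
  then have "9 \<le> 1 + h * s * real t / 6" by (simp add: mult_ac)
  also have "\<dots> \<le> exp (2 * G j t)" by (rule exp_2G_ge[OF j s4(1) t(1)])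
  finally have "9 \<le> exp (2 * G j t)" .
  moreover have "exp (2 * 1 :: real) \<le> 9"
    using power_mono[OF exp_le, of 2] exp_double[of "1::real"] by simp
  ultimately have "exp (2 * 1) \<le> exp (2 * G j t)" by linarith
  then show ?thesis by simp
qed

text \<open>4608 = 96 * 48, where 48 compares the signals of the two classes: a test point of class
  j may carry the noise of a training sample of the other class.\<close>

lemma a_le_G_opposite: assumes "i < n" shows "a i t \<le> 4608 * G j t / s"
proof -
  have "96 * G (y i) t / s \<le> 96 * (48 * G j t) / s"
    using G_ratio[OF j labels[OF assms] s4(1) t(1)] s_pos by (intro divide_right_mono) auto
  then show ?thesis using a_le_G[OF assms s4(2) t(1)] by simp
qed

text \<open>The neurons (j, r) and (-j, r) are compared index by index. Of the signal G, one half is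
  granted to the fresh noise and one eighth to the memorized noise 2 * a i t; since G \<ge> 1, the
  rest covers 3 / 128 and the errors \<nu>. Noise seen by (j, r) can only help.\<close>

lemma test_margin:
  assumes i: "i < n" and z: "\<And>r. r < m \<Longrightarrow> dot d (W t (- j, r)) z \<le> G j t / 2"
  shows "0 \<le> j * network d m (W t) (vscale j \<mu>, \<lambda>k. \<xi> i k + z k)"
proof -
  let ?S = "\<lambda>k r. relu (dot d (W t (k, r)) (vscale j \<mu>))"
  let ?N = "\<lambda>k r. relu (dot d (W t (k, r)) (\<lambda>k. \<xi> i k + z k))"
  have j': "- j = 1 \<or> - j = -1" using j by auto
  note B = bounded[OF t(1)]
  have "j * network d m (W t) (vscale j \<mu>, \<lambda>k. \<xi> i k + z k)
      = F d m (W t) j (vscale j \<mu>, \<lambda>k. \<xi> i k + z k) - F d m (W t) (- j) (vscale j \<mu>, \<lambda>k. \<xi> i k + z k)"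
    using j unfolding network_def by auto
  also have "\<dots> = 1 / real m * (\<Sum>r<m. ?S j r + ?N j r - ?S (- j) r - ?N (- j) r)"
    unfolding F_def fst_conv snd_conv by (simp add: sum.distrib sum_subtractf right_diff_distrib distrib_left)
  finally have eq: "j * network d m (W t) (vscale j \<mu>, \<lambda>k. \<xi> i k + z k)
      = 1 / real m * (\<Sum>r<m. ?S j r + ?N j r - ?S (- j) r - ?N (- j) r)" .
  have "0 \<le> ?S j r + ?N j r - ?S (- j) r - ?N (- j) r" if r: "r < m" for r
  proof -
    have "G j t - 3 / 128 - \<nu> \<le> ?S j r"
    proof -
      have "j * dot d (W t (j, r)) \<mu> \<le> ?S j r" by (simp add: dot_vscale_right relu_def)
      then show ?thesis using signal_bound[OF B j r] g_near_G[OF j r s4(2) t(1)] by linarith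
    qed
    moreover have "?S (- j) r \<le> \<nu>"
      using signal_bound[OF B j' r] g_nonneg[of "(- j, r)" t] \<nu>_bounds
      by (auto simp: dot_vscale_right relu_def)
    moreover have "?N (- j) r \<le> 2 * a i t + \<nu> + G j t / 2"
    proof -
      have "p (- j, r) i t * X i \<le> a i t * 2"
        using p_le_a[of "(- j, r)" i t] X_bounds[OF i] a_nonneg[of i t] by (intro mult_mono) auto
      moreover have "0 \<le> p (- j, r) i t * X i" using p_nonneg X_bounds[OF i] by simp
      moreover have "- j * y i = 1 \<or> - j * y i = -1" using j labels[OF i] by auto
      ultimately have "dot d (W t (- j, r)) (\<xi> i) \<le> 2 * a i t + \<nu>"
        using noise_bound[OF B j' r i] by auto
      then have "relu (dot d (W t (- j, r)) (\<xi> i)) \<le> 2 * a i t + \<nu>"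
        using a_nonneg[of i t] \<nu>_bounds by (simp add: relu_def)
      moreover have "relu (dot d (W t (- j, r)) z) \<le> G j t / 2"
        using z[OF r] G_nonneg[of j t] by (simp add: relu_def)
      ultimately show ?thesis
        using relu_add_le[of "dot d (W t (- j, r)) (\<xi> i)" "dot d (W t (- j, r)) z"]
        by (simp add: dot_add_right)
    qed
    moreover have "2 * a i t \<le> G j t / 8"
    proof -
      have "4608 * G j t / s \<le> 4608 * G j t / s\<^sub>1"
        using s_large G_ge_1 by (intro divide_left_mono) (auto simp: s\<^sub>1_def)
      then show ?thesis using a_le_G_opposite[OF i] G_ge_1 by (simp add: s\<^sub>1_def)
    qed
    ultimately show ?thesis using G_ge_1 \<nu>_bounds relu_nonneg[of "dot d (W t (j, r)) (\<lambda>k. \<xi> i k + z k)"]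
      by linarith
  qed
  then show ?thesis unfolding eq by (intro mult_nonneg_nonneg sum_nonneg) auto
qed

text \<open>The left-hand side is the variance of the response of an opposing neuron to fresh noise.
  With Q = n / (s d) = \<sigma>^2 / |\<mu>|^2, the initialization, signal and noise parts of the
  weight contribute at most 1, 49^2 and 3 in units of Q G^2. Squaring a sum of three terms costs a
  factor 3, and 3 * (1 + 2401 + 3) \<le> 8000.\<close>

lemma weight_norm:
  assumes r: "r < m" and w0: "\<sigma>\<^sup>2 * dot d (W0 (- j, r)) (W0 (- j, r)) \<le> real n / (s * real d)"
  shows "\<sigma>\<^sup>2 * dot d (W t (- j, r)) (W t (- j, r)) \<le> 8000 * (real n / (s * real d)) * (G j t)\<^sup>2"
proof -
  define Q where "Q = real n / (s * real d)"
  have Q: "0 < Q" using n_pos d_pos s_pos by (simp add: Q_def)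
  let ?p = "\<lambda>i. p (- j, r) i t" and ?w = "W0 (- j, r)"
  let ?c = "- j * g (- j, r) t / dot d \<mu> \<mu>" and ?S = "\<lambda>k. \<Sum>i<n. y i * ?p i * \<xi> i k"
  have j': "- j = 1 \<or> - j = -1" using j by auto
  have jj: "j\<^sup>2 = 1" using j by (auto simp: power2_eq_square)
  define A where "A = 4608 * G j t / s"
  have A: "0 \<le> ?p i" "?p i \<le> A" if "i < n" for i
    using p_nonneg p_le_a[of "(- j, r)" i t] a_le_G_opposite[OF that] by (auto simp: A_def)
  have A0: "0 \<le> A" using G_nonneg[of j t] s_pos by (simp add: A_def)
  have sq3: "(u + v + w)\<^sup>2 \<le> 3 * (u\<^sup>2 + v\<^sup>2 + w\<^sup>2)" for u v w :: real
    using zero_le_power2[of "u - v"] zero_le_power2[of "u - w"] zero_le_power2[of "v - w"]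
    by (simp add: power2_eq_square algebra_simps)
  have "dot d (W t (- j, r)) (W t (- j, r)) = (\<Sum>k<d. (?w k + ?c * \<mu> k + - j / q * ?S k)\<^sup>2)"
  proof -
    have "W t (- j, r) k = ?w k + ?c * \<mu> k + - j / q * ?S k" for k
      unfolding W_eq by simp
    then show ?thesis by (simp only: dot_def[of d "W t (- j, r)"] power2_eq_square)
  qed
  also have "\<dots> \<le> (\<Sum>k<d. 3 * ((?w k)\<^sup>2 + (?c * \<mu> k)\<^sup>2 + (- j / q * ?S k)\<^sup>2))"
    by (intro sum_mono sq3)
  also have "\<dots> = 3 * (dot d ?w ?w + ?c\<^sup>2 * dot d \<mu> \<mu> + (1 / q)\<^sup>2 * (\<Sum>k<d. (?S k)\<^sup>2))"
  proof -
    have "3 * (u\<^sup>2 + (?c * v)\<^sup>2 + (- j / q * S)\<^sup>2) = 3 * (u * u + ?c\<^sup>2 * (v * v) + (1 / q)\<^sup>2 * S\<^sup>2)" for u v S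
      by (simp only: power_mult_distrib power_divide power2_minus jj) (simp add: power2_eq_square)
    then show ?thesis unfolding dot_def by (simp only: sum.distrib sum_distrib_left[symmetric])
  qed
  finally have W: "\<sigma>\<^sup>2 * dot d (W t (- j, r)) (W t (- j, r))
      \<le> 3 * (\<sigma>\<^sup>2 * dot d ?w ?w + \<sigma>\<^sup>2 * (?c\<^sup>2 * dot d \<mu> \<mu>) + \<sigma>\<^sup>2 * ((1 / q)\<^sup>2 * (\<Sum>k<d. (?S k)\<^sup>2)))"
    using mult_left_mono[of _ _ "\<sigma>\<^sup>2"] by (fastforce simp: algebra_simps)
  have "\<sigma>\<^sup>2 / dot d \<mu> \<mu> = Q"
    using \<mu>_pos q_pos n_pos d_pos \<sigma>_pos by (simp add: Q_def s_def q_def field_simps)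
  moreover have "?c\<^sup>2 * dot d \<mu> \<mu> = (g (- j, r) t)\<^sup>2 / dot d \<mu> \<mu>"
    using \<mu>_pos jj by (simp add: power_divide power_mult_distrib power2_eq_square[of "dot d \<mu> \<mu>"])
  ultimately have "\<sigma>\<^sup>2 * (?c\<^sup>2 * dot d \<mu> \<mu>) = Q * (g (- j, r) t)\<^sup>2"
    by (metis times_divide_eq_left times_divide_eq_right mult.commute)
  also have "\<dots> \<le> Q * (49 * G j t)\<^sup>2"
  proof -
    \<comment> \<open>48 comes from the comparison of the classes, and the error 3 / 128 is at most
      G.\<close>
    have "g (- j, r) t \<le> 49 * G j t"
      using g_near_G[OF j' r s4(2) t(1)] G_ratio[OF j j' s4(1) t(1)] G_ge_1 by linarith
    then show ?thesis using g_nonneg[of "(- j, r)" t] Q by (intro mult_left_mono power_mono) auto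
  qed
  finally have c2: "\<sigma>\<^sup>2 * (?c\<^sup>2 * dot d \<mu> \<mu>) \<le> 2401 * Q * (G j t)\<^sup>2" by (simp add: power_mult_distrib)
  have "(\<Sum>k<d. (?S k)\<^sup>2) = (\<Sum>i<n. \<Sum>i'<n. (y i * ?p i) * (y i' * ?p i') * dot d (\<xi> i') (\<xi> i))"
  proof -
    have "(\<Sum>k<d. (?S k)\<^sup>2) = (\<Sum>k<d. \<Sum>i<n. \<Sum>i'<n. (y i * ?p i) * (y i' * ?p i') * (\<xi> i' k * \<xi> i k))"
      unfolding power2_eq_square sum_product by (intro sum.cong refl) (simp add: mult_ac)
    also have "\<dots> = (\<Sum>i<n. \<Sum>i'<n. \<Sum>k<d. (y i * ?p i) * (y i' * ?p i') * (\<xi> i' k * \<xi> i k))"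
      by (subst sum.swap, rule sum.cong[OF refl], rule sum.swap)
    finally show ?thesis by (simp add: dot_def sum_distrib_left)
  qed
  \<comment> \<open>The Gram matrix of the noise vectors is almost diagonal: diagonal entries are at
    most 2 * q, and the other entries of a row add up to at most q.\<close>
  also have "\<dots> \<le> (\<Sum>i<n. \<Sum>i'<n. A\<^sup>2 * (if i' = i then 2 * q else \<epsilon>\<^sub>1 * q))"
  proof (intro sum_mono)
    fix i i' assume "i \<in> {..<n}" "i' \<in> {..<n}"
    then have i: "i < n" "i' < n" by auto
    have "\<bar>dot d (\<xi> i') (\<xi> i)\<bar> \<le> (if i' = i then 2 * q else \<epsilon>\<^sub>1 * q)"
      using \<xi>_sq[OF i(1)] \<xi>_\<xi>[OF i] q_pos by auto
    moreover have "?p i * ?p i' \<le> A\<^sup>2"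
      unfolding power2_eq_square using A[OF i(1)] A[OF i(2)] A0 by (intro mult_mono) auto
    moreover have "0 \<le> ?p i * ?p i'" using A[OF i(1)] A[OF i(2)] by simp
    ultimately have "(?p i * ?p i') * \<bar>dot d (\<xi> i') (\<xi> i)\<bar> \<le> A\<^sup>2 * (if i' = i then 2 * q else \<epsilon>\<^sub>1 * q)"
      by (intro mult_mono) auto
    moreover have "\<bar>(y i * ?p i) * (y i' * ?p i') * dot d (\<xi> i') (\<xi> i)\<bar> = (?p i * ?p i') * \<bar>dot d (\<xi> i') (\<xi> i)\<bar>"
      using A[OF i(1)] A[OF i(2)] abs_y i by (simp add: abs_mult)
    ultimately show "(y i * ?p i) * (y i' * ?p i') * dot d (\<xi> i') (\<xi> i) \<le> A\<^sup>2 * (if i' = i then 2 * q else \<epsilon>\<^sub>1 * q)"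
      by linarith
  qed
  also have "\<dots> \<le> (\<Sum>i<n. A\<^sup>2 * (3 * q))"
  proof (rule sum_mono)
    fix i assume "i \<in> {..<n}"
    have "real n * \<epsilon>\<^sub>1 * 1 \<le> real n * \<epsilon>\<^sub>1 * \<alpha>" using \<epsilon>_nonneg(1) \<alpha>_ge(1) by (intro mult_left_mono) simp_all
    also have "\<dots> \<le> (s * \<epsilon>\<^sub>2 + real n * \<epsilon>\<^sub>1) * \<alpha>" using \<epsilon>_nonneg(2) \<alpha>_ge(1) s_pos by (intro mult_right_mono) simp_all
    finally have ne: "real n * \<epsilon>\<^sub>1 \<le> 1" using \<epsilon>_small \<nu>_bounds by linarith
    have "(\<Sum>i'<n. if i' = i then 2 * q else \<epsilon>\<^sub>1 * q) \<le> (\<Sum>i'<n. (if i' = i then 2 * q else 0) + \<epsilon>\<^sub>1 * q)"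
      using \<epsilon>_nonneg q_pos by (intro sum_mono) auto
    also have "\<dots> = 2 * q + real n * \<epsilon>\<^sub>1 * q" using \<open>i \<in> {..<n}\<close> by (simp add: sum.distrib sum.delta')
    also have "\<dots> \<le> 2 * q + 1 * q" using ne q_pos by (intro add_left_mono mult_right_mono) auto
    finally have "(\<Sum>i'<n. if i' = i then 2 * q else \<epsilon>\<^sub>1 * q) \<le> 3 * q" by simp
    then show "(\<Sum>i'<n. A\<^sup>2 * (if i' = i then 2 * q else \<epsilon>\<^sub>1 * q)) \<le> A\<^sup>2 * (3 * q)"
      unfolding sum_distrib_left[symmetric] by (intro mult_left_mono) auto
  qed
  also have "\<dots> = 3 * real n * q * A\<^sup>2" by simp
  finally have "\<sigma>\<^sup>2 * ((1 / q)\<^sup>2 * (\<Sum>k<d. (?S k)\<^sup>2)) \<le> \<sigma>\<^sup>2 * ((1 / q)\<^sup>2 * (3 * real n * q * A\<^sup>2))"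
    by (intro mult_left_mono) auto
  also have "\<dots> = 3 * (real n / real d) * A\<^sup>2"
    using \<sigma>_pos d_pos by (simp add: q_def power2_eq_square field_simps)
  also have "\<dots> = 3 * Q * (s * A\<^sup>2)" using s_pos by (simp add: Q_def)
  also have "s * A\<^sup>2 \<le> (G j t)\<^sup>2"
  proof -
    have "s * A\<^sup>2 = 4608\<^sup>2 / s * (G j t)\<^sup>2"
      using s_pos by (simp add: A_def power2_eq_square field_simps)
    also have "\<dots> \<le> 1 * (G j t)\<^sup>2" using s_large s_pos by (intro mult_right_mono) (auto simp: s\<^sub>1_def field_simps)
    finally show ?thesis by simp
  qed
  finally have S2: "\<sigma>\<^sup>2 * ((1 / q)\<^sup>2 * (\<Sum>k<d. (?S k)\<^sup>2)) \<le> 3 * Q * (G j t)\<^sup>2"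
    using Q by simp
  have "Q * 1 \<le> Q * (G j t)\<^sup>2" using Q G_ge_1 by (intro mult_left_mono) auto
  then have w2: "\<sigma>\<^sup>2 * dot d ?w ?w \<le> Q * (G j t)\<^sup>2" using w0 by (simp add: Q_def)
  have "\<sigma>\<^sup>2 * dot d (W t (- j, r)) (W t (- j, r)) \<le> 3 * (Q * (G j t)\<^sup>2 + 2401 * Q * (G j t)\<^sup>2 + 3 * Q * (G j t)\<^sup>2)"
    by (rule order_trans[OF W], intro mult_left_mono add_mono w2 c2 S2) simp_all
  also have "\<dots> \<le> 8000 * Q * (G j t)\<^sup>2" using Q by simp
  finally show ?thesis unfolding Q_def .
qed

end

end

section \<open>Gaussian concentration\<close>

lemma (in prob_space) chernoff:
  assumes [measurable]: "f \<in> borel_measurable M"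
    and K: "(\<integral>\<^sup>+x. ennreal (exp (f x)) \<partial>M) \<le> ennreal K" "0 \<le> K"
  shows "prob {x \<in> space M. t \<le> f x} \<le> K * exp (- t)"
proof -
  have "emeasure M {x \<in> space M. t \<le> f x} = (\<integral>\<^sup>+x. indicator {x \<in> space M. t \<le> f x} x \<partial>M)"
    by simp
  also have "\<dots> \<le> (\<integral>\<^sup>+x. ennreal (exp (f x)) * ennreal (exp (- t)) \<partial>M)"
  proof (rule nn_integral_mono)
    fix x assume "x \<in> space M"
    have "1 \<le> exp (f x) * exp (- t)" if "t \<le> f x" using that by (simp add: exp_add[symmetric])
    then show "indicator {x \<in> space M. t \<le> f x} x \<le> ennreal (exp (f x)) * ennreal (exp (- t))"
      by (auto simp: indicator_def ennreal_mult[symmetric])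
  qed
  also have "\<dots> = (\<integral>\<^sup>+x. ennreal (exp (f x)) \<partial>M) * ennreal (exp (- t))"
    by (rule nn_integral_multc) simp
  also have "\<dots> \<le> ennreal K * ennreal (exp (- t))" by (rule mult_right_mono[OF K(1)]) simp
  also have "\<dots> = ennreal (K * exp (- t))" using K(2) by (simp add: ennreal_mult)
  finally show ?thesis using K(2) by (simp add: emeasure_eq_measure)
qed

lemma nn_integral_normal_density: "0 < s \<Longrightarrow> (\<integral>\<^sup>+x. ennreal (normal_density \<mu> s x) \<partial>lborel) = 1"
  using prob_space.emeasure_space_1[OF prob_space_normal_density, of s \<mu>]
  by (simp add: emeasure_density)

text \<open>Completing the square: the weight exp (c x) shifts the mean of the normal density to c
  s^2.\<close>

lemma normal_mgf:
  assumes s: "0 < s"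
  shows "(\<integral>\<^sup>+x. ennreal (exp (c * x)) \<partial>density lborel (\<lambda>x. ennreal (normal_density 0 s x)))
    = ennreal (exp (c\<^sup>2 * s\<^sup>2 / 2))"
proof -
  have eq: "normal_density 0 s x * exp (c * x) = exp (c\<^sup>2 * s\<^sup>2 / 2) * normal_density (c * s\<^sup>2) s x" for x
  proof -
    have "- (x - 0)\<^sup>2 / (2 * s\<^sup>2) + c * x = c\<^sup>2 * s\<^sup>2 / 2 + - (x - c * s\<^sup>2)\<^sup>2 / (2 * s\<^sup>2)"
      using s by (simp add: field_simps power2_eq_square)
    then show ?thesis unfolding normal_density_def
      by (simp add: exp_add[symmetric] mult.assoc mult.left_commute)
  qed
  have "(\<integral>\<^sup>+x. ennreal (exp (c * x)) \<partial>density lborel (\<lambda>x. ennreal (normal_density 0 s x)))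
      = (\<integral>\<^sup>+x. ennreal (exp (c\<^sup>2 * s\<^sup>2 / 2)) * ennreal (normal_density (c * s\<^sup>2) s x) \<partial>lborel)"
    by (subst nn_integral_density) (auto simp: ennreal_mult[symmetric] eq intro!: nn_integral_cong)
  also have "\<dots> = ennreal (exp (c\<^sup>2 * s\<^sup>2 / 2))"
    using s by (simp add: nn_integral_cmult nn_integral_normal_density)
  finally show ?thesis .
qed

text \<open>The weight exp (c x^2) changes only the variance of the normal density, to s^2 / (1 - 2
  c s^2).\<close>

lemma normal_square_mgf:
  assumes s: "0 < s" and c: "2 * c * s\<^sup>2 < 1"
  shows "(\<integral>\<^sup>+x. ennreal (exp (c * x\<^sup>2)) \<partial>density lborel (\<lambda>x. ennreal (normal_density 0 s x)))
    = ennreal (1 / sqrt (1 - 2 * c * s\<^sup>2))"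
proof -
  define v where "v = 1 - 2 * c * s\<^sup>2"
  define s' where "s' = s / sqrt v"
  have v: "0 < v" using c by (simp add: v_def)
  have s': "0 < s'" "s'\<^sup>2 = s\<^sup>2 / v" using s v by (auto simp: s'_def power_divide)
  have eq: "normal_density 0 s x * exp (c * x\<^sup>2) = 1 / sqrt v * normal_density 0 s' x" for x
  proof -
    have "- (x - 0)\<^sup>2 / (2 * s\<^sup>2) + c * x\<^sup>2 = - (x - 0)\<^sup>2 / (2 * s'\<^sup>2)"
      using s v unfolding s'(2) by (simp add: field_simps v_def)
    moreover have "1 / sqrt (2 * pi * s\<^sup>2) = 1 / sqrt v * (1 / sqrt (2 * pi * s'\<^sup>2))"
      using s v unfolding s'(2) by (simp add: real_sqrt_mult real_sqrt_divide)
    ultimately show ?thesis unfolding normal_density_def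
      by (simp add: exp_add[symmetric] mult.assoc)
  qed
  have "(\<integral>\<^sup>+x. ennreal (exp (c * x\<^sup>2)) \<partial>density lborel (\<lambda>x. ennreal (normal_density 0 s x)))
      = (\<integral>\<^sup>+x. ennreal (1 / sqrt v) * ennreal (normal_density 0 s' x) \<partial>lborel)"
    using v by (subst nn_integral_density) (auto simp: ennreal_mult[symmetric] eq intro!: nn_integral_cong)
  also have "\<dots> = ennreal (1 / sqrt v)"
    using s' by (simp add: nn_integral_cmult nn_integral_normal_density)
  finally show ?thesis by (simp add: v_def)
qed

section \<open>Gaussian vectors: tails, norms and symmetry\<close>

lemma prob_space_gauss: "0 < s \<Longrightarrow> prob_space (gauss d s)"
  unfolding gauss_def by (intro prob_space_PiM prob_space_normal_density)

lemma sets_gauss [measurable_cong]: "sets (gauss d s) = sets (PiM {..<d} (\<lambda>_. borel))"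
  unfolding gauss_def by (intro sets_PiM_cong) auto

lemma measurable_gauss_component [measurable]: "k < d \<Longrightarrow> (\<lambda>x. x k) \<in> borel_measurable (gauss d s)"
  by measurable

lemma measurable_dot:
  assumes "\<And>k. k < d \<Longrightarrow> (\<lambda>x. u x k) \<in> borel_measurable M" "\<And>k. k < d \<Longrightarrow> (\<lambda>x. v x k) \<in> borel_measurable M"
  shows "(\<lambda>x. dot d (u x) (v x)) \<in> borel_measurable M"
  unfolding dot_def using assms by (intro borel_measurable_sum borel_measurable_times) auto

lemma borel_measurable_dot_gauss [measurable]: "(\<lambda>x. dot d x v) \<in> borel_measurable (gauss d s)"
  by (rule measurable_dot) (simp_all add: measurable_gauss_component)

lemma borel_measurable_dot_self_gauss [measurable]: "(\<lambda>x. dot d x x) \<in> borel_measurable (gauss d s)"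
  by (rule measurable_dot) (simp_all add: measurable_gauss_component)

lemma nn_integral_gauss_prod:
  assumes s: "0 < s" and f: "\<And>k. k < d \<Longrightarrow> f k \<in> borel_measurable borel"
  shows "(\<integral>\<^sup>+x. (\<Prod>k<d. f k (x k)) \<partial>gauss d s)
    = (\<Prod>k<d. \<integral>\<^sup>+x. f k x \<partial>density lborel (\<lambda>x. ennreal (normal_density 0 s x)))"
proof -
  interpret N: prob_space "density lborel (\<lambda>x. ennreal (normal_density 0 s x))"
    using s by (rule prob_space_normal_density)
  interpret product_sigma_finite "\<lambda>_::nat. density lborel (\<lambda>x. ennreal (normal_density 0 s x))" ..
  show ?thesis unfolding gauss_def
    by (rule product_nn_integral_prod) (use f in auto)
qed

lemma gauss_mgf:
  assumes s: "0 < s"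
  shows "(\<integral>\<^sup>+x. ennreal (exp (c * dot d x v)) \<partial>gauss d s) = ennreal (exp (c\<^sup>2 * s\<^sup>2 / 2 * dot d v v))"
proof -
  have "(\<integral>\<^sup>+x. ennreal (exp (c * dot d x v)) \<partial>gauss d s)
      = (\<integral>\<^sup>+x. (\<Prod>k<d. ennreal (exp (c * v k * x k))) \<partial>gauss d s)"
    by (simp add: prod_ennreal exp_sum[symmetric] dot_def sum_distrib_left mult_ac)
  also have "\<dots> = (\<Prod>k<d. ennreal (exp ((c * v k)\<^sup>2 * s\<^sup>2 / 2)))"
    using s by (subst nn_integral_gauss_prod) (auto simp: normal_mgf)
  also have "\<dots> = ennreal (exp (c\<^sup>2 * s\<^sup>2 / 2 * dot d v v))"
    by (simp add: prod_ennreal exp_sum[symmetric] dot_def sum_distrib_left power2_eq_square mult_ac)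
  finally show ?thesis .
qed

text \<open>Chernoff's bound with the exponent t / (s^2 B), optimal for |v|^2 = B. A positive bound
  B stands in for |v|^2 because in the applications v is a noise vector or a weight of which only an
  upper bound is known.\<close>

lemma gauss_tail:
  assumes s: "0 < s" and t: "0 \<le> t" and B: "dot d v v \<le> B" "0 < B"
  shows "measure (gauss d s) {x \<in> space (gauss d s). t \<le> dot d x v} \<le> exp (- t\<^sup>2 / (2 * s\<^sup>2 * B))"
proof (cases "t = 0")
  case True
  interpret prob_space "gauss d s" using s by (rule prob_space_gauss)
  show ?thesis using True by simp
next
  case False
  interpret prob_space "gauss d s" using s by (rule prob_space_gauss)
  define c where "c = t / (s\<^sup>2 * B)"
  have c: "0 < c" using False t s B by (simp add: c_def)
  have "{x \<in> space (gauss d s). t \<le> dot d x v} = {x \<in> space (gauss d s). c * t \<le> c * dot d x v}"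
    using c by simp
  also have "prob \<dots> \<le> exp (c\<^sup>2 * s\<^sup>2 / 2 * dot d v v) * exp (- (c * t))"
    by (rule chernoff) (auto simp: gauss_mgf[OF s])
  also have "\<dots> \<le> exp (c\<^sup>2 * s\<^sup>2 / 2 * B) * exp (- (c * t))"
    using B by (intro mult_right_mono) (auto intro!: mult_left_mono)
  also have "\<dots> = exp (- t\<^sup>2 / (2 * s\<^sup>2 * B))"
    using s B unfolding exp_add[symmetric] by (simp add: c_def field_simps power2_eq_square)
  finally show ?thesis .
qed

lemma gauss_tail_abs:
  assumes s: "0 < s" and t: "0 \<le> t" and B: "dot d v v \<le> B" "0 < B"
  shows "measure (gauss d s) {x \<in> space (gauss d s). t \<le> \<bar>dot d x v\<bar>} \<le> 2 * exp (- t\<^sup>2 / (2 * s\<^sup>2 * B))"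
proof -
  interpret prob_space "gauss d s" using s by (rule prob_space_gauss)
  let ?v = "\<lambda>k. - v k"
  have neg: "dot d x ?v = - dot d x v" "dot d ?v ?v = dot d v v" for x
    by (simp_all add: dot_def sum_negf)
  have eq: "{x \<in> space (gauss d s). t \<le> \<bar>dot d x v\<bar>}
      = {x \<in> space (gauss d s). t \<le> dot d x v} \<union> {x \<in> space (gauss d s). t \<le> dot d x ?v}"
    by (auto simp: neg)
  have "prob {x \<in> space (gauss d s). t \<le> \<bar>dot d x v\<bar>} \<le> prob {x \<in> space (gauss d s). t \<le> dot d x v} + prob {x \<in> space (gauss d s). t \<le> dot d x ?v}"
    unfolding eq by (rule measure_Un_le) measurable
  also have "\<dots> \<le> exp (- t\<^sup>2 / (2 * s\<^sup>2 * B)) + exp (- t\<^sup>2 / (2 * s\<^sup>2 * B))"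
  proof -
    have "dot d ?v ?v \<le> B" using B(1) by (simp only: neg(2))
    then show ?thesis using assms by (intro add_mono gauss_tail) simp_all
  qed
  finally show ?thesis by simp
qed

lemma gauss_square_mgf:
  assumes s: "0 < s" and c: "2 * c < 1"
  shows "(\<integral>\<^sup>+x. ennreal (exp (c / s\<^sup>2 * dot d x x)) \<partial>gauss d s) = ennreal ((1 / sqrt (1 - 2 * c)) ^ d)"
proof -
  have "(\<integral>\<^sup>+x. ennreal (exp (c / s\<^sup>2 * dot d x x)) \<partial>gauss d s)
      = (\<integral>\<^sup>+x. (\<Prod>k<d. ennreal (exp (c / s\<^sup>2 * (x k)\<^sup>2))) \<partial>gauss d s)"
    by (simp add: prod_ennreal exp_sum[symmetric] dot_def sum_distrib_left sum_divide_distrib power2_eq_square mult_ac)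
  also have "\<dots> = (\<Prod>k<d. ennreal (1 / sqrt (1 - 2 * c)))"
    using s normal_square_mgf[OF s, of "c / s\<^sup>2"] c by (subst nn_integral_gauss_prod) auto
  also have "\<dots> = ennreal ((1 / sqrt (1 - 2 * c)) ^ d)"
    using c by (simp add: ennreal_power)
  finally show ?thesis .
qed

lemma exp_ge_pow4: assumes "0 \<le> (x::real)" shows "(1 + x / 4) ^ 4 \<le> exp x"
  using power_mono[OF exp_ge_add_one_self[of "x / 4"], of 4] assms
  by (simp add: exp_of_nat_mult[symmetric])

text \<open>Chernoff's bound at c = 1 / 4 gives the d-th power of sqrt 2 * exp (- 1 / 2); the rate
  is 1 / 2 - 7 / 16 = 1 / 16.\<close>

lemma gauss_norm_upper:
  assumes s: "0 < s"
  shows "measure (gauss d s) {x \<in> space (gauss d s). 2 * (s\<^sup>2 * real d) \<le> dot d x x} \<le> exp (- real d / 16)"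
proof -
  interpret prob_space "gauss d s" using s by (rule prob_space_gauss)
  have r: "sqrt 2 \<le> exp (7 / 16)"
  proof (rule real_le_lsqrt)
    show "2 \<le> (exp (7 / 16 :: real))\<^sup>2"
      using exp_ge_pow4[of "7 / 8"] by (simp add: exp_double[symmetric] power4_eq_xxxx)
  qed auto
  have "{x \<in> space (gauss d s). 2 * (s\<^sup>2 * real d) \<le> dot d x x}
      = {x \<in> space (gauss d s). real d / 2 \<le> (1 / 4) / s\<^sup>2 * dot d x x}"
    using s by (auto simp: field_simps)
  also have "prob \<dots> \<le> (1 / sqrt (1 - 2 * (1 / 4))) ^ d * exp (- (real d / 2))"
    using gauss_square_mgf[OF s, of "1 / 4" d] by (intro chernoff) auto
  also have "\<dots> = (sqrt 2) ^ d * exp (- (real d / 2))" by (simp add: real_sqrt_divide)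
  also have "\<dots> \<le> exp (7 / 16) ^ d * exp (- (real d / 2))" using r by (intro mult_right_mono power_mono) auto
  also have "\<dots> = exp (- real d / 16)" by (simp add: exp_of_nat_mult[symmetric] exp_add[symmetric])
  finally show ?thesis .
qed

text \<open>Chernoff's bound at the negative exponent c = - 1 / 2; the rate is 3 / 10 - 1 / 4 = 1 /
  20.\<close>

lemma gauss_norm_lower:
  assumes s: "0 < s"
  shows "measure (gauss d s) {x \<in> space (gauss d s). dot d x x \<le> (s\<^sup>2 * real d) / 2} \<le> exp (- real d / 20)"
proof -
  interpret prob_space "gauss d s" using s by (rule prob_space_gauss)
  have r: "1 / sqrt 2 \<le> exp (- 3 / 10)"
  proof -
    have "exp (3 / 5) \<le> (2::real)"
    proof -
      have "exp (3 / 5 :: real) \<le> 1 + 3 / 5 + (3 / 5)\<^sup>2" by (rule exp_bound) auto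
      then show ?thesis by (simp add: power2_eq_square) 
    qed
    then have "exp (3 / 10) \<le> sqrt 2" by (intro real_le_rsqrt) (simp add: exp_double[symmetric])
    then have "1 / sqrt 2 \<le> 1 / exp (3 / 10)" by (intro divide_left_mono) auto
    then show ?thesis by (simp add: exp_minus inverse_eq_divide)
  qed
  have "{x \<in> space (gauss d s). dot d x x \<le> (s\<^sup>2 * real d) / 2}
      = {x \<in> space (gauss d s). - (real d / 4) \<le> (- 1 / 2) / s\<^sup>2 * dot d x x}"
    using s by (auto simp: field_simps)
  also have "prob \<dots> \<le> (1 / sqrt (1 - 2 * (- 1 / 2))) ^ d * exp (- (- (real d / 4)))"
    using gauss_square_mgf[OF s, of "- 1 / 2" d] by (intro chernoff) auto
  also have "\<dots> = (1 / sqrt 2) ^ d * exp (real d / 4)" by simp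
  also have "\<dots> \<le> exp (- 3 / 10) ^ d * exp (real d / 4)" using r by (intro mult_right_mono power_mono) auto
  also have "\<dots> = exp (- real d / 20)" by (simp add: exp_of_nat_mult[symmetric] exp_add[symmetric])
  finally show ?thesis .
qed

lemma normal_uminus:
  assumes s: "0 < s"
  defines "N \<equiv> density lborel (\<lambda>x. ennreal (normal_density 0 s x))"
  shows "distr N N uminus = N"
proof -
  interpret prob_space N unfolding N_def using s by (rule prob_space_normal_density)
  have "distributed N lborel (\<lambda>x. x) (normal_density 0 s)"
    unfolding distributed_def N_def by (auto intro!: distr_id2)
  from normal_density_affine[OF this s, of "-1" 0]
  have "distr N lborel (\<lambda>x. - x) = N"
    by (simp add: distributed_def N_def)
  moreover have "distr N N uminus = distr N lborel (\<lambda>x. - x)"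
    by (rule distr_cong) (simp_all add: N_def)
  ultimately show ?thesis by simp
qed

lemma gauss_uminus:
  assumes "0 < s"
  shows "distr (gauss d s) (gauss d s) (compose {..<d} uminus) = gauss d s"
  unfolding gauss_def using assms
  by (subst distr_PiM_finite_prob_space') (auto simp: prob_space_normal_density normal_uminus)

text \<open>Reflection preserves the measure and exchanges the two closed half-spaces, which cover
  the space. For v = 0 both are the whole space, so the inequality can be strict.\<close>

lemma gauss_halfspace:
  assumes s: "0 < s"
  shows "1 / 2 \<le> measure (gauss d s) {x \<in> space (gauss d s). 0 \<le> dot d x v}"
proof -
  let ?G = "gauss d s"
  interpret prob_space ?G using s by (rule prob_space_gauss)
  let ?A = "{x \<in> space ?G. 0 \<le> dot d x v}" and ?B = "{x \<in> space ?G. dot d x v \<le> 0}"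
  have meas: "compose {..<d} uminus \<in> measurable ?G ?G"
    unfolding compose_def gauss_def by measurable
  have neg: "dot d (compose {..<d} uminus x) v = - dot d x v" for x
    by (simp add: dot_def compose_def sum_negf)
  have "prob ?A = measure (distr ?G ?G (compose {..<d} uminus)) ?A"
    by (simp only: gauss_uminus[OF s])
  also have "\<dots> = prob (compose {..<d} uminus -` ?A \<inter> space ?G)"
    by (rule measure_distr[OF meas]) measurable
  also have "compose {..<d} uminus -` ?A \<inter> space ?G = ?B"
    using measurable_space[OF meas] by (auto simp: neg)
  finally have "prob ?A = prob ?B" .
  moreover have "1 \<le> prob ?A + prob ?B"
  proof -
    have "?A \<union> ?B = space ?G" by auto
    then have "prob (?A \<union> ?B) = 1" by (simp add: prob_space)
    moreover have "prob (?A \<union> ?B) \<le> prob ?A + prob ?B" by (rule measure_Un_le) measurable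
    ultimately show ?thesis by simp
  qed
  ultimately show ?thesis by simp
qed

section \<open>Product measures and union bounds\<close>

lemma measure_PiM_component:
  assumes "\<And>i. i \<in> I \<Longrightarrow> prob_space (M i)" "i \<in> I" "{x \<in> space (M i). Q x} \<in> sets (M i)"
  shows "measure (PiM I M) {\<omega> \<in> space (PiM I M). Q (\<omega> i)} = measure (M i) {x \<in> space (M i). Q x}"
proof -
  have "measure (M i) {x \<in> space (M i). Q x} = measure (distr (PiM I M) (M i) (\<lambda>\<omega>. \<omega> i)) {x \<in> space (M i). Q x}"
    using distr_PiM_component[where I = I and M = M and i = i] assms(1,2) by simp
  also have "\<dots> = measure (PiM I M) ((\<lambda>\<omega>. \<omega> i) -` {x \<in> space (M i). Q x} \<inter> space (PiM I M))"
    using assms by (intro measure_distr) auto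
  also have "(\<lambda>\<omega>. \<omega> i) -` {x \<in> space (M i). Q x} \<inter> space (PiM I M) = {\<omega> \<in> space (PiM I M). Q (\<omega> i)}"
    using assms(2) by (auto simp: space_PiM)
  finally show ?thesis by simp
qed

text \<open>Fubini in coordinate i. For an inner product of two independent vectors, one of them is
  frozen and becomes a fixed direction.\<close>

lemma emeasure_PiM_le_fiberwise:
  assumes M: "\<And>i. prob_space (M i)" and I: "finite I" "i \<in> I" and A: "A \<in> sets (PiM I M)"
    and le: "\<And>x. x \<in> space (PiM (I - {i}) M) \<Longrightarrow> emeasure (M i) {y \<in> space (M i). x(i := y) \<in> A} \<le> p"
  shows "emeasure (PiM I M) A \<le> p"
proof -
  interpret product_prob_space M I by (rule product_prob_spaceI) (rule M)
  have I': "insert i (I - {i}) = I" using I by auto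
  have meas: "{y \<in> space (M i). x(i := y) \<in> A} \<in> sets (M i)" if x: "x \<in> space (PiM (I - {i}) M)" for x
  proof -
    have "(\<lambda>y. x(i := y)) \<in> measurable (M i) (PiM (insert i (I - {i})) M)"
      using x by (intro measurable_component_update) auto
    then have "(\<lambda>y. x(i := y)) -` A \<inter> space (M i) \<in> sets (M i)"
      using A unfolding I' by (rule measurable_sets)
    moreover have "(\<lambda>y. x(i := y)) -` A \<inter> space (M i) = {y \<in> space (M i). x(i := y) \<in> A}" by auto
    ultimately show ?thesis by simp
  qed
  have "emeasure (PiM I M) A = integral\<^sup>N (PiM (insert i (I - {i})) M) (indicator A)"
    using A by (simp only: I' nn_integral_indicator)
  also have "\<dots> = (\<integral>\<^sup>+x. \<integral>\<^sup>+y. indicator A (x(i := y)) \<partial>M i \<partial>PiM (I - {i}) M)"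
  proof -
    have "indicator A \<in> borel_measurable (PiM (insert i (I - {i})) M)" unfolding I' using A by simp
    then show ?thesis using I by (intro product_nn_integral_insert) auto
  qed
  also have "\<dots> = (\<integral>\<^sup>+x. emeasure (M i) {y \<in> space (M i). x(i := y) \<in> A} \<partial>PiM (I - {i}) M)"
  proof (rule nn_integral_cong)
    fix x assume x: "x \<in> space (PiM (I - {i}) M)"
    have "(\<integral>\<^sup>+y. indicator A (x(i := y)) \<partial>M i) = (\<integral>\<^sup>+y. indicator {y \<in> space (M i). x(i := y) \<in> A} y \<partial>M i)"
      by (intro nn_integral_cong) (simp add: indicator_def)
    then show "(\<integral>\<^sup>+y. indicator A (x(i := y)) \<partial>M i) = emeasure (M i) {y \<in> space (M i). x(i := y) \<in> A}"
      using meas[OF x] by simp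
  qed
  also have "\<dots> \<le> (\<integral>\<^sup>+x. p \<partial>PiM (I - {i}) M)" by (rule nn_integral_mono) (rule le)
  also have "\<dots> = p"
    using prob_space.emeasure_space_1[OF prob_space_PiM[of "I - {i}" M]] M by simp
  finally show ?thesis .
qed

text \<open>The good events are finite conjunctions. Measurability and union bounds are both
  expressed through the negated conditions.\<close>

lemma sets_not_all:
  assumes "finite I" "\<And>i. i \<in> I \<Longrightarrow> {x \<in> space M. \<not> Q i x} \<in> sets M"
  shows "{x \<in> space M. \<not> (\<forall>i\<in>I. Q i x)} \<in> sets M"
proof -
  have "{x \<in> space M. \<not> (\<forall>i\<in>I. Q i x)} = (\<Union>i\<in>I. {x \<in> space M. \<not> Q i x})" by auto
  also have "\<dots> \<in> sets M" using assms by (intro sets.finite_UN) auto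
  finally show ?thesis .
qed

lemma sets_not_conj:
  assumes "{x \<in> space M. \<not> Q x} \<in> sets M" "{x \<in> space M. \<not> R x} \<in> sets M"
  shows "{x \<in> space M. \<not> (Q x \<and> R x)} \<in> sets M"
  using sets.Un[OF assms] by (rule back_subst[of "\<lambda>A. A \<in> sets M"]) auto

lemma (in prob_space) prob_not_all_le:
  assumes "finite I" "\<And>i. i \<in> I \<Longrightarrow> {x \<in> space M. \<not> Q i x} \<in> events"
    and "\<And>i. i \<in> I \<Longrightarrow> prob {x \<in> space M. \<not> Q i x} \<le> c"
  shows "prob {x \<in> space M. \<not> (\<forall>i\<in>I. Q i x)} \<le> real (card I) * c"
proof -
  have "{x \<in> space M. \<not> (\<forall>i\<in>I. Q i x)} = (\<Union>i\<in>I. {x \<in> space M. \<not> Q i x})" by auto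
  also have "prob \<dots> \<le> (\<Sum>i\<in>I. prob {x \<in> space M. \<not> Q i x})"
    using assms by (intro measure_UNION_le) auto
  also have "\<dots> \<le> (\<Sum>i\<in>I. c)" using assms by (intro sum_mono) auto
  finally show ?thesis by simp
qed

lemma (in prob_space) prob_not_conj_le:
  assumes "{x \<in> space M. \<not> Q x} \<in> events" "{x \<in> space M. \<not> R x} \<in> events"
    and "prob {x \<in> space M. \<not> Q x} \<le> a" "prob {x \<in> space M. \<not> R x} \<le> b"
  shows "prob {x \<in> space M. \<not> (Q x \<and> R x)} \<le> a + b"
proof -
  have eq: "{x \<in> space M. \<not> (Q x \<and> R x)} = {x \<in> space M. \<not> Q x} \<union> {x \<in> space M. \<not> R x}" by auto
  show ?thesis unfolding eq using assms by (intro order_trans[OF measure_Un_le]) auto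
qed

text \<open>The second clause concerns only partners of squared norm at most 2 q: for every fixed
  partner its failure then has small probability, as a fiberwise bound requires. The first clause
  makes the restriction harmless.\<close>

definition good_noise :: "nat \<Rightarrow> nat \<Rightarrow> vec \<Rightarrow> real \<Rightarrow> real \<Rightarrow> real \<Rightarrow> (nat \<Rightarrow> vec) \<Rightarrow> bool" where
  "good_noise d n \<mu> \<sigma> \<epsilon>\<^sub>1 \<epsilon>\<^sub>2 \<xi> \<longleftrightarrow>
    (\<forall>i\<in>{..<n}. \<sigma>\<^sup>2 * real d / 2 \<le> dot d (\<xi> i) (\<xi> i) \<and> dot d (\<xi> i) (\<xi> i) \<le> 2 * (\<sigma>\<^sup>2 * real d)) \<and>
    (\<forall>w\<in>{..<n} \<times> {..<n}. fst w \<noteq> snd w \<longrightarrow> dot d (\<xi> (snd w)) (\<xi> (snd w)) \<le> 2 * (\<sigma>\<^sup>2 * real d) \<longrightarrow>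
       \<bar>dot d (\<xi> (fst w)) (\<xi> (snd w))\<bar> \<le> \<epsilon>\<^sub>1 * (\<sigma>\<^sup>2 * real d)) \<and>
    (\<forall>i\<in>{..<n}. \<bar>dot d (\<xi> i) \<mu>\<bar> \<le> \<epsilon>\<^sub>2 * dot d \<mu> \<mu>)"

lemma measurable_PiM_gauss_component:
  "i \<in> I \<Longrightarrow> k < d \<Longrightarrow> (\<lambda>\<xi>. \<xi> i k) \<in> borel_measurable (PiM I (\<lambda>_. gauss d s))"
  by (rule measurable_compose[of "\<lambda>\<xi>. \<xi> i" _ "gauss d s" "\<lambda>x. x k"]) auto

lemma measurable_dot_PiM:
  assumes "i \<in> I" "k \<in> I"
  shows "(\<lambda>\<xi>. dot d (\<xi> i) (\<xi> k)) \<in> borel_measurable (PiM I (\<lambda>_. gauss d s))"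
  by (rule measurable_dot) (rule measurable_PiM_gauss_component[OF assms(1)] measurable_PiM_gauss_component[OF assms(2)], assumption)+

lemma borel_measurable_dot_PiM: "i \<in> I \<Longrightarrow> (\<lambda>\<xi>. dot d (\<xi> i) v) \<in> borel_measurable (PiM I (\<lambda>_. gauss d s))"
  by (rule measurable_dot) (simp_all add: measurable_PiM_gauss_component)

lemma good_noise_prob:
  fixes \<delta> :: real
  assumes \<sigma>: "0 < \<sigma>" and pos: "0 < d" "0 < n" "0 < dot d \<mu> \<mu>" and \<delta>: "0 < \<delta>" "\<delta> < 1"
    and \<epsilon>: "0 \<le> \<epsilon>\<^sub>1" "0 \<le> \<epsilon>\<^sub>2"
    and d: "exp (- real d / 20) \<le> \<delta> / real n"
    and \<epsilon>\<^sub>1: "exp (- \<epsilon>\<^sub>1\<^sup>2 * real d / 4) \<le> (\<delta> / real n)\<^sup>2"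
    and \<epsilon>\<^sub>2: "exp (- \<epsilon>\<^sub>2\<^sup>2 * dot d \<mu> \<mu> / (2 * \<sigma>\<^sup>2)) \<le> \<delta> / real n"
  defines "N \<equiv> PiM {..<n} (\<lambda>_. gauss d \<sigma>)"
  shows "{\<xi> \<in> space N. \<not> good_noise d n \<mu> \<sigma> \<epsilon>\<^sub>1 \<epsilon>\<^sub>2 \<xi>} \<in> sets N"
    and "measure N {\<xi> \<in> space N. \<not> good_noise d n \<mu> \<sigma> \<epsilon>\<^sub>1 \<epsilon>\<^sub>2 \<xi>} \<le> 6 * \<delta>"
proof -
  let ?G = "gauss d \<sigma>"
  interpret G: prob_space ?G using \<sigma> by (rule prob_space_gauss)
  interpret N: prob_space N unfolding N_def by (intro prob_space_PiM G.prob_space_axioms)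
  define q where "q = \<sigma>\<^sup>2 * real d"
  have q: "0 < q" using \<sigma> pos by (simp add: q_def)
  define Q1 where "Q1 i \<xi> \<longleftrightarrow> q / 2 \<le> dot d (\<xi> i) (\<xi> i) \<and> dot d (\<xi> i) (\<xi> i) \<le> 2 * q" for i :: nat and \<xi> :: "nat \<Rightarrow> vec"
  define Q2 where "Q2 w \<xi> \<longleftrightarrow> (fst w \<noteq> snd w \<longrightarrow> dot d (\<xi> (snd w)) (\<xi> (snd w)) \<le> 2 * q \<longrightarrow>
       \<bar>dot d (\<xi> (fst w)) (\<xi> (snd w))\<bar> \<le> \<epsilon>\<^sub>1 * q)" for w :: "nat \<times> nat" and \<xi> :: "nat \<Rightarrow> vec"
  define Q3 where "Q3 i \<xi> \<longleftrightarrow> \<bar>dot d (\<xi> i) \<mu>\<bar> \<le> \<epsilon>\<^sub>2 * dot d \<mu> \<mu>" for i :: nat and \<xi> :: "nat \<Rightarrow> vec"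
  have good: "good_noise d n \<mu> \<sigma> \<epsilon>\<^sub>1 \<epsilon>\<^sub>2 \<xi> \<longleftrightarrow>
      (\<forall>i\<in>{..<n}. Q1 i \<xi>) \<and> (\<forall>w\<in>{..<n} \<times> {..<n}. Q2 w \<xi>) \<and> (\<forall>i\<in>{..<n}. Q3 i \<xi>)" for \<xi>
    by (simp add: good_noise_def Q1_def Q2_def Q3_def q_def)
  have m1: "{\<xi> \<in> space N. \<not> Q1 i \<xi>} \<in> sets N" if "i \<in> {..<n}" for i
  proof -
    have [measurable]: "(\<lambda>\<xi>. dot d (\<xi> i) (\<xi> i)) \<in> borel_measurable N"
      unfolding N_def using that by (intro measurable_dot_PiM)
    show ?thesis unfolding Q1_def by measurable
  qed
  have m2: "{\<xi> \<in> space N. \<not> Q2 w \<xi>} \<in> sets N" if "w \<in> {..<n} \<times> {..<n}" for w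
  proof -
    obtain i k where w: "w = (i, k)" "i < n" "k < n" using \<open>w \<in> {..<n} \<times> {..<n}\<close> by (cases w) auto
    note meas = measurable_dot_PiM[of _ "{..<n}" _ d \<sigma>, folded N_def]
    show ?thesis
    proof (cases "i = k")
      case True
      then show ?thesis by (simp add: Q2_def w(1))
    next
      case False
      then have "{\<xi> \<in> space N. \<not> Q2 w \<xi>} = {\<xi> \<in> space N. dot d (\<xi> k) (\<xi> k) \<le> 2 * q}
          \<inter> {\<xi> \<in> space N. \<epsilon>\<^sub>1 * q < \<bar>dot d (\<xi> i) (\<xi> k)\<bar>}"
        by (auto simp: Q2_def w(1))
      also have "\<dots> \<in> sets N"
        using w by (intro sets.Int borel_measurable_le borel_measurable_less borel_measurable_abs
            borel_measurable_const meas) simp_all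
      finally show ?thesis .
    qed
  qed
  have m3: "{\<xi> \<in> space N. \<not> Q3 i \<xi>} \<in> sets N" if "i \<in> {..<n}" for i
  proof -
    have [measurable]: "(\<lambda>\<xi>. dot d (\<xi> i) \<mu>) \<in> borel_measurable N"
      unfolding N_def using that by (intro borel_measurable_dot_PiM)
    show ?thesis unfolding Q3_def by measurable
  qed
  have M1: "{\<xi> \<in> space N. \<not> (\<forall>i\<in>{..<n}. Q1 i \<xi>)} \<in> sets N"
    and M2: "{\<xi> \<in> space N. \<not> (\<forall>w\<in>{..<n} \<times> {..<n}. Q2 w \<xi>)} \<in> sets N"
    and M3: "{\<xi> \<in> space N. \<not> (\<forall>i\<in>{..<n}. Q3 i \<xi>)} \<in> sets N"
    by (intro sets_not_all m1 m2 m3; simp)+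
  have p1: "N.prob {\<xi> \<in> space N. \<not> Q1 i \<xi>} \<le> 2 * (\<delta> / real n)" if i: "i \<in> {..<n}" for i
  proof -
    have "N.prob {\<xi> \<in> space N. \<not> Q1 i \<xi>}
        = G.prob {x \<in> space ?G. \<not> (q / 2 \<le> dot d x x \<and> dot d x x \<le> 2 * q)}"
      unfolding N_def Q1_def using i G.prob_space_axioms
      by (intro measure_PiM_component[where Q = "\<lambda>x. \<not> (q / 2 \<le> dot d x x \<and> dot d x x \<le> 2 * q)"]) auto
    also have "\<dots> \<le> \<delta> / real n + \<delta> / real n"
    proof (rule G.prob_not_conj_le)
      have "G.prob {x \<in> space ?G. \<not> q / 2 \<le> dot d x x} \<le> G.prob {x \<in> space ?G. dot d x x \<le> \<sigma>\<^sup>2 * real d / 2}"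
        by (rule G.finite_measure_mono) (auto simp: q_def)
      then show "G.prob {x \<in> space ?G. \<not> q / 2 \<le> dot d x x} \<le> \<delta> / real n"
        using gauss_norm_lower[OF \<sigma>, of d] d by linarith
      have "G.prob {x \<in> space ?G. \<not> dot d x x \<le> 2 * q} \<le> G.prob {x \<in> space ?G. 2 * (\<sigma>\<^sup>2 * real d) \<le> dot d x x}"
        by (rule G.finite_measure_mono) (auto simp: q_def)
      moreover have "exp (- real d / 16) \<le> exp (- real d / 20)" by simp
      ultimately show "G.prob {x \<in> space ?G. \<not> dot d x x \<le> 2 * q} \<le> \<delta> / real n"
        using gauss_norm_upper[OF \<sigma>, of d] d by linarith
    qed measurable
    finally show ?thesis by simp
  qed
  have p2: "N.prob {\<xi> \<in> space N. \<not> Q2 w \<xi>} \<le> 2 * (\<delta> / real n)\<^sup>2" if w: "w \<in> {..<n} \<times> {..<n}" for w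
  proof (cases "fst w = snd w")
    case True
    then show ?thesis by (simp add: Q2_def)
  next
    case False
    let ?i = "fst w" and ?k = "snd w"
    have i: "?i \<in> {..<n}" "?k \<in> {..<n}" using w by auto
    have "emeasure N {\<xi> \<in> space N. \<not> Q2 w \<xi>} \<le> ennreal (2 * (\<delta> / real n)\<^sup>2)"
      unfolding N_def
    proof (rule emeasure_PiM_le_fiberwise)
      show "{\<xi> \<in> space (PiM {..<n} (\<lambda>_. ?G)). \<not> Q2 w \<xi>} \<in> sets (PiM {..<n} (\<lambda>_. ?G))"
        using m2[OF w] by (simp add: N_def)
      fix \<xi> assume \<xi>: "\<xi> \<in> space (PiM ({..<n} - {?i}) (\<lambda>_. ?G))"
      have sub: "{x \<in> space ?G. \<xi>(?i := x) \<in> {\<xi> \<in> space (PiM {..<n} (\<lambda>_. ?G)). \<not> Q2 w \<xi>}}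
          \<subseteq> {x \<in> space ?G. dot d (\<xi> ?k) (\<xi> ?k) \<le> 2 * q \<and> \<epsilon>\<^sub>1 * q \<le> \<bar>dot d x (\<xi> ?k)\<bar>}" (is "?A \<subseteq> ?B")
        using False by (auto simp: Q2_def)
      have "emeasure ?G ?A \<le> emeasure ?G ?B" by (rule emeasure_mono[OF sub]) measurable
      also have "\<dots> \<le> ennreal (2 * (\<delta> / real n)\<^sup>2)"
      proof (cases "dot d (\<xi> ?k) (\<xi> ?k) \<le> 2 * q")
        case True
        have "G.prob ?B \<le> 2 * exp (- (\<epsilon>\<^sub>1 * q)\<^sup>2 / (2 * \<sigma>\<^sup>2 * (2 * q)))"
          using gauss_tail_abs[OF \<sigma> _ True, of "\<epsilon>\<^sub>1 * q"] q \<epsilon> True by simp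
        also have "- (\<epsilon>\<^sub>1 * q)\<^sup>2 / (2 * \<sigma>\<^sup>2 * (2 * q)) = - \<epsilon>\<^sub>1\<^sup>2 * real d / 4"
          using \<sigma> pos by (simp add: q_def power2_eq_square)
        finally show ?thesis using \<epsilon>\<^sub>1 by (simp add: G.emeasure_eq_measure ennreal_leI)
      qed simp
      finally show "emeasure ?G ?A \<le> ennreal (2 * (\<delta> / real n)\<^sup>2)" .
    qed (use i G.prob_space_axioms in auto)
    then show ?thesis by (simp add: N.emeasure_eq_measure)
  qed
  have p3: "N.prob {\<xi> \<in> space N. \<not> Q3 i \<xi>} \<le> 2 * (\<delta> / real n)" if i: "i \<in> {..<n}" for i
  proof -
    have "N.prob {\<xi> \<in> space N. \<not> Q3 i \<xi>} = G.prob {x \<in> space ?G. \<not> \<bar>dot d x \<mu>\<bar> \<le> \<epsilon>\<^sub>2 * dot d \<mu> \<mu>}"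
      unfolding N_def Q3_def using i G.prob_space_axioms
      by (intro measure_PiM_component[where Q = "\<lambda>x. \<not> \<bar>dot d x \<mu>\<bar> \<le> \<epsilon>\<^sub>2 * dot d \<mu> \<mu>"]) auto
    also have "\<dots> \<le> G.prob {x \<in> space ?G. \<epsilon>\<^sub>2 * dot d \<mu> \<mu> \<le> \<bar>dot d x \<mu>\<bar>}"
      by (rule G.finite_measure_mono) auto
    also have "\<dots> \<le> 2 * exp (- (\<epsilon>\<^sub>2 * dot d \<mu> \<mu>)\<^sup>2 / (2 * \<sigma>\<^sup>2 * dot d \<mu> \<mu>))"
      using pos \<epsilon> by (intro gauss_tail_abs[OF \<sigma>]) auto
    also have "- (\<epsilon>\<^sub>2 * dot d \<mu> \<mu>)\<^sup>2 / (2 * \<sigma>\<^sup>2 * dot d \<mu> \<mu>) = - \<epsilon>\<^sub>2\<^sup>2 * dot d \<mu> \<mu> / (2 * \<sigma>\<^sup>2)"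
      using pos by (simp add: power2_eq_square)
    finally show ?thesis using \<epsilon>\<^sub>2 by simp
  qed
  show "{\<xi> \<in> space N. \<not> good_noise d n \<mu> \<sigma> \<epsilon>\<^sub>1 \<epsilon>\<^sub>2 \<xi>} \<in> sets N"
    unfolding good by (intro sets_not_conj M1 M2 M3)
  \<comment> \<open>Norms, pairs and products with \<mu> have the shares 2 * \<delta>, 2 *
    \<delta>^2 and 2 * \<delta>; each of the n^2 pairs is allowed 2 * (\<delta> / n)^2.\<close>
  have "N.prob {\<xi> \<in> space N. \<not> good_noise d n \<mu> \<sigma> \<epsilon>\<^sub>1 \<epsilon>\<^sub>2 \<xi>}
      \<le> real (card {..<n}) * (2 * (\<delta> / real n)) + (real (card ({..<n} \<times> {..<n})) * (2 * (\<delta> / real n)\<^sup>2)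
         + real (card {..<n}) * (2 * (\<delta> / real n)))"
    unfolding good
    by (intro N.prob_not_conj_le N.prob_not_all_le m1 m2 m3 p1 p2 p3 M1 M2 M3 sets_not_conj)
       simp_all
  also have "\<dots> = 4 * \<delta> + 2 * \<delta>\<^sup>2" using pos by (simp add: power2_eq_square)
  also have "\<delta>\<^sup>2 \<le> \<delta>" using \<delta> by (simp add: power2_eq_square)
  finally show "N.prob {\<xi> \<in> space N. \<not> good_noise d n \<mu> \<sigma> \<epsilon>\<^sub>1 \<epsilon>\<^sub>2 \<xi>} \<le> 6 * \<delta>" by simp
qed

section \<open>Random initialization\<close>

lemma finite_neurons: "finite (neurons m)"
  by (simp add: neurons_def)

lemma neurons_iff: "(j, r) \<in> neurons m \<longleftrightarrow> (j = 1 \<or> j = -1) \<and> r < m"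
  by (auto simp: neurons_def)

lemma card_neurons: "real (card (neurons m)) = 2 * real m"
  by (simp add: neurons_def card_cartesian_product)

lemma borel_measurable_of_bool_nonneg:
  fixes f :: "'a \<Rightarrow> real"
  assumes "f \<in> borel_measurable M"
  shows "(\<lambda>x. of_bool (0 \<le> f x) :: real) \<in> borel_measurable M"
proof -
  have eq: "(\<lambda>x. of_bool (0 \<le> f x) :: real) = (\<lambda>x. indicator {0..} (f x))" by (auto simp: indicator_def)
  show ?thesis unfolding eq by (rule measurable_compose[OF assms]) simp
qed

text \<open>The moment generating function, at -1, of an indicator with probability at least 1 /
  2.\<close>

lemma gauss_activation_mgf:
  assumes s: "0 < s"
  shows "(\<integral>\<^sup>+x. ennreal (exp (- of_bool (0 \<le> dot d x v))) \<partial>gauss d s) \<le> ennreal ((1 + exp (- 1)) / 2)"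
proof -
  let ?G = "gauss d s"
  interpret prob_space ?G using s by (rule prob_space_gauss)
  let ?A = "{x \<in> space ?G. 0 \<le> dot d x v}"
  have A: "?A \<in> events"
    by (intro borel_measurable_le borel_measurable_dot_gauss borel_measurable_const)
  let ?f = "\<lambda>x. 1 - (1 - exp (- 1)) * indicat_real ?A x"
  have int: "integrable ?G ?f" using A by (intro Bochner_Integration.integrable_diff) (auto simp: emeasure_eq_measure)
  have "(\<integral>\<^sup>+x. ennreal (exp (- of_bool (0 \<le> dot d x v))) \<partial>?G) = (\<integral>\<^sup>+x. ennreal (?f x) \<partial>?G)"
    by (rule nn_integral_cong) (simp add: indicator_def)
  also have "\<dots> = ennreal (\<integral>x. ?f x \<partial>?G)"
    by (rule nn_integral_eq_integral[OF int]) (auto simp: indicator_def)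
  also have "(\<integral>x. ?f x \<partial>?G) = 1 - (1 - exp (- 1)) * prob ?A"
    using A by (subst Bochner_Integration.integral_diff) (auto simp: emeasure_eq_measure prob_space)
  also have "\<dots> \<le> 1 - (1 - exp (- 1)) * (1 / 2)"
    using gauss_halfspace[OF s, of d v] by (intro diff_left_mono mult_left_mono) auto
  finally show ?thesis by (simp add: field_simps ennreal_leI)
qed

text \<open>Chernoff's bound for a count of mean at least m / 2. The factor per neuron is at most 7
  / 10 \<le> exp (- 3 / 10), and the rate is 3 / 10 - 1 / 4 = 1 / 20.\<close>

lemma activation_count_prob:
  fixes d m :: nat
  assumes s: "0 < s" and j: "j = 1 \<or> j = -1"
  defines "M \<equiv> PiM (neurons m) (\<lambda>_. gauss d s)"
  shows "measure M {W \<in> space M. \<not> real m / 4 \<le> (\<Sum>r<m. of_bool (0 \<le> dot d (W (j, r)) v))} \<le> exp (- real m / 20)"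
proof -
  let ?G = "gauss d s"
  interpret G: prob_space ?G using s by (rule prob_space_gauss)
  interpret M: prob_space M unfolding M_def by (intro prob_space_PiM G.prob_space_axioms)
  interpret product_sigma_finite "\<lambda>_::real \<times> nat. ?G" ..
  let ?c = "(1 + exp (- 1 :: real)) / 2"
  \<comment> \<open>Neurons of the other sign get the factor 1, so that the product runs over the
    full index set of the measure.\<close>
  let ?g = "\<lambda>w x. if fst w = j then ennreal (exp (- of_bool (0 \<le> dot d x v))) else 1"
  have of_bool_meas: "(\<lambda>x. of_bool (0 \<le> dot d x v) :: real) \<in> borel_measurable ?G"
    by (intro borel_measurable_of_bool_nonneg borel_measurable_dot_gauss)
  have f_meas: "(\<lambda>W. - (\<Sum>r<m. of_bool (0 \<le> dot d (W (j, r)) v)) :: real) \<in> borel_measurable M"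
    unfolding M_def using j
    by (intro borel_measurable_uminus borel_measurable_sum measurable_compose[OF _ of_bool_meas] measurable_component_singleton)
       (auto simp: neurons_iff)
  have prod: "(\<Prod>w\<in>neurons m. h (fst w) (snd w)) = (\<Prod>r<m. h (-1) r) * (\<Prod>r<m. h 1 r)" for h :: "real \<Rightarrow> nat \<Rightarrow> ennreal"
    unfolding neurons_def using prod.cartesian_product[of h "{..<m}" "{-1, 1}"] by (simp add: split_def)
  have "(\<integral>\<^sup>+W. ennreal (exp (- (\<Sum>r<m. of_bool (0 \<le> dot d (W (j, r)) v)))) \<partial>M)
      = (\<integral>\<^sup>+W. (\<Prod>w\<in>neurons m. ?g w (W w)) \<partial>M)"
  proof (rule nn_integral_cong)
    fix W :: weights
    have "(\<Prod>w\<in>neurons m. ?g w (W w)) = (\<Prod>w\<in>neurons m. ?g (fst w, snd w) (W (fst w, snd w)))" by (simp only: prod.collapse)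
    also have "\<dots> = (\<Prod>r<m. ?g (-1, r) (W (-1, r))) * (\<Prod>r<m. ?g (1, r) (W (1, r)))"
      by (rule prod[of "\<lambda>k r. ?g (k, r) (W (k, r))"])
    also have "\<dots> = (\<Prod>r<m. ennreal (exp (- of_bool (0 \<le> dot d (W (j, r)) v))))"
      using j by auto
    also have "\<dots> = ennreal (exp (- (\<Sum>r<m. of_bool (0 \<le> dot d (W (j, r)) v))))"
      by (simp add: prod_ennreal exp_sum[symmetric] sum_negf)
    finally show "ennreal (exp (- (\<Sum>r<m. of_bool (0 \<le> dot d (W (j, r)) v)))) = (\<Prod>w\<in>neurons m. ?g w (W w))" ..
  qed
  also have "\<dots> = (\<Prod>w\<in>neurons m. \<integral>\<^sup>+x. ?g w x \<partial>?G)"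
    unfolding M_def
  proof (rule product_nn_integral_prod[OF finite_neurons])
    show "?g w \<in> borel_measurable ?G" for w
      using of_bool_meas by (cases "fst w = j") simp_all
  qed
  also have "\<dots> \<le> (\<Prod>w\<in>neurons m. if fst w = j then ennreal ?c else 1)"
    using gauss_activation_mgf[OF s, of d v] G.emeasure_space_1 by (intro prod_mono_ennreal) auto
  also have "\<dots> = ennreal (?c ^ m)"
    using j prod[of "\<lambda>k r. if k = j then ennreal ?c else 1"] by (auto simp: ennreal_power)
  finally have mgf: "(\<integral>\<^sup>+W. ennreal (exp (- (\<Sum>r<m. of_bool (0 \<le> dot d (W (j, r)) v)))) \<partial>M) \<le> ennreal (?c ^ m)" .
  have c: "?c \<le> exp (- 3 / 10)"
  proof -
    have "exp (3 / 10 :: real) \<le> 1 + 3 / 10 + (3 / 10)\<^sup>2" by (rule exp_bound) auto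
    then have "exp (3 / 10 :: real) \<le> 139 / 100" by (simp add: power2_eq_square)
    then have "1 / (139 / 100) \<le> 1 / exp (3 / 10 :: real)" by (intro divide_left_mono) auto
    then have e1: "100 / 139 \<le> exp (- 3 / 10 :: real)" by (simp add: exp_minus inverse_eq_divide)
    have "5 / 2 \<le> exp (1::real)" using exp_lower_Taylor_quadratic[of 1] by simp
    then have "1 / exp (1::real) \<le> 1 / (5 / 2)" by (intro divide_left_mono) auto
    then have "exp (- 1 :: real) \<le> 2 / 5" by (simp add: exp_minus inverse_eq_divide)
    then show ?thesis using e1 by simp
  qed
  have "M.prob {W \<in> space M. \<not> real m / 4 \<le> (\<Sum>r<m. of_bool (0 \<le> dot d (W (j, r)) v))}
      \<le> M.prob {W \<in> space M. - (real m / 4) \<le> - (\<Sum>r<m. of_bool (0 \<le> dot d (W (j, r)) v))}"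
    by (intro M.finite_measure_mono borel_measurable_le f_meas borel_measurable_const) auto
  also have "\<dots> \<le> ?c ^ m * exp (- (- (real m / 4)))"
    by (rule M.chernoff[OF f_meas mgf]) (simp add: add_nonneg_nonneg)
  also have "\<dots> \<le> exp (- 3 / 10) ^ m * exp (real m / 4)"
    using c by (intro mult_mono power_mono) (auto intro: add_nonneg_nonneg)
  also have "\<dots> = exp (- real m / 20)" by (simp add: exp_of_nat_mult[symmetric] exp_add[symmetric])
  finally show ?thesis .
qed

text \<open>The norm clause limits the share of the initialization in the response to fresh test
  noise. Activity is counted by a sum of indicators, which is directly a measurable function of the
  weights.\<close>

definition good_init :: "nat \<Rightarrow> nat \<Rightarrow> nat \<Rightarrow> vec \<Rightarrow> real \<Rightarrow> real \<Rightarrow> real \<Rightarrow> (nat \<Rightarrow> vec) \<Rightarrow> weights \<Rightarrow> bool" where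
  "good_init d n m \<mu> \<sigma>\<^sub>0 u v \<xi> W \<longleftrightarrow>
    (\<forall>p\<in>neurons m \<times> {..<n}. \<bar>dot d (W (fst p)) (\<xi> (snd p))\<bar> \<le> u) \<and>
    (\<forall>w\<in>neurons m. \<bar>dot d (W w) \<mu>\<bar> \<le> v) \<and>
    (\<forall>w\<in>neurons m. dot d (W w) (W w) \<le> 2 * (\<sigma>\<^sub>0\<^sup>2 * real d)) \<and>
    (\<forall>p\<in>{-1, 1} \<times> {..<n}. real m / 4 \<le> (\<Sum>r<m. of_bool (0 \<le> dot d (W (fst p, r)) (\<xi> (snd p)))))"

lemma sets_not_good_init:
  assumes W\<xi>: "\<And>w i. w \<in> neurons m \<Longrightarrow> i < n \<Longrightarrow> (\<lambda>x. dot d (W x w) (\<xi> x i)) \<in> borel_measurable M"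
    and W\<mu>: "\<And>w. w \<in> neurons m \<Longrightarrow> (\<lambda>x. dot d (W x w) \<mu>) \<in> borel_measurable M"
    and WW: "\<And>w. w \<in> neurons m \<Longrightarrow> (\<lambda>x. dot d (W x w) (W x w)) \<in> borel_measurable M"
  shows "p \<in> neurons m \<times> {..<n} \<Longrightarrow> {x \<in> space M. \<not> \<bar>dot d (W x (fst p)) (\<xi> x (snd p))\<bar> \<le> u} \<in> sets M"
    and "w \<in> neurons m \<Longrightarrow> {x \<in> space M. \<not> \<bar>dot d (W x w) \<mu>\<bar> \<le> v} \<in> sets M"
    and "w \<in> neurons m \<Longrightarrow> {x \<in> space M. \<not> dot d (W x w) (W x w) \<le> 2 * (\<sigma>\<^sub>0\<^sup>2 * real d)} \<in> sets M"
    and "p' \<in> {-1, 1} \<times> {..<n} \<Longrightarrow>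
      {x \<in> space M. \<not> real m / 4 \<le> (\<Sum>r<m. of_bool (0 \<le> dot d (W x (fst p', r)) (\<xi> x (snd p'))))} \<in> sets M"
    and "{x \<in> space M. \<not> good_init d n m \<mu> \<sigma>\<^sub>0 u v (\<xi> x) (W x)} \<in> sets M"
proof -
  show 1: "{x \<in> space M. \<not> \<bar>dot d (W x (fst p)) (\<xi> x (snd p))\<bar> \<le> u} \<in> sets M" if "p \<in> neurons m \<times> {..<n}" for p
    unfolding not_le using that
    by (intro borel_measurable_less borel_measurable_const borel_measurable_abs W\<xi>) auto
  show 2: "{x \<in> space M. \<not> \<bar>dot d (W x w) \<mu>\<bar> \<le> v} \<in> sets M" if "w \<in> neurons m" for w
    unfolding not_le using that by (intro borel_measurable_less borel_measurable_const borel_measurable_abs W\<mu>)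
  show 3: "{x \<in> space M. \<not> dot d (W x w) (W x w) \<le> 2 * (\<sigma>\<^sub>0\<^sup>2 * real d)} \<in> sets M" if "w \<in> neurons m" for w
    unfolding not_le using that by (intro borel_measurable_less borel_measurable_const WW)
  show 4: "{x \<in> space M. \<not> real m / 4 \<le> (\<Sum>r<m. of_bool (0 \<le> dot d (W x (fst p', r)) (\<xi> x (snd p'))))} \<in> sets M"
    if "p' \<in> {-1, 1} \<times> {..<n}" for p'
    unfolding not_le using that
    by (intro borel_measurable_less borel_measurable_const borel_measurable_sum borel_measurable_of_bool_nonneg W\<xi>)
       (auto simp: neurons_iff)
  show "{x \<in> space M. \<not> good_init d n m \<mu> \<sigma>\<^sub>0 u v (\<xi> x) (W x)} \<in> sets M"
    unfolding good_init_def
    by (intro sets_not_conj sets_not_all 1 2 3 4) (simp_all add: finite_neurons)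
qed

lemma good_init_prob:
  fixes \<delta> :: real
  assumes \<sigma>\<^sub>0: "0 < \<sigma>\<^sub>0" and pos: "0 < d" "0 < n" "0 < m" "0 < dot d \<mu> \<mu>" and \<delta>: "0 < \<delta>"
    and \<xi>: "\<And>i. i < n \<Longrightarrow> dot d (\<xi> i) (\<xi> i) \<le> 2 * q" and q: "0 < q"
    and uv: "0 \<le> u" "0 \<le> v"
    and u: "exp (- u\<^sup>2 / (4 * \<sigma>\<^sub>0\<^sup>2 * q)) \<le> \<delta> / (real n * real m)"
    and v: "exp (- v\<^sup>2 / (2 * \<sigma>\<^sub>0\<^sup>2 * dot d \<mu> \<mu>)) \<le> \<delta> / real m"
    and d: "exp (- real d / 16) \<le> \<delta> / real m"
    and m: "exp (- real m / 20) \<le> \<delta> / real n"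
  defines "P \<equiv> PiM (neurons m) (\<lambda>_. gauss d \<sigma>\<^sub>0)"
  shows "measure P {W \<in> space P. \<not> good_init d n m \<mu> \<sigma>\<^sub>0 u v \<xi> W} \<le> 12 * \<delta>"
proof -
  let ?G = "gauss d \<sigma>\<^sub>0"
  interpret G: prob_space ?G using \<sigma>\<^sub>0 by (rule prob_space_gauss)
  interpret P: prob_space P unfolding P_def by (intro prob_space_PiM G.prob_space_axioms)
  have meas1: "(\<lambda>W. dot d (W w) v) \<in> borel_measurable P" if "w \<in> neurons m" for w v
    unfolding P_def using that by (rule borel_measurable_dot_PiM)
  have meas2: "(\<lambda>W. dot d (W w) (W w)) \<in> borel_measurable P" if "w \<in> neurons m" for w
    unfolding P_def using that by (intro measurable_dot_PiM)
  note S = sets_not_good_init[where M = P and W = "\<lambda>W. W" and \<xi> = "\<lambda>_. \<xi>" and m = m and n = n, OF meas1 meas1 meas2]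
  have single: "P.prob {W \<in> space P. \<not> \<bar>dot d (W w) z\<bar> \<le> t} \<le> 2 * exp (- t\<^sup>2 / (2 * \<sigma>\<^sub>0\<^sup>2 * B))"
    if w: "w \<in> neurons m" and z: "0 \<le> t" "dot d z z \<le> B" "0 < B" for w z t B
  proof -
    have "P.prob {W \<in> space P. \<not> \<bar>dot d (W w) z\<bar> \<le> t} = G.prob {x \<in> space ?G. \<not> \<bar>dot d x z\<bar> \<le> t}"
      unfolding P_def using w G.prob_space_axioms
      by (intro measure_PiM_component[where Q = "\<lambda>x. \<not> \<bar>dot d x z\<bar> \<le> t"])
         (auto simp only: not_le intro!: borel_measurable_less borel_measurable_const borel_measurable_abs borel_measurable_dot_gauss)
    also have "\<dots> \<le> G.prob {x \<in> space ?G. t \<le> \<bar>dot d x z\<bar>}"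
      by (intro G.finite_measure_mono borel_measurable_le borel_measurable_const borel_measurable_abs borel_measurable_dot_gauss) auto
    also have "\<dots> \<le> 2 * exp (- t\<^sup>2 / (2 * \<sigma>\<^sub>0\<^sup>2 * B))" by (rule gauss_tail_abs[OF \<sigma>\<^sub>0 z])
    finally show ?thesis .
  qed
  have p1: "P.prob {W \<in> space P. \<not> \<bar>dot d (W (fst p)) (\<xi> (snd p))\<bar> \<le> u} \<le> 2 * (\<delta> / (real n * real m))"
    if p: "p \<in> neurons m \<times> {..<n}" for p
  proof -
    have "P.prob {W \<in> space P. \<not> \<bar>dot d (W (fst p)) (\<xi> (snd p))\<bar> \<le> u} \<le> 2 * exp (- u\<^sup>2 / (2 * \<sigma>\<^sub>0\<^sup>2 * (2 * q)))"
      using p \<xi> uv q by (intro single) auto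
    also have "2 * \<sigma>\<^sub>0\<^sup>2 * (2 * q) = 4 * \<sigma>\<^sub>0\<^sup>2 * q" by simp
    finally show ?thesis using u by linarith
  qed
  have p2: "P.prob {W \<in> space P. \<not> \<bar>dot d (W w) \<mu>\<bar> \<le> v} \<le> 2 * (\<delta> / real m)" if w: "w \<in> neurons m" for w
    using single[OF w uv(2) order_refl pos(4)] v by linarith
  have p3: "P.prob {W \<in> space P. \<not> dot d (W w) (W w) \<le> 2 * (\<sigma>\<^sub>0\<^sup>2 * real d)} \<le> \<delta> / real m" if w: "w \<in> neurons m" for w
  proof -
    have "P.prob {W \<in> space P. \<not> dot d (W w) (W w) \<le> 2 * (\<sigma>\<^sub>0\<^sup>2 * real d)}
        = G.prob {x \<in> space ?G. \<not> dot d x x \<le> 2 * (\<sigma>\<^sub>0\<^sup>2 * real d)}"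
      unfolding P_def using w G.prob_space_axioms
      by (intro measure_PiM_component[where Q = "\<lambda>x. \<not> dot d x x \<le> 2 * (\<sigma>\<^sub>0\<^sup>2 * real d)"]) auto
    also have "\<dots> \<le> G.prob {x \<in> space ?G. 2 * (\<sigma>\<^sub>0\<^sup>2 * real d) \<le> dot d x x}"
      by (rule G.finite_measure_mono) auto
    finally show ?thesis using gauss_norm_upper[OF \<sigma>\<^sub>0, of d] d by linarith
  qed
  have p4: "P.prob {W \<in> space P. \<not> real m / 4 \<le> (\<Sum>r<m. of_bool (0 \<le> dot d (W (fst p, r)) (\<xi> (snd p))))} \<le> \<delta> / real n"
    if p: "p \<in> {-1, 1} \<times> {..<n}" for p
    using activation_count_prob[OF \<sigma>\<^sub>0, of "fst p" m d "\<xi> (snd p)"] p m unfolding P_def by fastforce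
  \<comment> \<open>With 2 m neurons and two signs, the four clauses have the shares 4, 4, 2 and 2
    times \<delta>.\<close>
  have "P.prob {W \<in> space P. \<not> good_init d n m \<mu> \<sigma>\<^sub>0 u v \<xi> W}
      \<le> real (card (neurons m \<times> {..<n})) * (2 * (\<delta> / (real n * real m))) +
        (real (card (neurons m)) * (2 * (\<delta> / real m)) + (real (card (neurons m)) * (\<delta> / real m)
          + real (card ({-1, 1 :: real} \<times> {..<n})) * (\<delta> / real n)))"
    unfolding good_init_def
    by (intro P.prob_not_conj_le P.prob_not_all_le p1 p2 p3 p4 S(1-4) sets_not_conj sets_not_all)
       (simp_all add: finite_neurons)
  also have "\<dots> = 12 * \<delta>"
    using pos by (simp add: card_cartesian_product card_neurons field_simps)
  finally show ?thesis .
qed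

text \<open>The bounds on the initialization hold for each fixed \<xi> with bounded norms. By
  independence, bad noise costs 6 * \<delta>, and integrating the failure of the initialization over
  good noise adds 12 * \<delta>.\<close>

lemma good_event_prob:
  fixes \<delta> :: real
  assumes \<sigma>: "0 < \<sigma>" "0 < \<sigma>\<^sub>0" and pos: "0 < d" "0 < n" "0 < m" "0 < dot d \<mu> \<mu>" and \<delta>: "0 < \<delta>" "\<delta> < 1"
    and \<epsilon>: "0 \<le> \<epsilon>\<^sub>1" "0 \<le> \<epsilon>\<^sub>2" and uv: "0 \<le> u" "0 \<le> v"
    and bounds: "exp (- real d / 20) \<le> \<delta> / real n"
      "exp (- \<epsilon>\<^sub>1\<^sup>2 * real d / 4) \<le> (\<delta> / real n)\<^sup>2"
      "exp (- \<epsilon>\<^sub>2\<^sup>2 * dot d \<mu> \<mu> / (2 * \<sigma>\<^sup>2)) \<le> \<delta> / real n"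
      "exp (- u\<^sup>2 / (4 * \<sigma>\<^sub>0\<^sup>2 * (\<sigma>\<^sup>2 * real d))) \<le> \<delta> / (real n * real m)"
      "exp (- v\<^sup>2 / (2 * \<sigma>\<^sub>0\<^sup>2 * dot d \<mu> \<mu>)) \<le> \<delta> / real m"
      "exp (- real d / 16) \<le> \<delta> / real m"
      "exp (- real m / 20) \<le> \<delta> / real n"
  defines "E \<equiv> PiM {..<n} (\<lambda>_. gauss d \<sigma>) \<Otimes>\<^sub>M PiM (neurons m) (\<lambda>_. gauss d \<sigma>\<^sub>0)"
  defines "Good \<equiv> \<lambda>x. good_noise d n \<mu> \<sigma> \<epsilon>\<^sub>1 \<epsilon>\<^sub>2 (fst x) \<and> good_init d n m \<mu> \<sigma>\<^sub>0 u v (fst x) (snd x)"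
  shows "{x \<in> space E. Good x} \<in> sets E"
    and "1 - 18 * \<delta> \<le> measure E {x \<in> space E. Good x}"
proof -
  define N where "N = PiM {..<n} (\<lambda>_. gauss d \<sigma>)"
  define P where "P = PiM (neurons m) (\<lambda>_. gauss d \<sigma>\<^sub>0)"
  have E: "E = N \<Otimes>\<^sub>M P" by (simp add: E_def N_def P_def)
  interpret N: prob_space N unfolding N_def by (intro prob_space_PiM prob_space_gauss \<sigma>)
  interpret P: prob_space P unfolding P_def by (intro prob_space_PiM prob_space_gauss \<sigma>)
  interpret NP: pair_prob_space N P ..
  note noise = good_noise_prob[OF \<sigma>(1) pos(1,2,4) \<delta> \<epsilon> bounds(1-3), folded N_def]
  have W\<xi>: "(\<lambda>x. dot d (snd x w) (fst x i)) \<in> borel_measurable E" if "w \<in> neurons m" "i < n" for w i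
    unfolding E N_def P_def using that
    by (intro measurable_dot measurable_compose[OF measurable_snd measurable_PiM_gauss_component]
        measurable_compose[OF measurable_fst measurable_PiM_gauss_component]) auto
  have W\<mu>: "(\<lambda>x. dot d (snd x w) v) \<in> borel_measurable E" if "w \<in> neurons m" for w v
    unfolding E N_def P_def using that
    by (intro measurable_compose[OF measurable_snd borel_measurable_dot_PiM]) auto
  have WW: "(\<lambda>x. dot d (snd x w) (snd x w)) \<in> borel_measurable E" if "w \<in> neurons m" for w
    unfolding E N_def P_def using that
    by (intro measurable_compose[OF measurable_snd measurable_dot_PiM]) auto
  have init: "{x \<in> space E. \<not> good_init d n m \<mu> \<sigma>\<^sub>0 u v (fst x) (snd x)} \<in> sets E"
    by (rule sets_not_good_init(5)[OF W\<xi> W\<mu> WW])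
  have "{x \<in> space E. \<not> good_noise d n \<mu> \<sigma> \<epsilon>\<^sub>1 \<epsilon>\<^sub>2 (fst x)}
      = {\<xi> \<in> space N. \<not> good_noise d n \<mu> \<sigma> \<epsilon>\<^sub>1 \<epsilon>\<^sub>2 \<xi>} \<times> space P"
    by (auto simp: E space_pair_measure)
  moreover have "emeasure (N \<Otimes>\<^sub>M P) (A \<times> space P) = emeasure N A" if "A \<in> sets N" for A
    using that by (simp add: P.emeasure_pair_measure_Times P.emeasure_space_1)
  ultimately have noise_sets: "{x \<in> space E. \<not> good_noise d n \<mu> \<sigma> \<epsilon>\<^sub>1 \<epsilon>\<^sub>2 (fst x)} \<in> sets E"
    and noise_prob: "measure E {x \<in> space E. \<not> good_noise d n \<mu> \<sigma> \<epsilon>\<^sub>1 \<epsilon>\<^sub>2 (fst x)} \<le> 6 * \<delta>"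
    using noise by (auto simp: E measure_def)
  let ?B = "{x \<in> space E. \<not> good_noise d n \<mu> \<sigma> \<epsilon>\<^sub>1 \<epsilon>\<^sub>2 (fst x)}"
  let ?C = "{x \<in> space E. good_noise d n \<mu> \<sigma> \<epsilon>\<^sub>1 \<epsilon>\<^sub>2 (fst x) \<and> \<not> good_init d n m \<mu> \<sigma>\<^sub>0 u v (fst x) (snd x)}"
  have C_eq: "?C = {x \<in> space E. \<not> good_init d n m \<mu> \<sigma>\<^sub>0 u v (fst x) (snd x)} - ?B" by auto
  have C_sets: "?C \<in> sets E" unfolding C_eq using init noise_sets by (rule sets.Diff)
  have "emeasure E ?C = (\<integral>\<^sup>+\<xi>. emeasure P (Pair \<xi> -` ?C) \<partial>N)"
    using C_sets unfolding E by (rule P.emeasure_pair_measure_alt)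
  also have "\<dots> \<le> (\<integral>\<^sup>+\<xi>. ennreal (12 * \<delta>) \<partial>N)"
  proof (rule nn_integral_mono)
    fix \<xi> assume \<xi>: "\<xi> \<in> space N"
    show "emeasure P (Pair \<xi> -` ?C) \<le> ennreal (12 * \<delta>)"
    proof (cases "good_noise d n \<mu> \<sigma> \<epsilon>\<^sub>1 \<epsilon>\<^sub>2 \<xi>")
      case False
      then have "Pair \<xi> -` ?C = {}" by auto
      then show ?thesis by (simp only: emeasure_empty zero_le)
    next
      case True
      then have "Pair \<xi> -` ?C = {W \<in> space P. \<not> good_init d n m \<mu> \<sigma>\<^sub>0 u v \<xi> W}"
        using \<xi> by (auto simp: E space_pair_measure)
      moreover have "P.prob {W \<in> space P. \<not> good_init d n m \<mu> \<sigma>\<^sub>0 u v \<xi> W} \<le> 12 * \<delta>"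
        unfolding P_def
        by (rule good_init_prob[OF \<sigma>(2) pos \<delta>(1) _ _ uv bounds(4-7)])
           (use True \<sigma> pos in \<open>auto simp: good_noise_def\<close>)
      ultimately show ?thesis by (simp add: P.emeasure_eq_measure ennreal_leI)
    qed
  qed
  also have "\<dots> = ennreal (12 * \<delta>)" by (simp add: N.emeasure_space_1)
  finally have C: "measure E ?C \<le> 12 * \<delta>"
    using \<delta> by (simp add: E NP.P.emeasure_eq_measure)
  have eq: "{x \<in> space E. Good x} = space E - (?B \<union> ?C)" by (auto simp: Good_def)
  show "{x \<in> space E. Good x} \<in> sets E" unfolding eq using noise_sets C_sets by auto
  have "measure E (?B \<union> ?C) \<le> 6 * \<delta> + 12 * \<delta>"
    using measure_Un_le[OF noise_sets C_sets] noise_prob C by linarith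
  moreover have "measure E {x \<in> space E. Good x} = 1 - measure E (?B \<union> ?C)"
    unfolding eq using noise_sets C_sets unfolding E by (intro NP.P.prob_compl) auto
  ultimately show "1 - 18 * \<delta> \<le> measure E {x \<in> space E. Good x}" by simp
qed

section \<open>Measurability and the test error\<close>

lemma borel_measurable_relu [measurable]: "relu \<in> borel_measurable borel"
  unfolding relu_def[abs_def] by measurable

lemma borel_measurable_relu' [measurable]: "relu' \<in> borel_measurable borel"
  unfolding relu'_def[abs_def] by measurable

lemma measurable_network:
  assumes W: "\<And>j r k. j = 1 \<or> j = -1 \<Longrightarrow> r < m \<Longrightarrow> k < d \<Longrightarrow> (\<lambda>x. W x (j, r) k) \<in> borel_measurable M"
    and u: "\<And>k. k < d \<Longrightarrow> (\<lambda>x. u x k) \<in> borel_measurable M"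
    and v: "\<And>k. k < d \<Longrightarrow> (\<lambda>x. v x k) \<in> borel_measurable M"
  shows "(\<lambda>x. network d m (W x) (u x, v x)) \<in> borel_measurable M"
  unfolding network_def F_def fst_conv snd_conv
  by (intro borel_measurable_diff borel_measurable_times borel_measurable_const borel_measurable_sum
      borel_measurable_add measurable_compose[OF _ borel_measurable_relu] measurable_dot W u v) auto

text \<open>\<open>measure\<close> vanishes outside the sigma-algebra, so a lower bound on a
  probability requires a measurable event. The iterates are measurable since \<open>relu'\<close>,
  though discontinuous, is a Borel function.\<close>

lemma measurable_gd:
  assumes y: "\<And>i. i < n \<Longrightarrow> (\<lambda>x. y x i) \<in> borel_measurable M"
    and \<xi>: "\<And>i k. i < n \<Longrightarrow> k < d \<Longrightarrow> (\<lambda>x. \<xi> x i k) \<in> borel_measurable M"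
    and W0: "\<And>j r k. j = 1 \<or> j = -1 \<Longrightarrow> r < m \<Longrightarrow> k < d \<Longrightarrow> (\<lambda>x. W0 x (j, r) k) \<in> borel_measurable M"
    and jrk: "j = 1 \<or> j = -1" "r < m" "k < d"
  shows "(\<lambda>x. gd d n m \<mu> \<eta> (y x) (\<xi> x) (W0 x) t (j, r) k) \<in> borel_measurable M"
  using jrk
proof (induction t arbitrary: j r k)
  case 0
  then show ?case using W0 by simp
next
  case (Suc t)
  let ?W = "\<lambda>x. gd d n m \<mu> \<eta> (y x) (\<xi> x) (W0 x) t"
  have vs: "(\<lambda>x. vscale (y x i) \<mu> k) \<in> borel_measurable M" if "i < n" for i k
    unfolding vscale_def using y[OF that] by simp
  have net: "(\<lambda>x. network d m (?W x) (train_input \<mu> (y x) (\<xi> x) i)) \<in> borel_measurable M" if "i < n" for i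
    unfolding train_input_def by (rule measurable_network) (use Suc.IH vs \<xi> that in auto)
  have dl: "(\<lambda>x. deriv logistic (y x i * network d m (?W x) (train_input \<mu> (y x) (\<xi> x) i))) \<in> borel_measurable M"
    if "i < n" for i
    unfolding deriv_logistic
    by (intro borel_measurable_divide borel_measurable_const borel_measurable_add borel_measurable_times y net that
        measurable_compose[OF _ borel_measurable_exp])
  have d1: "(\<lambda>x. relu' (dot d (?W x (j, r)) (vscale (y x i) \<mu>))) \<in> borel_measurable M" if "i < n" for i
    by (intro measurable_compose[OF _ borel_measurable_relu'] measurable_dot Suc.IH vs that Suc.prems)
  have d2: "(\<lambda>x. relu' (dot d (?W x (j, r)) (\<xi> x i))) \<in> borel_measurable M" if "i < n" for i
    by (intro measurable_compose[OF _ borel_measurable_relu'] measurable_dot Suc.IH \<xi> that Suc.prems)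
  show ?case
    unfolding gd.simps train_grad_def prod.case
    by (intro borel_measurable_diff borel_measurable_times borel_measurable_const borel_measurable_sum
        borel_measurable_add Suc.IH Suc.prems dl y d1 d2 vs \<xi>) simp_all
qed

section \<open>The test error as an average of Gaussian probabilities\<close>

lemma label_pmf_eq: "set_pmf label_pmf = {-1, 1}" "pmf label_pmf 1 = 1 / 2" "pmf label_pmf (-1) = 1 / 2"
  by (simp_all add: label_pmf_def)

lemma measurable_from_pmf: "f \<in> borel_measurable (measure_pmf p)"
  by simp

lemma measurable_test_margin:
  "(\<lambda>x. fst x * network d m W (vscale (fst x) \<mu>, \<lambda>k. fst (snd x) k + snd (snd x) k))
     \<in> borel_measurable (test_measure d n \<sigma> \<xi>)"
proof -
  let ?M = "test_measure d n \<sigma> \<xi>"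
  have y: "(\<lambda>x. f (fst x)) \<in> borel_measurable ?M" for f
    unfolding test_measure_def by (rule measurable_compose[OF measurable_fst measurable_from_pmf])
  have v: "(\<lambda>x. fst (snd x) k) \<in> borel_measurable ?M" for k
    unfolding test_measure_def
    by (rule measurable_compose[OF measurable_snd], rule measurable_compose[OF measurable_fst measurable_from_pmf])
  have z: "(\<lambda>x. snd (snd x) k) \<in> borel_measurable ?M" if "k < d" for k
    unfolding test_measure_def
    by (rule measurable_compose[OF measurable_snd], rule measurable_compose[OF measurable_snd measurable_gauss_component[OF that]])
  show ?thesis
    by (intro borel_measurable_times y[of "\<lambda>x. x"] measurable_network borel_measurable_add v z)
       (simp_all add: vscale_def y[of "\<lambda>x. x * _"])
qed

text \<open>The test measure itself depends on the training noise. Averaging over the 2 n choices of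
  a label and a noise vector leaves probabilities under one fixed Gaussian measure, whose dependence
  on the training data is measurable.\<close>

lemma test_error_eq:
  assumes \<sigma>: "0 < \<sigma>" and n: "0 < n"
  shows "test_error d n m \<mu> \<sigma> \<xi> W = 1 / (2 * real n) * (\<Sum>y\<in>{-1, 1}. \<Sum>i<n.
    measure (gauss d \<sigma>) {z \<in> space (gauss d \<sigma>). y * network d m W (vscale y \<mu>, \<lambda>k. \<xi> i k + z k) < 0})"
proof -
  let ?G = "gauss d \<sigma>" and ?V = "measure_pmf (map_pmf \<xi> (pmf_of_set {..<n}))" and ?L = "measure_pmf label_pmf"
  interpret G: prob_space ?G using \<sigma> by (rule prob_space_gauss)
  interpret V: prob_space ?V by (rule prob_space_measure_pmf)
  interpret L: prob_space ?L by (rule prob_space_measure_pmf)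
  interpret VG: pair_prob_space ?V ?G ..
  interpret LVG: pair_prob_space ?L "?V \<Otimes>\<^sub>M ?G" ..
  let ?h = "\<lambda>y v z. y * network d m W (vscale y \<mu>, \<lambda>k. v k + z k)"
  let ?A = "{x \<in> space (test_measure d n \<sigma> \<xi>). ?h (fst x) (fst (snd x)) (snd (snd x)) < 0}"
  define B where "B y v = {z \<in> space ?G. ?h y v z < 0}" for y v
  have T: "test_measure d n \<sigma> \<xi> = ?L \<Otimes>\<^sub>M (?V \<Otimes>\<^sub>M ?G)" by (simp add: test_measure_def)
  have A: "?A \<in> sets (?L \<Otimes>\<^sub>M (?V \<Otimes>\<^sub>M ?G))"
    unfolding T[symmetric] by (intro borel_measurable_less measurable_test_margin borel_measurable_const)
  have PP: "Pair v -` (Pair y -` ?A) = B y v" for y v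
    by (auto simp: B_def T space_pair_measure)
  have "emeasure (?L \<Otimes>\<^sub>M (?V \<Otimes>\<^sub>M ?G)) ?A = (\<integral>\<^sup>+y. emeasure (?V \<Otimes>\<^sub>M ?G) (Pair y -` ?A) \<partial>?L)"
    by (rule VG.P.emeasure_pair_measure_alt[OF A])
  also have "\<dots> = (\<integral>\<^sup>+y. \<integral>\<^sup>+v. emeasure ?G (B y v) \<partial>?V \<partial>?L)"
    by (intro nn_integral_cong, subst G.emeasure_pair_measure_alt[OF sets_Pair1[OF A]]) (simp only: PP)
  also have "\<dots> = (\<integral>\<^sup>+y. ennreal (1 / real n * (\<Sum>i<n. G.prob (B y (\<xi> i)))) \<partial>?L)"
  proof (rule nn_integral_cong)
    fix y
    have "(\<integral>\<^sup>+v. emeasure ?G (B y v) \<partial>?V) = (\<Sum>i<n. emeasure ?G (B y (\<xi> i))) / of_nat n"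
      unfolding nn_integral_map_pmf using n by (subst nn_integral_pmf_of_set) (auto simp: lessThan_empty_iff)
    also have "\<dots> = ennreal (\<Sum>i<n. G.prob (B y (\<xi> i))) / ennreal (real n)"
      by (simp add: G.emeasure_eq_measure ennreal_of_nat_eq_real_of_nat)
    also have "\<dots> = ennreal (1 / real n * (\<Sum>i<n. G.prob (B y (\<xi> i))))"
      using n by (subst divide_ennreal) (auto intro: sum_nonneg)
    finally show "(\<integral>\<^sup>+v. emeasure ?G (B y v) \<partial>?V) = ennreal (1 / real n * (\<Sum>i<n. G.prob (B y (\<xi> i))))" .
  qed
  also have "\<dots> = (\<Sum>y\<in>{-1, 1}. ennreal (1 / real n * (\<Sum>i<n. G.prob (B y (\<xi> i))))) / ennreal 2"
    unfolding label_pmf_def by (subst nn_integral_pmf_of_set) simp_all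
  also have "\<dots> = ennreal ((\<Sum>y\<in>{-1, 1}. 1 / real n * (\<Sum>i<n. G.prob (B y (\<xi> i)))) / 2)"
    by (subst sum_ennreal, simp add: sum_nonneg, subst divide_ennreal) (auto intro!: sum_nonneg add_nonneg_nonneg divide_nonneg_nonneg)
  finally have "measure (?L \<Otimes>\<^sub>M (?V \<Otimes>\<^sub>M ?G)) ?A = (\<Sum>y\<in>{-1, 1}. 1 / real n * (\<Sum>i<n. G.prob (B y (\<xi> i)))) / 2"
    by (simp add: measure_def sum_nonneg)
  moreover have "test_error d n m \<mu> \<sigma> \<xi> W = measure (?L \<Otimes>\<^sub>M (?V \<Otimes>\<^sub>M ?G)) ?A"
    unfolding test_error_def T[symmetric] by (rule arg_cong[where f = "measure _"]) auto
  moreover have "(\<Sum>y\<in>{-1, 1 :: real}. 1 / real n * S y) / 2 = 1 / (2 * real n) * (\<Sum>y\<in>{-1, 1}. S y)" for S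
    using n by (simp add: field_simps)
  ultimately show ?thesis by (simp only: B_def)
qed

lemma test_error_le:
  assumes \<sigma>: "0 < \<sigma>" and n: "0 < n"
    and p: "\<And>y i. y = 1 \<or> y = -1 \<Longrightarrow> i < n \<Longrightarrow>
      measure (gauss d \<sigma>) {z \<in> space (gauss d \<sigma>). y * network d m W (vscale y \<mu>, \<lambda>k. \<xi> i k + z k) < 0} \<le> p"
  shows "test_error d n m \<mu> \<sigma> \<xi> W \<le> p"
proof -
  have "(\<Sum>y\<in>{-1, 1}. \<Sum>i<n.
    measure (gauss d \<sigma>) {z \<in> space (gauss d \<sigma>). y * network d m W (vscale y \<mu>, \<lambda>k. \<xi> i k + z k) < 0})
      \<le> (\<Sum>y\<in>{-1, 1 :: real}. \<Sum>i<n. p)"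
    using p by (intro sum_mono) auto
  also have "\<dots> = 2 * real n * p" by simp
  finally show ?thesis unfolding test_error_eq[OF \<sigma> n] using n by (simp add: field_simps)
qed

lemma test_error_le_1: "0 < \<sigma> \<Longrightarrow> 0 < n \<Longrightarrow> test_error d n m \<mu> \<sigma> \<xi> W \<le> 1"
  by (rule test_error_le) (auto intro: prob_space.prob_le_1[OF prob_space_gauss])

lemma measurable_test_error:
  assumes \<sigma>: "0 < \<sigma>" and n: "0 < n"
    and \<xi>: "\<And>i k. i < n \<Longrightarrow> k < d \<Longrightarrow> (\<lambda>x. \<xi> x i k) \<in> borel_measurable M"
    and W: "\<And>j r k. j = 1 \<or> j = -1 \<Longrightarrow> r < m \<Longrightarrow> k < d \<Longrightarrow> (\<lambda>x. W x (j, r) k) \<in> borel_measurable M"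
  shows "(\<lambda>x. test_error d n m \<mu> \<sigma> (\<xi> x) (W x)) \<in> borel_measurable M"
  unfolding test_error_eq[OF \<sigma> n]
proof (intro borel_measurable_times borel_measurable_const borel_measurable_sum)
  let ?G = "gauss d \<sigma>"
  interpret G: prob_space ?G using \<sigma> by (rule prob_space_gauss)
  fix y :: real and i assume "i \<in> {..<n}"
  then have i: "i < n" by simp
  let ?h = "\<lambda>x z. y * network d m (W x) (vscale y \<mu>, \<lambda>k. \<xi> x i k + z k)"
  let ?Q = "{p \<in> space (M \<Otimes>\<^sub>M ?G). ?h (fst p) (snd p) < 0}"
  have "(\<lambda>p. ?h (fst p) (snd p)) \<in> borel_measurable (M \<Otimes>\<^sub>M ?G)"
    by (intro borel_measurable_times borel_measurable_const measurable_network borel_measurable_add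
        measurable_compose[OF measurable_fst W] measurable_compose[OF measurable_fst \<xi>[OF i]]
        measurable_compose[OF measurable_snd measurable_gauss_component])
  then have Q: "?Q \<in> sets (M \<Otimes>\<^sub>M ?G)" by (intro borel_measurable_less borel_measurable_const)
  have "(\<lambda>x. enn2real (emeasure ?G (Pair x -` ?Q))) \<in> borel_measurable M"
    using G.measurable_emeasure_Pair[OF Q] by measurable
  moreover have "enn2real (emeasure ?G (Pair x -` ?Q)) = G.prob {z \<in> space ?G. ?h x z < 0}" if "x \<in> space M" for x
  proof -
    have "Pair x -` ?Q = {z \<in> space ?G. ?h x z < 0}" using that by (auto simp: space_pair_measure)
    then show ?thesis by (simp only: measure_def)
  qed
  ultimately show "(\<lambda>x. G.prob {z \<in> space ?G. ?h x z < 0}) \<in> borel_measurable M"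
    by (subst measurable_cong[symmetric]) auto
qed

section \<open>The parameter regime\<close>

text \<open>The tolerance \<nu> of \<open>good_run\<close>, with max 1 b in the place of b.\<close>

definition noise_tol :: "real \<Rightarrow> real" where
  "noise_tol b = 1 / (256 * (1 + exp (max 1 b + 3)))"

text \<open>8192 = 8 * 32^2, so that C * (\<nu> / 32)^2 = 8 * max 1 b, which covers the squared
  estimates of the cross terms in \<open>cross_small\<close>.\<close>

definition regime_const :: "real \<Rightarrow> real" where
  "regime_const b = 8192 * max 1 b / (noise_tol b)\<^sup>2"

lemma noise_tol: "0 < noise_tol b" "noise_tol b \<le> 1 / 256"
  by (simp_all add: noise_tol_def add_pos_pos)

lemma vnorm_sq: "(vnorm d u)\<^sup>2 = dot d u u"
  by (simp add: vnorm_def dot_def sum_nonneg)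

locale regime =
  fixes d n m :: nat and \<mu> :: vec and \<sigma> \<sigma>\<^sub>0 \<eta> \<epsilon> \<delta> :: real and T :: nat and a b \<epsilon>max :: real
  assumes pos: "0 < d" "0 < n" "0 < m" "0 < \<sigma>" "0 < \<sigma>\<^sub>0" "0 < \<eta>" "0 < \<epsilon>" "0 < \<delta>"
    and \<mu>_nz: "\<exists>k<d. \<mu> k \<noteq> 0" and \<epsilon>_le: "\<epsilon> \<le> \<epsilon>max" and \<delta>_less: "\<delta> < 1"
    and T_ge: "(200 + 3 * \<epsilon>max) * log_factor d n m \<epsilon> \<delta> * (time_scale d n m \<sigma> \<eta> / \<epsilon>) \<le> real T"
    and C0: "condition_C0 a b (regime_const b) d n m \<mu> \<sigma> \<sigma>\<^sub>0 \<eta> \<delta> T"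
begin

definition "C = regime_const b"
definition "B = max 1 b"
definition "\<nu> = noise_tol b"
definition "\<mu>2 = dot d \<mu> \<mu>"
definition "q = \<sigma>\<^sup>2 * real d"
definition "h = \<eta> * q / (real n * real m)"
definition "s = real n * \<mu>2 / q"
definition "L1 = ln (real n / \<delta>)"
definition "L2 = ln (real m / \<delta>)"
definition "L3 = ln (real n * real m / \<delta>)"
text \<open>This and the next three thresholds are chosen so that the Gaussian tail exponents become
  2 * L1, L1, L3 and L2: for products of two noise vectors, of noise with \<mu>, and of initial
  weights with noise and with \<mu>.\<close>

definition "\<epsilon>\<^sub>1 = sqrt (8 * L1 / real d)"
definition "\<epsilon>\<^sub>2 = sqrt (2 * \<sigma>\<^sup>2 * L1 / \<mu>2)"
definition "u = 2 * \<sigma>\<^sub>0 * \<sigma> * sqrt (real d * L3)"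
definition "v = \<sigma>\<^sub>0 * vnorm d \<mu> * sqrt (2 * L2)"

lemma B_ge: "1 \<le> B" by (simp add: B_def)

lemma \<nu>: "0 < \<nu>" "\<nu> \<le> 1 / 256" using noise_tol by (simp_all add: \<nu>_def)

lemma C_eq: "C * \<nu>\<^sup>2 = 8192 * B"
  using \<nu> by (simp add: C_def regime_const_def \<nu>_def[symmetric] B_def)

lemma C_\<nu>: "C * (\<nu> / 32)\<^sup>2 = 8 * B"
  using C_eq by (simp add: power_divide)

lemma C_ge: "64 * B \<le> C" "4 / \<nu> \<le> C" "64 \<le> C"
proof -
  have "\<nu>\<^sup>2 \<le> 1" using \<nu> by (intro power_le_one) auto
  then have "8192 * B / 1 \<le> 8192 * B / \<nu>\<^sup>2" using \<nu> B_ge by (intro divide_left_mono) auto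
  moreover have C: "C = 8192 * B / \<nu>\<^sup>2" using C_eq \<nu> by (simp add: field_simps)
  ultimately show "64 * B \<le> C" "64 \<le> C" using B_ge by auto
  have "4 * \<nu> \<le> 8192 * B" using \<nu> B_ge by linarith
  then have "4 * \<nu> / \<nu>\<^sup>2 \<le> 8192 * B / \<nu>\<^sup>2" by (rule divide_right_mono) simp
  then show "4 / \<nu> \<le> C" using \<nu> by (simp add: C power2_eq_square)
qed

lemma C_pos: "0 < C" using C_ge by linarith

lemma \<mu>2_pos: "0 < \<mu>2"
proof -
  obtain k where k: "k < d" "\<mu> k \<noteq> 0" using \<mu>_nz by blast
  then show ?thesis unfolding \<mu>2_def dot_def
    by (intro sum_pos2[of _ k]) (auto simp: zero_less_mult_iff not_less linorder_neq_iff)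
qed

lemma q_pos: "0 < q" using pos by (simp add: q_def)
lemma h_pos: "0 < h" using pos q_pos by (simp add: h_def)
lemma s_pos: "0 < s" using pos q_pos \<mu>2_pos by (simp add: s_def)

lemma vnorm_pos: "0 < vnorm d \<mu>" using \<mu>2_pos by (simp add: vnorm_def \<mu>2_def)

lemma L1_pos: "0 < L1" using pos \<delta>_less unfolding L1_def by (intro ln_gt_zero) (simp add: less_divide_eq)
lemma L2_pos: "0 < L2" using pos \<delta>_less unfolding L2_def by (intro ln_gt_zero) (simp add: less_divide_eq)
lemma L1_le_L3: "L1 \<le> L3" unfolding L1_def L3_def using pos by (intro ln_mono) (auto simp: divide_right_mono)
lemma L2_le_L3: "L2 \<le> L3" unfolding L2_def L3_def using pos by (intro ln_mono) (auto simp: divide_right_mono)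
lemma L3_pos: "0 < L3" using L1_pos L1_le_L3 by simp

lemma SNR_eq: "real n * (SNR d \<mu> \<sigma>)\<^sup>2 = s"
  using pos by (simp add: SNR_def power_divide power_mult_distrib vnorm_sq s_def \<mu>2_def q_def)

lemma time_scale_eq: "time_scale d n m \<sigma> \<eta> = 1 / h"
  using pos by (simp add: time_scale_def h_def q_def mult.assoc)

lemma C0_facts:
  "s \<le> B"
  "C * ((real n)\<^sup>2 * L3 * (ln (real T))\<^sup>2) \<le> real d"
  "C * L1 \<le> real m"
  "\<sigma>\<^sub>0 \<le> 1 / C * (sqrt (real n) / (\<sigma> * real d))"
  "\<sigma>\<^sub>0 \<le> 1 / C * (1 / (vnorm d \<mu> * sqrt L2))"
  "\<eta> \<le> 1 / C * (real n / q)"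
proof -
  note H = C0[unfolded condition_C0_def SNR_eq, folded C_def L1_def L2_def L3_def q_def]
  have C0: "0 \<le> C" "0 \<le> 1 / C" using C_pos by auto
  show "s \<le> B" using H by (auto simp: B_def le_max_iff_disj)
  show "C * ((real n)\<^sup>2 * L3 * (ln (real T))\<^sup>2) \<le> real d"
    using H mult_left_mono[OF max.cobounded1 C0(1), of "(real n)\<^sup>2 * L3 * (ln (real T))\<^sup>2"] order_trans by blast
  show "C * L1 \<le> real m" using H by simp
  show "\<sigma>\<^sub>0 \<le> 1 / C * (sqrt (real n) / (\<sigma> * real d))"
    using H mult_left_mono[OF min.cobounded1 C0(2), of "sqrt (real n) / (\<sigma> * real d)"] order_trans by blast
  show "\<sigma>\<^sub>0 \<le> 1 / C * (1 / (vnorm d \<mu> * sqrt L2))"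
    using H mult_left_mono[OF min.cobounded2 C0(2), of _ "1 / (vnorm d \<mu> * sqrt L2)"] order_trans by blast
  show "\<eta> \<le> 1 / C * (real n / q)"
    using H mult_left_mono[OF min.cobounded2 C0(2), of _ "real n / q"] order_trans by blast
qed

lemma h_le: "h \<le> 1 / C"
proof -
  have "h \<le> 1 / C * (real n / q) * q / (real n * real m)"
    unfolding h_def using C0_facts(6) q_pos pos by (intro divide_right_mono mult_right_mono) auto
  also have "\<dots> = 1 / C / real m" using q_pos pos by simp
  also have "\<dots> \<le> 1 / C / 1" using C_pos pos by (intro divide_left_mono) auto
  finally show ?thesis by simp
qed

lemma h_bounds: "s * h \<le> 1 / 64" "h \<le> 1 / 2"
proof -
  have "s * h \<le> B * (1 / C)" using C0_facts(1) h_le s_pos h_pos B_ge by (intro mult_mono) auto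
  also have "\<dots> \<le> 1 / 64" using C_ge C_pos by (simp add: field_simps)
  finally show "s * h \<le> 1 / 64" .
  have "1 / C \<le> 1 / 64" using C_ge by (intro divide_left_mono) auto
  then show "h \<le> 1 / 2" using h_le by linarith
qed

lemma log_factor_ge: "1 \<le> log_factor d n m \<epsilon> \<delta>" "ln (1 + 1 / \<epsilon>) \<le> log_factor d n m \<epsilon> \<delta>"
proof -
  let ?r = "real n * real m * real d"
  have "1 * 1 * 1 \<le> ?r" using pos by (intro mult_mono) auto
  then have "1 / \<epsilon> \<le> ?r / \<epsilon>" using pos by (intro divide_right_mono) auto
  also have "\<dots> \<le> ?r / (\<delta> * \<epsilon>)" using pos \<delta>_less by (intro divide_left_mono) auto
  finally have r: "1 / \<epsilon> \<le> ?r / (\<delta> * \<epsilon>)" .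
  have p: "0 \<le> ?r / (\<delta> * \<epsilon>)" using pos by simp
  have "ln (exp 1) \<le> log_factor d n m \<epsilon> \<delta>"
    unfolding log_factor_def using p by (intro ln_mono) auto
  then show "1 \<le> log_factor d n m \<epsilon> \<delta>" by simp
  have e: "1 \<le> exp (1::real)" by simp
  have "0 < 1 / \<epsilon>" using pos by simp
  then show "ln (1 + 1 / \<epsilon>) \<le> log_factor d n m \<epsilon> \<delta>"
    unfolding log_factor_def using r e by (intro ln_mono) linarith+
qed

lemma hT_ge: "(200 + 3 * \<epsilon>max) * log_factor d n m \<epsilon> \<delta> \<le> h * real T * \<epsilon>"
  using T_ge h_pos pos by (simp add: time_scale_eq field_simps)

text \<open>The summand 3 * \<epsilon>max leaves room for the starting time, which is at most 2 / h,
  whenever \<epsilon> \<le> \<epsilon>max.\<close>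

lemma hT_ge_3: "3 \<le> h * real T"
proof -
  have "3 * \<epsilon> \<le> (200 + 3 * \<epsilon>max) * 1" using \<epsilon>_le by simp
  also have "\<dots> \<le> (200 + 3 * \<epsilon>max) * log_factor d n m \<epsilon> \<delta>"
    using log_factor_ge pos \<epsilon>_le by (intro mult_left_mono) auto
  also note hT_ge
  finally have "3 * \<epsilon> \<le> h * real T * \<epsilon>" .
  then show ?thesis using pos by simp
qed

text \<open>As h \<le> 1 / 2, T dominates 1 + h T. The cap \<alpha> can thus be taken as 8 * ln T,
  the logarithm that occurs in Condition (C0).\<close>

lemma T_bounds: "1 + h * real T \<le> real T" "1 \<le> ln (real T)"
proof -
  have hT: "h * real T \<le> 1 / 2 * real T" using h_bounds by (intro mult_right_mono) auto
  then show "1 + h * real T \<le> real T" using hT_ge_3 by linarith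
  have "exp 1 \<le> real T" using hT hT_ge_3 exp_le by linarith
  then have "ln (exp 1) \<le> ln (real T)" by (intro ln_mono) auto
  then show "1 \<le> ln (real T)" by simp
qed

text \<open>With z = h T \<epsilon>, ln (1 + h T) is at most ln (1 + z) + ln (1 + 1 / \<epsilon>).
  The second term is at most \<open>log_factor\<close>, and the first grows more slowly than z. The
  factor 200 lets z / 2 - z / 8 beat 48 + 8 * \<open>log_factor\<close>, and 3 * \<epsilon>max pays
  for \<epsilon>.\<close>

lemma loss_condition: "8 * ln (1 + h * real T) < (h * real T - 2) * \<epsilon> / 2"
proof -
  let ?L = "log_factor d n m \<epsilon> \<delta>"
  define z where "z = h * real T * \<epsilon>"
  have z: "(200 + 3 * \<epsilon>max) * ?L \<le> z" using hT_ge by (simp add: z_def)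
  have "0 \<le> (200 + 3 * \<epsilon>max) * ?L" using log_factor_ge(1) pos \<epsilon>_le by (intro mult_nonneg_nonneg) auto
  then have z0: "0 \<le> z" using z by simp
  have "1 + h * real T \<le> (1 + z) * (1 + 1 / \<epsilon>)"
    using pos z0 h_pos by (simp add: z_def field_simps)
  moreover have hT: "0 < 1 + h * real T" using h_pos by (intro add_pos_nonneg) auto
  ultimately have "ln (1 + h * real T) \<le> ln ((1 + z) * (1 + 1 / \<epsilon>))" by (intro ln_mono)
  also have "\<dots> = ln (1 + z) + ln (1 + 1 / \<epsilon>)" using z0 pos by (intro ln_mult_pos) (auto intro: add_pos_pos)
  also have "\<dots> \<le> ln (1 + z) + ?L" using log_factor_ge by simp
  also have "ln (1 + z) \<le> z / 64 + 6"
  proof -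
    \<comment> \<open>The tangent line at 64 has a small slope, at the price of the constant ln 64 <
      6.\<close>
    have "ln (1 + z) = ln ((1 + z) / 64) + ln 64" using z0 by (simp add: ln_div)
    also have "ln ((1 + z) / 64) \<le> (1 + z) / 64 - 1" using z0 by (intro ln_le_minus_one) auto
    also have "ln (64::real) = 6 * ln 2" using ln_realpow[of 2 6] by simp
    finally show ?thesis using ln_2_less_1 by (simp add: field_simps)
  qed
  finally have "8 * ln (1 + h * real T) \<le> z / 8 + 48 + 8 * ?L" by simp
  moreover have "(200 + 3 * \<epsilon>max) * ?L = 200 * ?L + 3 * (\<epsilon>max * ?L)" by (simp add: algebra_simps)
  moreover have "\<epsilon>max * 1 \<le> \<epsilon>max * ?L" using log_factor_ge(1) pos \<epsilon>_le by (intro mult_left_mono) auto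
  moreover have "(h * real T - 2) * \<epsilon> / 2 = z / 2 - \<epsilon>" by (simp add: z_def field_simps)
  ultimately show ?thesis using z log_factor_ge(1) \<epsilon>_le pos by linarith
qed

lemma nL_le: "C * (real n * L3 * (ln (real T))\<^sup>2) \<le> real d" "real n * L3 \<le> real d" "C * L3 \<le> real d"
proof -
  have n: "real n \<le> (real n)\<^sup>2" using pos by (simp add: power2_eq_square)
  have T1: "1 \<le> (ln (real T))\<^sup>2" using T_bounds by (simp add: one_le_power)
  have "C * (real n * L3 * (ln (real T))\<^sup>2) \<le> C * ((real n)\<^sup>2 * L3 * (ln (real T))\<^sup>2)"
    using n C_pos L3_pos by (intro mult_left_mono mult_right_mono) auto
  then show 1: "C * (real n * L3 * (ln (real T))\<^sup>2) \<le> real d" using C0_facts(2) by linarith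
  have "C * (real n * L3 * 1) \<le> C * (real n * L3 * (ln (real T))\<^sup>2)"
    using T1 C_pos L3_pos by (intro mult_left_mono) auto
  then have 2: "C * (real n * L3) \<le> real d" using 1 by simp
  have "1 * (real n * L3) \<le> C * (real n * L3)" using C_ge L3_pos by (intro mult_right_mono) auto
  then show "real n * L3 \<le> real d" using 2 by simp
  have "C * (1 * L3) \<le> C * (real n * L3)" using C_pos L3_pos pos by (intro mult_left_mono mult_right_mono) auto
  then show "C * L3 \<le> real d" using 2 by simp
qed

section \<open>Sizes of the thresholds under Condition (C0)\<close>

lemma d_pos: "0 < real d" using pos by simp

text \<open>The thresholds are square roots, so the products are compared after squaring: their
  squares are at most 8 / C and 2 * B / C. The squared logarithm of T in the lower bound on d serves
  this comparison.\<close>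

lemma cross_small: "(s * \<epsilon>\<^sub>2 + real n * \<epsilon>\<^sub>1) * (8 * ln (real T)) \<le> \<nu> / 2"
proof -
  let ?l = "ln (real T)"
  have l: "0 \<le> ?l" using T_bounds by simp
  have "(real n * \<epsilon>\<^sub>1 * ?l)\<^sup>2 = 8 * ((real n)\<^sup>2 * L1 * ?l\<^sup>2) / real d"
    using L1_pos pos by (simp add: \<epsilon>\<^sub>1_def power_mult_distrib)
  also have "\<dots> \<le> (\<nu> / 32)\<^sup>2"
  proof -
    have "C * (8 * ((real n)\<^sup>2 * L1 * ?l\<^sup>2)) \<le> C * (8 * ((real n)\<^sup>2 * L3 * ?l\<^sup>2))"
      using C_pos L1_le_L3 by (intro mult_left_mono mult_right_mono) auto
    also have "\<dots> \<le> 8 * 1 * real d" using C0_facts(2) by simp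
    also have "\<dots> \<le> C * (\<nu> / 32)\<^sup>2 * real d" unfolding C_\<nu> using B_ge by (intro mult_right_mono) auto
    finally have "C * (8 * ((real n)\<^sup>2 * L1 * ?l\<^sup>2)) \<le> C * ((\<nu> / 32)\<^sup>2 * real d)" by (simp only: mult.assoc)
    then have "8 * ((real n)\<^sup>2 * L1 * ?l\<^sup>2) \<le> (\<nu> / 32)\<^sup>2 * real d" using C_pos by (rule mult_left_le_imp_le)
    then show ?thesis by (simp only: pos_divide_le_eq[OF d_pos])
  qed
  finally have 1: "real n * \<epsilon>\<^sub>1 * ?l \<le> \<nu> / 32" by (rule power2_le_imp_le) (use \<nu> in simp)
  have "(s * \<epsilon>\<^sub>2 * ?l)\<^sup>2 = s\<^sup>2 * (2 * \<sigma>\<^sup>2 * L1 / \<mu>2) * ?l\<^sup>2"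
    using L1_pos \<mu>2_pos pos by (simp add: \<epsilon>\<^sub>2_def power_mult_distrib)
  also have "\<dots> = 2 * s * (real n * L1 * ?l\<^sup>2) / real d"
    using \<mu>2_pos pos by (simp add: s_def q_def power2_eq_square field_simps)
  also have "\<dots> \<le> (\<nu> / 32)\<^sup>2"
  proof -
    have "C * (2 * s * (real n * L1 * ?l\<^sup>2)) \<le> C * (2 * B * (real n * L3 * ?l\<^sup>2))"
      using C_pos L1_le_L3 C0_facts(1) s_pos L1_pos B_ge by (intro mult_left_mono mult_mono mult_right_mono) auto
    also have "\<dots> \<le> 2 * B * real d" using mult_left_mono[OF nL_le(1), of "2 * B"] B_ge by (simp add: mult_ac)
    also have "\<dots> \<le> C * (\<nu> / 32)\<^sup>2 * real d" unfolding C_\<nu> using B_ge by (intro mult_right_mono) auto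
    finally have "C * (2 * s * (real n * L1 * ?l\<^sup>2)) \<le> C * ((\<nu> / 32)\<^sup>2 * real d)" by (simp only: mult.assoc)
    then have "2 * s * (real n * L1 * ?l\<^sup>2) \<le> (\<nu> / 32)\<^sup>2 * real d" using C_pos by (rule mult_left_le_imp_le)
    then show ?thesis by (simp only: pos_divide_le_eq[OF d_pos])
  qed
  finally have 2: "s * \<epsilon>\<^sub>2 * ?l \<le> \<nu> / 32" by (rule power2_le_imp_le) (use \<nu> in simp)
  have "(s * \<epsilon>\<^sub>2 + real n * \<epsilon>\<^sub>1) * (8 * ?l) = 8 * (s * \<epsilon>\<^sub>2 * ?l + real n * \<epsilon>\<^sub>1 * ?l)" by (simp add: algebra_simps)
  also have "\<dots> \<le> 8 * (\<nu> / 32 + \<nu> / 32)" using 1 2 by (intro mult_left_mono add_mono) auto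
  finally show ?thesis by simp
qed

lemma two_div_C: "2 / C \<le> \<nu> / 2"
  using C_ge(2) C_pos \<nu> by (simp add: field_simps)

lemma u_le: "0 \<le> u" "u \<le> \<nu> / 2"
proof -
  show "0 \<le> u" using pos L3_pos by (simp add: u_def)
  have "u \<le> 2 * (1 / C * (sqrt (real n) / (\<sigma> * real d))) * \<sigma> * sqrt (real d * L3)"
    unfolding u_def using C0_facts(4) pos L3_pos by (intro mult_right_mono mult_left_mono) auto
  also have "\<dots> = 2 / C * (sqrt (real n * L3) * sqrt (real d) / real d)"
    using pos by (simp add: real_sqrt_mult field_simps)
  also have "\<dots> \<le> 2 / C * (sqrt (real d) * sqrt (real d) / real d)"
    using nL_le(2) C_pos pos by (intro mult_left_mono divide_right_mono mult_right_mono real_sqrt_le_mono) auto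
  also have "\<dots> = 2 / C" using pos by simp
  finally show "u \<le> \<nu> / 2" using two_div_C by linarith
qed

lemma v_le: "0 \<le> v" "v \<le> \<nu> / 2"
proof -
  show "0 \<le> v" using pos L2_pos vnorm_pos by (simp add: v_def)
  have "v \<le> 1 / C * (1 / (vnorm d \<mu> * sqrt L2)) * vnorm d \<mu> * sqrt (2 * L2)"
    unfolding v_def using C0_facts(5) vnorm_pos L2_pos by (intro mult_right_mono) auto
  also have "\<dots> = sqrt 2 / C" using vnorm_pos L2_pos by (simp add: real_sqrt_mult)
  also have "\<dots> \<le> 2 / C" using C_pos sqrt2_less_2 by (intro divide_right_mono) auto
  finally show "v \<le> \<nu> / 2" using two_div_C by linarith
qed

lemma exp_L: "exp (- L1) = \<delta> / real n" "exp (- L2) = \<delta> / real m" "exp (- L3) = \<delta> / (real n * real m)"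
  using pos by (simp_all add: L1_def L2_def L3_def exp_minus)

lemma tail_bounds:
  "exp (- real d / 20) \<le> \<delta> / real n"
  "exp (- \<epsilon>\<^sub>1\<^sup>2 * real d / 4) \<le> (\<delta> / real n)\<^sup>2"
  "exp (- \<epsilon>\<^sub>2\<^sup>2 * dot d \<mu> \<mu> / (2 * \<sigma>\<^sup>2)) \<le> \<delta> / real n"
  "exp (- u\<^sup>2 / (4 * \<sigma>\<^sub>0\<^sup>2 * (\<sigma>\<^sup>2 * real d))) \<le> \<delta> / (real n * real m)"
  "exp (- v\<^sup>2 / (2 * \<sigma>\<^sub>0\<^sup>2 * dot d \<mu> \<mu>)) \<le> \<delta> / real m"
  "exp (- real d / 16) \<le> \<delta> / real m"
  "exp (- real m / 20) \<le> \<delta> / real n"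
proof -
  have "20 * L3 \<le> C * L3" "20 * L1 \<le> C * L1" using C_ge L3_pos L1_pos by (intro mult_right_mono; simp)+
  then have d: "20 * L3 \<le> real d" and m: "20 * L1 \<le> real m" using nL_le(3) C0_facts(3) by linarith+
  show "exp (- real d / 20) \<le> \<delta> / real n" "exp (- real m / 20) \<le> \<delta> / real n"
    unfolding exp_L[symmetric] using d m L1_le_L3 by simp_all
  show "exp (- real d / 16) \<le> \<delta> / real m"
    unfolding exp_L[symmetric] using d L2_le_L3 L3_pos by simp
  have "- \<epsilon>\<^sub>1\<^sup>2 * real d / 4 = - L1 + - L1" using L1_pos pos by (simp add: \<epsilon>\<^sub>1_def)
  then show "exp (- \<epsilon>\<^sub>1\<^sup>2 * real d / 4) \<le> (\<delta> / real n)\<^sup>2"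
    by (simp only: exp_add exp_L power2_eq_square)
  have "- \<epsilon>\<^sub>2\<^sup>2 * dot d \<mu> \<mu> / (2 * \<sigma>\<^sup>2) = - L1"
    using L1_pos pos \<mu>2_pos by (simp add: \<epsilon>\<^sub>2_def \<mu>2_def[symmetric])
  then show "exp (- \<epsilon>\<^sub>2\<^sup>2 * dot d \<mu> \<mu> / (2 * \<sigma>\<^sup>2)) \<le> \<delta> / real n" by (simp only: exp_L)
  have "- u\<^sup>2 / (4 * \<sigma>\<^sub>0\<^sup>2 * (\<sigma>\<^sup>2 * real d)) = - L3"
    using L3_pos pos by (simp add: u_def power_mult_distrib)
  then show "exp (- u\<^sup>2 / (4 * \<sigma>\<^sub>0\<^sup>2 * (\<sigma>\<^sup>2 * real d))) \<le> \<delta> / (real n * real m)" by (simp only: exp_L)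
  have "- v\<^sup>2 / (2 * \<sigma>\<^sub>0\<^sup>2 * dot d \<mu> \<mu>) = - L2"
    using L2_pos pos \<mu>2_pos by (simp add: v_def power_mult_distrib vnorm_sq \<mu>2_def)
  then show "exp (- v\<^sup>2 / (2 * \<sigma>\<^sub>0\<^sup>2 * dot d \<mu> \<mu>)) \<le> \<delta> / real m" by (simp only: exp_L)
qed

lemma \<epsilon>_nonneg: "0 \<le> \<epsilon>\<^sub>1" "0 \<le> \<epsilon>\<^sub>2"
  using L1_pos \<mu>2_pos by (simp_all add: \<epsilon>\<^sub>1_def \<epsilon>\<^sub>2_def)

lemma init_norm: "\<sigma>\<^sup>2 * (2 * (\<sigma>\<^sub>0\<^sup>2 * real d)) \<le> real n / (s * real d)"
proof -
  have "\<sigma>\<^sub>0\<^sup>2 \<le> (1 / C * (sqrt (real n) / (\<sigma> * real d)))\<^sup>2"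
    using C0_facts(4) pos by (intro power_mono) auto
  also have "\<dots> = real n / (C\<^sup>2 * (\<sigma>\<^sup>2 * (real d)\<^sup>2))" by (simp add: power_mult_distrib power_divide)
  finally have "\<sigma>\<^sup>2 * (2 * (\<sigma>\<^sub>0\<^sup>2 * real d)) \<le> \<sigma>\<^sup>2 * (2 * (real n / (C\<^sup>2 * (\<sigma>\<^sup>2 * (real d)\<^sup>2)) * real d))"
    by (intro mult_left_mono mult_right_mono) auto
  also have "\<dots> = 2 / C\<^sup>2 * (real n / real d)" using pos C_pos by (simp add: power2_eq_square)
  also have "\<dots> \<le> 1 / s * (real n / real d)"
  proof (rule mult_right_mono)
    have "2 * s \<le> C * 1" using C0_facts(1) C_ge B_ge by linarith
    also have "\<dots> \<le> C * C" using C_ge by (intro mult_left_mono) auto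
    finally show "2 / C\<^sup>2 \<le> 1 / s" using s_pos C_pos by (simp add: field_simps power2_eq_square)
  qed simp
  finally show ?thesis by simp
qed

text \<open>The lower bound on d gives n * L3 \<le> d, and L3 is at least ln m because \<delta> <
  1.\<close>

lemma width_le: "real m \<le> exp (real d / real n)"
proof -
  have "ln (real m) \<le> L2" unfolding L2_def using pos \<delta>_less by (intro ln_mono) (auto simp: field_simps)
  also have "\<dots> \<le> L3" by (rule L2_le_L3)
  also have "\<dots> \<le> real d / real n" using nL_le(2) pos by (simp add: field_simps)
  finally show ?thesis using pos by (simp add: ln_le_cancel_iff[symmetric] del: ln_le_cancel_iff)
qed

end

section \<open>Conditioning on balanced labels\<close>

lemma card_eq_sum_of_bool:
  fixes n :: nat
  shows "real (card {i. i < n \<and> Q i}) = (\<Sum>i<n. of_bool (Q i))"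
proof -
  have eq: "{i. i < n \<and> Q i} = {..<n} \<inter> {i. Q i}" by auto
  show ?thesis unfolding eq by (subst sum_of_bool_eq) simp_all
qed

definition label_space :: "nat \<Rightarrow> (nat \<Rightarrow> real) measure" where
  "label_space n = PiM {..<n} (\<lambda>_. measure_pmf label_pmf)"

lemma prob_space_label_space: "prob_space (label_space n)"
  unfolding label_space_def by (intro prob_space_PiM prob_space_measure_pmf)

lemma measurable_label: "i < n \<Longrightarrow> (\<lambda>y. f (y i)) \<in> borel_measurable (label_space n)"
  unfolding label_space_def
  by (rule measurable_compose[of "\<lambda>y. y i" _ "measure_pmf label_pmf" f]) (simp_all add: measurable_component_singleton)

lemma sets_balanced: "{y \<in> space (label_space n). balanced n y} \<in> sets (label_space n)"
proof -
  have "balanced n y \<longleftrightarrow> (\<Sum>i<n. of_bool (y i = 1)) = (\<Sum>i<n. of_bool (y i = -1) :: real)" for y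
    unfolding balanced_def card_eq_sum_of_bool[symmetric] by simp
  then show ?thesis
    by (simp only:) (intro borel_measurable_eq borel_measurable_sum measurable_label; simp)
qed

lemma AE_labels: "AE y in label_space n. \<forall>i\<in>{..<n}. y i = 1 \<or> y i = -1"
proof (rule AE_finite_allI)
  fix i assume "i \<in> {..<n}"
  then show "AE y in label_space n. y i = 1 \<or> y i = -1"
    unfolding label_space_def
  proof (intro AE_PiM_component prob_space_measure_pmf)
    show "AE x in measure_pmf label_pmf. x = 1 \<or> x = -1"
      by (rule AE_mp[OF AE_measure_pmf]) (auto simp: label_pmf_eq)
  qed
qed simp

text \<open>A single labelling, +1 on the first half and -1 on the second, already has probability
  2^(-n). Positivity matters because \<open>cond_prob\<close> divides by this number and division by
  0 gives 0.\<close>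

lemma measure_balanced_pos:
  assumes "even n"
  shows "0 < measure (label_space n) {y \<in> space (label_space n). balanced n y}"
proof -
  interpret L: prob_space "label_space n" by (rule prob_space_label_space)
  interpret product_prob_space "\<lambda>_::nat. measure_pmf label_pmf" "{..<n}"
    by (rule product_prob_spaceI) (rule prob_space_measure_pmf)
  define c :: "nat \<Rightarrow> real" where "c i = (if i < n div 2 then 1 else -1)" for i
  let ?A = "PiE {..<n} (\<lambda>i. {c i})"
  have "?A \<subseteq> {y \<in> space (label_space n). balanced n y}"
  proof
    fix y assume y: "y \<in> ?A"
    then have yc: "y i = c i" if "i < n" for i using that by (auto simp: PiE_iff)
    have "{i. i < n \<and> y i = x} = {i. i < n \<and> c i = x}" for x
      using yc by (intro Collect_cong conj_cong refl) simp
    moreover have "{i. i < n \<and> c i = 1} = {..<n div 2}" "{i. i < n \<and> c i = -1} = {n div 2..<n}"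
      by (auto simp: c_def split: if_splits)
    ultimately have eq: "{i. i < n \<and> y i = 1} = {..<n div 2}" "{i. i < n \<and> y i = -1} = {n div 2..<n}"
      by (simp_all only:)
    have "balanced n y" unfolding balanced_def eq using assms by (elim evenE) simp
    then show "y \<in> {y \<in> space (label_space n). balanced n y}"
      using y by (auto simp: label_space_def space_PiM PiE_iff)
  qed
  then have "emeasure (label_space n) ?A \<le> emeasure (label_space n) {y \<in> space (label_space n). balanced n y}"
    by (intro emeasure_mono sets_balanced)
  moreover have "emeasure (label_space n) ?A = (\<Prod>i<n. emeasure (measure_pmf label_pmf) {c i})"
    unfolding label_space_def by (rule emeasure_PiM) auto
  moreover have "\<dots> = (\<Prod>i<n. ennreal (1 / 2))"
    by (intro prod.cong) (auto simp: emeasure_pmf_single c_def label_pmf_eq)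
  moreover have "\<dots> = ennreal ((1 / 2) ^ n)" by (simp add: ennreal_power del: ennreal_half)
  ultimately have "ennreal ((1 / 2) ^ n) \<le> emeasure (label_space n) {y \<in> space (label_space n). balanced n y}" by simp
  then have "(1 / 2) ^ n \<le> L.prob {y \<in> space (label_space n). balanced n y}"
    by (simp add: L.emeasure_eq_measure)
  moreover have "0 < (1 / 2 :: real) ^ n" by simp
  ultimately show ?thesis by linarith
qed

text \<open>Balancedness is a property of the labels, which are independent of noise and
  initialization; conditioning on it leaves the probability of \<open>Good\<close>
  unchanged.\<close>

lemma cond_prob_balanced_ge:
  fixes Z :: "'z measure" and S :: "(nat \<Rightarrow> real) \<Rightarrow> 'z \<Rightarrow> bool"
  assumes Z: "prob_space Z" and n: "even n"
    and S: "{x \<in> space (label_space n \<Otimes>\<^sub>M Z). S (fst x) (snd x)} \<in> sets (label_space n \<Otimes>\<^sub>M Z)"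
    and good: "{z \<in> space Z. Good z} \<in> sets Z" "p \<le> measure Z {z \<in> space Z. Good z}"
    and imp: "\<And>y z. balanced n y \<Longrightarrow> (\<And>i. i < n \<Longrightarrow> y i = 1 \<or> y i = -1) \<Longrightarrow> Good z \<Longrightarrow> S y z"
  shows "p \<le> cond_prob (label_space n \<Otimes>\<^sub>M Z) (\<lambda>(y, z). S y z) (\<lambda>(y, z). balanced n y)"
proof -
  let ?L = "label_space n"
  interpret L: prob_space ?L by (rule prob_space_label_space)
  interpret Z: prob_space Z by (rule Z)
  interpret LZ: pair_prob_space ?L Z ..
  let ?b = "{y \<in> space ?L. balanced n y}" and ?g = "{z \<in> space Z. Good z}"
  \<comment> \<open>The space also contains label functions with values outside {-1, 1}. They form a
    null set and are removed here.\<close>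
  let ?b' = "{y \<in> space ?L. balanced n y \<and> (\<forall>i\<in>{..<n}. y i = 1 \<or> y i = -1)}"
  have lab: "{y \<in> space ?L. \<forall>i\<in>{..<n}. y i = 1 \<or> y i = -1} \<in> sets ?L"
  proof -
    have lab_i: "{y \<in> space ?L. y i = 1 \<or> y i = -1} \<in> sets ?L" if "i \<in> {..<n}" for i
    proof -
      have "(\<lambda>y. y i) -` {1, -1} \<inter> space ?L \<in> sets ?L"
        using that unfolding label_space_def by (intro measurable_sets[OF measurable_component_singleton]) auto
      moreover have "(\<lambda>y. y i) -` {1, -1} \<inter> space ?L = {y \<in> space ?L. y i = 1 \<or> y i = -1}" by auto
      ultimately show ?thesis by (simp only:)
    qed
    show ?thesis by (rule sets.sets_Collect_finite_All[OF lab_i]) simp_all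
  qed
  have b': "?b' \<in> sets ?L" by (rule sets.sets_Collect_conj[OF lab sets_balanced])
  have beq: "L.prob ?b = L.prob ?b'"
    by (rule L.prob_eq_AE[OF _ sets_balanced b']) (use AE_labels[of n] in eventually_elim, auto)
  have times: "measure (?L \<Otimes>\<^sub>M Z) (A \<times> D) = L.prob A * Z.prob D" if "A \<in> sets ?L" "D \<in> sets Z" for A D
    using Z.emeasure_pair_measure_Times[OF that]
    by (simp add: LZ.P.emeasure_eq_measure L.emeasure_eq_measure Z.emeasure_eq_measure ennreal_mult[symmetric])
  have Q_eq: "{x \<in> space (?L \<Otimes>\<^sub>M Z). case x of (y, z) \<Rightarrow> balanced n y} = ?b \<times> space Z"
    by (auto simp: space_pair_measure)
  then have Q: "measure (?L \<Otimes>\<^sub>M Z) {x \<in> space (?L \<Otimes>\<^sub>M Z). case x of (y, z) \<Rightarrow> balanced n y} = L.prob ?b"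
    using times[OF sets_balanced sets.top] by (simp add: Z.prob_space)
  have PQ_eq: "{x \<in> space (?L \<Otimes>\<^sub>M Z). (case x of (y, z) \<Rightarrow> S y z) \<and> (case x of (y, z) \<Rightarrow> balanced n y)}
      = {x \<in> space (?L \<Otimes>\<^sub>M Z). S (fst x) (snd x)} \<inter> (?b \<times> space Z)"
    by (auto simp: space_pair_measure)
  have PQ_sets: "{x \<in> space (?L \<Otimes>\<^sub>M Z). (case x of (y, z) \<Rightarrow> S y z) \<and> (case x of (y, z) \<Rightarrow> balanced n y)}
      \<in> sets (?L \<Otimes>\<^sub>M Z)"
    unfolding PQ_eq using S sets_balanced by (intro sets.Int pair_measureI) auto
  have "p * L.prob ?b \<le> Z.prob ?g * L.prob ?b'"
    unfolding beq using good(2) by (intro mult_right_mono) auto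
  also have "\<dots> = measure (?L \<Otimes>\<^sub>M Z) (?b' \<times> ?g)" using times[OF b' good(1)] by simp
  also have "\<dots> \<le> measure (?L \<Otimes>\<^sub>M Z)
      {x \<in> space (?L \<Otimes>\<^sub>M Z). (case x of (y, z) \<Rightarrow> S y z) \<and> (case x of (y, z) \<Rightarrow> balanced n y)}"
    using imp by (intro LZ.P.finite_measure_mono PQ_sets) (auto simp: space_pair_measure)
  finally show ?thesis
    using measure_balanced_pos[OF n] unfolding cond_prob_def Q by (simp add: le_divide_eq)
qed

text \<open>The event of the theorem in a shape that can be folded there, with the time window and
  the test bound as parameters.\<close>

definition success ::
  "nat \<Rightarrow> nat \<Rightarrow> nat \<Rightarrow> vec \<Rightarrow> real \<Rightarrow> real \<Rightarrow> real \<Rightarrow> nat \<Rightarrow> real \<Rightarrow> real \<Rightarrow> real \<Rightarrow>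
    (nat \<Rightarrow> real) \<Rightarrow> (nat \<Rightarrow> vec) \<Rightarrow> weights \<Rightarrow> bool" where
  "success d n m \<mu> \<sigma> \<eta> \<epsilon> T c\<^sub>1 c\<^sub>2 bound y \<xi> W0 \<longleftrightarrow> (\<exists>T\<^sub>1::nat.
     c\<^sub>1 \<le> real T\<^sub>1 \<and> real T\<^sub>1 \<le> c\<^sub>2 \<and>
     (\<forall>t. T\<^sub>1 \<le> t \<and> t \<le> T \<longrightarrow>
        (\<forall>i<n. y i * network d m (gd d n m \<mu> \<eta> y \<xi> W0 t) (train_input \<mu> y \<xi> i) \<ge> 0)) \<and>
     (\<exists>t. T\<^sub>1 \<le> t \<and> t \<le> T \<and>
        train_loss d n m \<mu> y \<xi> (gd d n m \<mu> \<eta> y \<xi> W0 t) \<le> \<epsilon> \<and>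
        (\<forall>i<n. y i * network d m (gd d n m \<mu> \<eta> y \<xi> W0 t) (train_input \<mu> y \<xi> i) \<ge> 0) \<and>
        test_error d n m \<mu> \<sigma> \<xi> (gd d n m \<mu> \<eta> y \<xi> W0 t) \<le> bound))"

lemma sets_success:
  assumes \<sigma>: "0 < \<sigma>" and n: "0 < n"
    and y: "\<And>i. i < n \<Longrightarrow> (\<lambda>x. y x i) \<in> borel_measurable M"
    and \<xi>: "\<And>i k. i < n \<Longrightarrow> k < d \<Longrightarrow> (\<lambda>x. \<xi> x i k) \<in> borel_measurable M"
    and W0: "\<And>j r k. j = 1 \<or> j = -1 \<Longrightarrow> r < m \<Longrightarrow> k < d \<Longrightarrow> (\<lambda>x. W0 x (j, r) k) \<in> borel_measurable M"
  shows "{x \<in> space M. success d n m \<mu> \<sigma> \<eta> \<epsilon> T c\<^sub>1 c\<^sub>2 bound (y x) (\<xi> x) (W0 x)} \<in> sets M"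
proof -
  let ?W = "\<lambda>t x. gd d n m \<mu> \<eta> (y x) (\<xi> x) (W0 x) t"
  let ?f = "\<lambda>t i x. y x i * network d m (?W t x) (train_input \<mu> (y x) (\<xi> x) i)"
  have W: "(\<lambda>x. ?W t x (j, r) k) \<in> borel_measurable M" if "j = 1 \<or> j = -1" "r < m" "k < d" for t j r k
    by (rule measurable_gd, erule y, erule (1) \<xi>, erule (2) W0, (rule that)+)
  have f: "?f t i \<in> borel_measurable M" if "i < n" for t i
  proof -
    have "(\<lambda>x. vscale (y x i) \<mu> k) \<in> borel_measurable M" for k
      unfolding vscale_def by (intro borel_measurable_times borel_measurable_const y that)
    then show ?thesis unfolding train_input_def
      using that by (intro borel_measurable_times y measurable_network W \<xi>)
  qed
  have loss: "(\<lambda>x. train_loss d n m \<mu> (y x) (\<xi> x) (?W t x)) \<in> borel_measurable M" for t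
  proof -
    have "logistic \<in> borel_measurable borel" unfolding logistic_def[abs_def] by measurable
    then have lf: "(\<lambda>x. logistic (?f t i x)) \<in> borel_measurable M" if "i < n" for i
      by (rule measurable_compose[OF f[OF that]])
    have "(\<lambda>x. \<Sum>i<n. logistic (?f t i x)) \<in> borel_measurable M"
      by (rule borel_measurable_sum, rule lf) simp
    then show ?thesis unfolding train_loss_def by (rule borel_measurable_times[OF borel_measurable_const])
  qed
  have te: "(\<lambda>x. test_error d n m \<mu> \<sigma> (\<xi> x) (?W t x)) \<in> borel_measurable M" for t
    by (rule measurable_test_error[OF \<sigma> n], erule (1) \<xi>, erule (2) W)
  have fs: "{x \<in> space M. \<forall>i<n. 0 \<le> ?f t i x} \<in> sets M" for t
  proof -
    have "{x \<in> space M. \<forall>i\<in>{..<n}. 0 \<le> ?f t i x} \<in> sets M"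
      by (intro sets.sets_Collect_finite_All borel_measurable_le borel_measurable_const f) simp_all
    moreover have "(\<forall>i\<in>{..<n}. Q i) \<longleftrightarrow> (\<forall>i<n. Q i)" for Q by auto
    ultimately show ?thesis by (simp only:)
  qed
  show ?thesis unfolding success_def
    by (intro sets.sets_Collect_countable_Ex sets.sets_Collect_conj sets.sets_Collect_const
        sets.sets_Collect_countable_All sets.sets_Collect_imp fs borel_measurable_le loss te borel_measurable_const)
qed

section \<open>From the good event to the theorem\<close>

context regime begin

lemma good_runI:
  assumes noise: "good_noise d n \<mu> \<sigma> \<epsilon>\<^sub>1 \<epsilon>\<^sub>2 \<xi>" and init: "good_init d n m \<mu> \<sigma>\<^sub>0 u v \<xi> W0"
    and labels: "\<And>i. i < n \<Longrightarrow> y i = 1 \<or> y i = -1" and bal: "balanced n y"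
  shows "good_run d n m \<mu> \<sigma> \<eta> y \<xi> W0 T B (8 * ln (real T)) \<nu> \<epsilon>\<^sub>1 \<epsilon>\<^sub>2"
proof -
  interpret R: gd_run d n m \<mu> \<sigma> \<eta> y \<xi> W0
    using pos \<mu>2_pos labels by unfold_locales (auto simp: \<mu>2_def)
  have qhs: "R.q = q" "R.h = h" "R.s = s"
    by (simp_all add: R.q_def R.h_def R.s_def q_def h_def s_def \<mu>2_def)
  have card: "real (card {i. i < n \<and> y i = j}) = real n / 2" if "j = 1 \<or> j = -1" for j
  proof -
    have "{i. i < n \<and> y i = 1} \<union> {i. i < n \<and> y i = -1} = {..<n}" using labels by auto
    moreover have "card ({i. i < n \<and> y i = 1} \<union> {i. i < n \<and> y i = -1})
        = card {i. i < n \<and> y i = 1} + card {i. i < n \<and> y i = -1}"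
      by (rule card_Un_disjoint) auto
    ultimately have "card {i. i < n \<and> y i = 1} + card {i. i < n \<and> y i = -1} = n" by simp
    then show ?thesis using bal that unfolding balanced_def by auto
  qed
  show ?thesis
  proof (unfold_locales, unfold qhs)
    show "real (card {i. i < n \<and> y i = j}) = real n / 2" if "j = 1 \<or> j = -1" for j
      using card[OF that] .
    show "q / 2 \<le> dot d (\<xi> i) (\<xi> i) \<and> dot d (\<xi> i) (\<xi> i) \<le> 2 * q" if "i < n" for i
      using noise that by (simp add: good_noise_def q_def)
    show "\<bar>dot d (\<xi> k) (\<xi> i)\<bar> \<le> \<epsilon>\<^sub>1 * q" if "i < n" "k < n" "k \<noteq> i" for i k
      using noise that by (auto simp: good_noise_def q_def)
    show "\<bar>dot d \<mu> (\<xi> i)\<bar> \<le> \<epsilon>\<^sub>2 * dot d \<mu> \<mu>" if "i < n" for i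
      unfolding dot_commute[of d \<mu> "\<xi> i"] using noise that by (simp add: good_noise_def)
    show "\<bar>dot d (W0 (j, r)) (\<xi> i)\<bar> \<le> \<nu> / 2" if "j = 1 \<or> j = -1" "r < m" "i < n" for j r i
    proof -
      have "((j, r), i) \<in> neurons m \<times> {..<n}" using that by (simp add: neurons_iff)
      then have "\<bar>dot d (W0 (j, r)) (\<xi> i)\<bar> \<le> u" using init unfolding good_init_def by fastforce
      then show ?thesis using u_le by linarith
    qed
    show "\<bar>dot d (W0 (j, r)) \<mu>\<bar> \<le> \<nu> / 2" if "j = 1 \<or> j = -1" "r < m" for j r
    proof -
      have "(j, r) \<in> neurons m" using that by (simp add: neurons_iff)
      then have "\<bar>dot d (W0 (j, r)) \<mu>\<bar> \<le> v" using init unfolding good_init_def by blast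
      then show ?thesis using v_le by linarith
    qed
    show "real m / 4 \<le> real (card {r. r < m \<and> 0 \<le> dot d (W0 (y i, r)) (\<xi> i)})" if "i < n" for i
    proof -
      have "(y i, i) \<in> {-1, 1} \<times> {..<n}" using labels[OF that] that by auto
      then show ?thesis using init unfolding good_init_def card_eq_sum_of_bool by fastforce
    qed
    show "8 * ln (1 + h * real T) \<le> 8 * ln (real T)"
      using T_bounds hT_ge_3 by (intro mult_left_mono ln_mono) auto
    show "\<nu> = 1 / (256 * (1 + exp (B + 3)))" by (simp add: \<nu>_def noise_tol_def B_def)
  qed (use B_ge C0_facts(1) h_bounds T_bounds \<epsilon>_nonneg cross_small in auto)
qed

lemma success:
  assumes noise: "good_noise d n \<mu> \<sigma> \<epsilon>\<^sub>1 \<epsilon>\<^sub>2 \<xi>" and init: "good_init d n m \<mu> \<sigma>\<^sub>0 u v \<xi> W0"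
    and labels: "\<And>i. i < n \<Longrightarrow> y i = 1 \<or> y i = -1" and bal: "balanced n y"
  shows "success d n m \<mu> \<sigma> \<eta> \<epsilon> T (time_scale d n m \<sigma> \<eta>) (2 * time_scale d n m \<sigma> \<eta>)
    (exp (real d / real n - real n * vnorm d \<mu> ^ 4 / ((3 * 10 ^ 7 * B) * \<sigma> ^ 4 * real d))) y \<xi> W0"
proof -
  interpret R: good_run d n m \<mu> \<sigma> \<eta> y \<xi> W0 T B "8 * ln (real T)" \<nu> \<epsilon>\<^sub>1 \<epsilon>\<^sub>2
    by (rule good_runI[OF noise init labels bal])
  have qhs: "R.q = q" "R.h = h" "R.s = s"
    by (simp_all add: R.q_def R.h_def R.s_def q_def h_def s_def \<mu>2_def)
  define K :: real where "K = 3 * 10 ^ 7"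
  define bound where "bound = exp (real d / real n - real n * vnorm d \<mu> ^ 4 / ((K * B) * \<sigma> ^ 4 * real d))"
  have bound_eq: "bound = exp (real d / real n * (1 - s\<^sup>2 / (K * B)))"
  proof -
    have "vnorm d \<mu> ^ 4 = \<mu>2\<^sup>2" unfolding \<mu>2_def vnorm_sq[symmetric] by simp
    then have "real n * vnorm d \<mu> ^ 4 / ((K * B) * \<sigma> ^ 4 * real d) = real d / real n * (s\<^sup>2 / (K * B))"
      using pos by (simp add: s_def q_def power2_eq_square power4_eq_xxxx field_simps)
    then show ?thesis by (simp add: bound_def right_diff_distrib)
  qed
  have KB: "0 < K * B" using B_ge by (simp add: K_def)
  have te: "test_error d n m \<mu> \<sigma> \<xi> (R.W t) \<le> bound" if t: "t \<le> T" "1 \<le> h * real t" for t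
  proof (cases "K \<le> s")
    case False
    \<comment> \<open>One factor s is below K and the other is at most B, so the exponent of the
      bound is nonnegative.\<close>
    have "s\<^sup>2 \<le> K * B" unfolding power2_eq_square using False C0_facts(1) s_pos by (intro mult_mono) auto
    then have "0 \<le> real d / real n * (1 - s\<^sup>2 / (K * B))" using KB by (intro mult_nonneg_nonneg) auto
    then have "1 \<le> bound" unfolding bound_eq by simp
    then show ?thesis using test_error_le_1[OF pos(4,2), of d m \<mu> \<xi> "R.W t"] by linarith
  next
    case True
    then have s1: "R.s\<^sub>1 \<le> R.s" by (simp add: R.s\<^sub>1_def K_def qhs)
    have t': "1 \<le> R.h * real t" using t by (simp add: qhs)
    let ?G = "gauss d \<sigma>"
    interpret G: prob_space ?G using pos by (intro prob_space_gauss)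
    show ?thesis
    proof (rule test_error_le[OF pos(4,2)])
      fix j :: real and i assume j: "j = 1 \<or> j = -1" and i: "i < n"
      let ?A = "{z \<in> space ?G. j * network d m (R.W t) (vscale j \<mu>, \<lambda>k. \<xi> i k + z k) < 0}"
      let ?D = "\<lambda>r. {z \<in> space ?G. R.G j t / 2 \<le> dot d z (R.W t (- j, r))}"
      note ctx = s1 t(1) t' j
      have G1: "1 \<le> R.G j t" by (rule R.G_ge_1[OF ctx])
      have D: "?D r \<in> sets ?G" for r
        by (intro borel_measurable_le borel_measurable_const borel_measurable_dot_gauss)
      have "?A \<subseteq> (\<Union>r<m. ?D r)"
      proof
        fix z assume z: "z \<in> ?A"
        show "z \<in> (\<Union>r<m. ?D r)"
        proof (rule ccontr)
          assume "z \<notin> (\<Union>r<m. ?D r)"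
          then have "dot d (R.W t (- j, r)) z \<le> R.G j t / 2" if "r < m" for r
          proof -
            have "\<not> R.G j t / 2 \<le> dot d z (R.W t (- j, r))" using \<open>z \<notin> (\<Union>r<m. ?D r)\<close> z that by blast
            then show ?thesis by (subst dot_commute) linarith
          qed
          then show False using R.test_margin[OF ctx i, of z] z by auto
        qed
      qed
      then have "G.prob ?A \<le> G.prob (\<Union>r<m. ?D r)" using D by (intro G.finite_measure_mono) auto
      also have "\<dots> \<le> (\<Sum>r<m. G.prob (?D r))" using D by (intro measure_UNION_le) auto
      \<comment> \<open>64000 = 4 * 2 * 8000: the squared threshold (G / 2)^2 is divided by twice
        the variance bound 8000 * (n / (s d)) * G^2, and G cancels.\<close>
      also have "\<dots> \<le> (\<Sum>r<m. exp (- (s * real d / (64000 * real n))))"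
      proof (rule sum_mono)
        fix r assume "r \<in> {..<m}"
        then have r: "r < m" by simp
        define Bd where "Bd = 8000 * (real n / (s * real d)) * (R.G j t)\<^sup>2 / \<sigma>\<^sup>2"
        have Bd: "0 < Bd" using pos s_pos G1 by (simp add: Bd_def)
        have "(- j, r) \<in> neurons m" using j r by (auto simp: neurons_iff)
        then have "dot d (W0 (- j, r)) (W0 (- j, r)) \<le> 2 * (\<sigma>\<^sub>0\<^sup>2 * real d)"
          using init unfolding good_init_def by blast
        then have "\<sigma>\<^sup>2 * dot d (W0 (- j, r)) (W0 (- j, r)) \<le> \<sigma>\<^sup>2 * (2 * (\<sigma>\<^sub>0\<^sup>2 * real d))"
          by (intro mult_left_mono) auto
        also note init_norm
        finally have "\<sigma>\<^sup>2 * dot d (R.W t (- j, r)) (R.W t (- j, r)) \<le> 8000 * (real n / (s * real d)) * (R.G j t)\<^sup>2"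
          using R.weight_norm[OF ctx r] by (simp only: qhs)
        then have "dot d (R.W t (- j, r)) (R.W t (- j, r)) \<le> Bd"
          unfolding Bd_def using pos by (subst pos_le_divide_eq) (simp_all add: mult.commute)
        then have "G.prob (?D r) \<le> exp (- (R.G j t / 2)\<^sup>2 / (2 * \<sigma>\<^sup>2 * Bd))"
          using G1 Bd pos by (intro gauss_tail) auto
        also have "- (R.G j t / 2)\<^sup>2 / (2 * \<sigma>\<^sup>2 * Bd) = - (s * real d / (64000 * real n))"
          using pos G1 s_pos by (simp add: Bd_def field_simps power2_eq_square)
        finally show "G.prob (?D r) \<le> exp (- (s * real d / (64000 * real n)))" .
      qed
      also have "\<dots> = real m * exp (- (s * real d / (64000 * real n)))" by simp
      also have "\<dots> \<le> exp (real d / real n) * exp (- (s * real d / (64000 * real n)))"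
        using width_le by (intro mult_right_mono) auto
      also have "\<dots> = exp (real d / real n * (1 - s / 64000))"
        unfolding exp_add[symmetric] using pos by (simp add: field_simps)
      also have "\<dots> \<le> bound"
      proof -
        \<comment> \<open>The factor B in the denominator absorbs one factor s, so that the
          quadratic exponent of the claim follows from the linear one.\<close>
        have "s\<^sup>2 / (K * B) \<le> s * B / (K * B)"
          unfolding power2_eq_square using C0_facts(1) s_pos KB by (intro divide_right_mono mult_left_mono) auto
        also have "\<dots> = s / K" using B_ge by simp
        also have "\<dots> \<le> s / 64000" using s_pos by (intro divide_left_mono) (auto simp: K_def)
        finally show ?thesis unfolding bound_eq by (simp add: mult_left_mono divide_right_mono)
      qed
      finally show "G.prob ?A \<le> bound" .
    qed
  qed
  \<comment> \<open>Rounding 1 / h up at most doubles it, since h \<le> 1; hence the window from 1 /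
    h to 2 / h.\<close>
  define T1 where "T1 = nat \<lceil>1 / h\<rceil>"
  have "0 \<le> 1 / h" using h_pos by simp
  then have "1 / h \<le> real T1" "real T1 \<le> 1 / h + 1" unfolding T1_def by linarith+
  moreover have "1 \<le> 1 / h" using h_bounds h_pos by (simp add: field_simps)
  ultimately have T1: "1 / h \<le> real T1" "real T1 \<le> 2 / h" by auto
  have hT1: "1 \<le> h * real T1" "h * real T1 \<le> 2" using T1 h_pos by (auto simp: field_simps)
  have "h * real T1 \<le> h * real T" using hT1 hT_ge_3 by linarith
  then have T1T: "T1 \<le> T" using h_pos by simp
  have late: "1 \<le> h * real t" if "T1 \<le> t" for t
  proof -
    have "h * real T1 \<le> h * real t" using that h_pos by simp
    then show ?thesis using hT1 by linarith
  qed
  have margin: "0 \<le> R.M i t" if "T1 \<le> t" "t \<le> T" "i < n" for t i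
    using R.margin_nonneg[of t i] late that by (simp add: qhs)
  obtain t where t: "T1 \<le> t" "t \<le> T" "train_loss d n m \<mu> y \<xi> (R.W t) \<le> \<epsilon>"
    using R.small_loss_time[of T1 \<epsilon>] hT1 T1T pos(7) loss_condition unfolding qhs by blast
  show ?thesis
    unfolding success_def
  proof (rule exI[of _ T1], intro conjI exI[of _ t] allI impI)
    show "time_scale d n m \<sigma> \<eta> \<le> real T1" "real T1 \<le> 2 * time_scale d n m \<sigma> \<eta>"
      using T1 by (simp_all add: time_scale_eq)
    show "test_error d n m \<mu> \<sigma> \<xi> (gd d n m \<mu> \<eta> y \<xi> W0 t)
        \<le> exp (real d / real n - real n * vnorm d \<mu> ^ 4 / (3 * 10 ^ 7 * B * \<sigma> ^ 4 * real d))"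
      using te[OF t(2) late[OF t(1)]] by (simp add: bound_def K_def R.W_def)
  qed (use t margin in \<open>auto simp: R.M_def R.W_def\<close>)
qed

lemma main:
  assumes even: "even n"
  shows "1 - 18 * \<delta> \<le> cond_prob (sample_space d n m \<sigma> \<sigma>\<^sub>0)
    (\<lambda>(y, \<xi>, W0). success d n m \<mu> \<sigma> \<eta> \<epsilon> T (time_scale d n m \<sigma> \<eta>) (2 * time_scale d n m \<sigma> \<eta>)
      (exp (real d / real n - real n * vnorm d \<mu> ^ 4 / ((3 * 10 ^ 7 * B) * \<sigma> ^ 4 * real d))) y \<xi> W0)
    (\<lambda>(y, \<xi>, W0). balanced n y)"
proof -
  let ?N = "PiM {..<n} (\<lambda>_. gauss d \<sigma>)" and ?P = "PiM (neurons m) (\<lambda>_. gauss d \<sigma>\<^sub>0)"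
  let ?S = "success d n m \<mu> \<sigma> \<eta> \<epsilon> T (time_scale d n m \<sigma> \<eta>) (2 * time_scale d n m \<sigma> \<eta>)
      (exp (real d / real n - real n * vnorm d \<mu> ^ 4 / ((3 * 10 ^ 7 * B) * \<sigma> ^ 4 * real d)))"
  interpret N: prob_space ?N by (intro prob_space_PiM prob_space_gauss pos)
  interpret P: prob_space ?P by (intro prob_space_PiM prob_space_gauss pos)
  interpret NP: pair_prob_space ?N ?P ..
  have space: "sample_space d n m \<sigma> \<sigma>\<^sub>0 = label_space n \<Otimes>\<^sub>M (?N \<Otimes>\<^sub>M ?P)"
    by (simp add: sample_space_def label_space_def)
  let ?M = "label_space n \<Otimes>\<^sub>M (?N \<Otimes>\<^sub>M ?P)"
  note good = good_event_prob[OF pos(4,5,1,2,3) _ pos(8) \<delta>_less \<epsilon>_nonneg u_le(1) v_le(1) tail_bounds,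
      folded \<mu>2_def, OF \<mu>2_pos, unfolded \<mu>2_def]
  have "{x \<in> space ?M. ?S (fst x) (fst (snd x)) (snd (snd x))} \<in> sets ?M"
  proof (rule sets_success[OF pos(4,2)])
    show "(\<lambda>x. fst x i) \<in> borel_measurable ?M" if "i < n" for i
      by (rule measurable_compose[OF measurable_fst measurable_label[OF that, of "\<lambda>x. x"]])
    show "(\<lambda>x. fst (snd x) i k) \<in> borel_measurable ?M" if "i < n" "k < d" for i k
      by (rule measurable_compose[OF measurable_snd], rule measurable_compose[OF measurable_fst])
         (use that in \<open>auto intro!: measurable_PiM_gauss_component\<close>)
    show "(\<lambda>x. snd (snd x) (j, r) k) \<in> borel_measurable ?M" if "j = 1 \<or> j = -1" "r < m" "k < d" for j r k
      by (rule measurable_compose[OF measurable_snd], rule measurable_compose[OF measurable_snd])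
         (use that in \<open>auto intro!: measurable_PiM_gauss_component simp: neurons_iff\<close>)
  qed
  from cond_prob_balanced_ge[where S = "\<lambda>y z. ?S y (fst z) (snd z)", OF NP.P.prob_space_axioms even this good]
  have "1 - 18 * \<delta> \<le> cond_prob ?M (\<lambda>(y, z). ?S y (fst z) (snd z)) (\<lambda>(y, z). balanced n y)"
    using success by blast
  moreover have "(\<lambda>(y, z). ?S y (fst z) (snd z)) = (\<lambda>(y, \<xi>, W0). ?S y \<xi> W0)"
    "(\<lambda>(y, z :: (nat \<Rightarrow> vec) \<times> weights). balanced n y) = (\<lambda>(y, \<xi>, W0). balanced n y)"
    by (simp_all add: fun_eq_iff)
  ultimately show ?thesis unfolding space by (simp only:)
qed

end

theorem theorem4p4:
  shows "\<exists>K>0. \<forall>a b \<epsilon>max. 0 < a \<and> a \<le> b \<and> 0 < \<epsilon>max \<longrightarrow>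
    (\<exists>C\<^sub>D>0. C\<^sub>D \<le> K * max 1 b \<and> (\<exists>c>0. \<exists>c\<^sub>1>0. \<exists>c\<^sub>2>0. \<exists>\<kappa>>0. \<exists>p::nat. \<forall>\<kappa>'>0. \<forall>p'::nat. \<exists>C>0.
      \<forall>(d::nat) (n::nat) (m::nat) (\<mu>::vec) (\<sigma>\<^sub>\<xi>::real) (\<sigma>\<^sub>0::real) (\<eta>::real) (\<epsilon>::real) (\<delta>::real) (T::nat).
        0 < d \<and> 0 < n \<and> even n \<and> 0 < m \<and> (\<exists>k<d. \<mu> k \<noteq> 0) \<and>
        0 < \<sigma>\<^sub>\<xi> \<and> 0 < \<sigma>\<^sub>0 \<and> 0 < \<eta> \<and> 0 < \<epsilon> \<and> \<epsilon> \<le> \<epsilon>max \<and> 0 < \<delta> \<and> \<delta> < 1 \<and>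
        \<kappa> * log_factor d n m \<epsilon> \<delta> ^ p * (time_scale d n m \<sigma>\<^sub>\<xi> \<eta> / \<epsilon>) \<le> real T \<and>
        real T \<le> \<kappa>' * log_factor d n m \<epsilon> \<delta> ^ p' * (time_scale d n m \<sigma>\<^sub>\<xi> \<eta> / \<epsilon>) \<and>
        condition_C0 a b C d n m \<mu> \<sigma>\<^sub>\<xi> \<sigma>\<^sub>0 \<eta> \<delta> T
        \<longrightarrow>
        cond_prob (sample_space d n m \<sigma>\<^sub>\<xi> \<sigma>\<^sub>0)
          (\<lambda>(y, \<xi>, W0). \<exists>T\<^sub>1::nat.
             c\<^sub>1 * time_scale d n m \<sigma>\<^sub>\<xi> \<eta> \<le> real T\<^sub>1 \<and> real T\<^sub>1 \<le> c\<^sub>2 * time_scale d n m \<sigma>\<^sub>\<xi> \<eta> \<and>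
             (\<forall>t. T\<^sub>1 \<le> t \<and> t \<le> T \<longrightarrow>
                (\<forall>i<n. y i * network d m (gd d n m \<mu> \<eta> y \<xi> W0 t) (train_input \<mu> y \<xi> i) \<ge> 0)) \<and>
             (\<exists>t. T\<^sub>1 \<le> t \<and> t \<le> T \<and>
                train_loss d n m \<mu> y \<xi> (gd d n m \<mu> \<eta> y \<xi> W0 t) \<le> \<epsilon> \<and>
                (\<forall>i<n. y i * network d m (gd d n m \<mu> \<eta> y \<xi> W0 t) (train_input \<mu> y \<xi> i) \<ge> 0) \<and>
                test_error d n m \<mu> \<sigma>\<^sub>\<xi> \<xi> (gd d n m \<mu> \<eta> y \<xi> W0 t)
                  \<le> exp (real d / real n - real n * vnorm d \<mu> ^ 4 / (C\<^sub>D * \<sigma>\<^sub>\<xi> ^ 4 * real d))))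
          (\<lambda>(y, \<xi>, W0). balanced n y)
        \<ge> 1 - c * \<delta>))"
proof -
  have main: "1 - 18 * \<delta> \<le> cond_prob (sample_space d n m \<sigma> \<sigma>\<^sub>0)
    (\<lambda>(y, \<xi>, W0). success d n m \<mu> \<sigma> \<eta> \<epsilon> T (1 * time_scale d n m \<sigma> \<eta>) (2 * time_scale d n m \<sigma> \<eta>)
      (exp (real d / real n - real n * vnorm d \<mu> ^ 4 / ((3 * 10 ^ 7 * max 1 b) * \<sigma> ^ 4 * real d))) y \<xi> W0)
    (\<lambda>(y, \<xi>, W0). balanced n y)"
    if H: "0 < d \<and> 0 < n \<and> even n \<and> 0 < m \<and> (\<exists>k<d. \<mu> k \<noteq> 0) \<and>
        0 < \<sigma> \<and> 0 < \<sigma>\<^sub>0 \<and> 0 < \<eta> \<and> 0 < \<epsilon> \<and> \<epsilon> \<le> \<epsilon>max \<and> 0 < \<delta> \<and> \<delta> < 1 \<and>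
        (200 + 3 * \<epsilon>max) * log_factor d n m \<epsilon> \<delta> ^ 1 * (time_scale d n m \<sigma> \<eta> / \<epsilon>) \<le> real T \<and>
        real T \<le> \<kappa>' * log_factor d n m \<epsilon> \<delta> ^ p' * (time_scale d n m \<sigma> \<eta> / \<epsilon>) \<and>
        condition_C0 a b (regime_const b) d n m \<mu> \<sigma> \<sigma>\<^sub>0 \<eta> \<delta> T"
    for a b \<epsilon>max \<kappa>' p' d n m \<mu> \<sigma> \<sigma>\<^sub>0 \<eta> \<epsilon> \<delta> T
  proof -
    interpret regime d n m \<mu> \<sigma> \<sigma>\<^sub>0 \<eta> \<epsilon> \<delta> T a b \<epsilon>max
      using H by unfold_locales auto
    show ?thesis using main H by (simp add: B_def)
  qed
  have K: "0 < (3 * 10 ^ 7 :: real)" by simp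
  show ?thesis
  proof (rule exI[of _ "3 * 10 ^ 7"], intro conjI K allI impI, goal_cases)
    case (1 a b \<epsilon>max)
    have C: "0 < regime_const b" using noise_tol[of b] by (simp add: regime_const_def)
    show ?case
      unfolding success_def[symmetric]
      \<comment> \<open>18 = 6 + 12 counts the failures of noise and initialization, and 1 and 2
        delimit the starting time. \<kappa> = 200 + 3 * \<epsilon>max with p = 1 is the size of T
        used in \<open>loss_condition\<close>; C is a function of b alone and therefore serves every
        \<kappa>' and p'.\<close>
      by (rule exI[of _ "3 * 10 ^ 7 * max 1 b"], intro conjI order_refl,
          simp, rule exI[of _ 18], intro conjI, simp, rule exI[of _ 1], intro conjI, simp,
          rule exI[of _ 2], intro conjI, simp, rule exI[of _ "200 + 3 * \<epsilon>max"], intro conjI,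
          use 1 in simp, rule exI[of _ 1], intro allI impI, rule exI[of _ "regime_const b"],
          intro conjI C allI impI, erule main)
  qed
qed

end
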